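(* Let $B$ be a finite left regular band and $\Bbbk$ a field. Then the quiver $Q(\Bbbk B)$ has vertex set $\Lambda(B)$ (with $X\in\Lambda(B)$ corresponding to the isomorphism class of the simple module $\Bbbk_X$). The number of arrows from $X$ to $Y$ is zero unless $X<Y$, in which case it is one less than the number of connected components of $\Delta(X,Y)$.
   Context: A left regular band is a monoid $B$ satisfying $x^2=x$ and $xyx=xy$ for all $x,y\in B$. For finite $B$, $\Lambda(B)$ denotes the lattice of principal left ideals $Bb$ ($b\in B$) ordered by inclusion, and $\sigma\colon B\to\Lambda(B)$ is the support map $\sigma(b)=Bb$. $B$ is partially ordered by $a\le b$ iff $ba=a$. For $X<Y$ in $\Lambda(B)$ choose $e\in B$ with $\sigma(e)=Y$ and put $B[X,Y)=\{b\in B\mid b\le e,\ b\ne e,\ \sigma(b)\ge X\}$ (independent of $e$ up to isomorphism). $\Delta(X,Y)$ is the order complex of the poset $(B[X,Y),\le)$: the simplicial complex with vertex set $B[X,Y)$ whose simplices are the finite chains. $\Bbbk_X$ is the left $\Bbbk B$-module with underlying space $\Bbbk$ and action $b\cdot\alpha=\alpha$ if $\sigma(b)\ge X$, and $b\cdot\alpha=0$ otherwise; when $\Bbbk$ is a field these modules form a complete set of pairwise non-isomorphic simple $\Bbbk B$-modules. A finite dimensional algebra is split basic if all its simple modules are one-dimensional; the (Gabriel) quiver $Q(A)$ of a unital split basic $\Bbbk$-algebra $A$ is the directed graph with vertices the isomorphism classes of simple $A$-modules and with $\dim_{\Bbbk}\operatorname{Ext}^1_A(S_1,S_2)$ edges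 from $S_1$ to $S_2$. *)

theory Defs
  imports "HOL-Algebra.Module" "HOL-Algebra.AbelCoset" "HOL-Library.Extended_Nat"
    "Jordan_Normal_Form.Missing_VectorSpace"
begin

section \<open>Left modules over a not necessarily commutative ring\<close>

text \<open>
  The library locale \<^locale>\<open>module\<close> demands a commutative ring of scalars. As there, the fields
  \<^const>\<open>monoid.mult\<close> and \<^const>\<open>monoid.one\<close> of a module record carry no information.
\<close>

locale left_module = R?: ring R + M?: abelian_group M
  for R :: "('a, 'c) ring_scheme" (structure) and M :: "('a, 'm, 'd) module_scheme" (structure) +
  assumes smult_closed:
      "\<lbrakk>a \<in> carrier R; x \<in> carrier M\<rbrakk> \<Longrightarrow> a \<odot>\<^bsub>M\<^esub> x \<in> carrier M"
    and smult_l_distr: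
      "\<lbrakk>a \<in> carrier R; b \<in> carrier R; x \<in> carrier M\<rbrakk> \<Longrightarrow>
        (a \<oplus> b) \<odot>\<^bsub>M\<^esub> x = a \<odot>\<^bsub>M\<^esub> x \<oplus>\<^bsub>M\<^esub> b \<odot>\<^bsub>M\<^esub> x"
    and smult_r_distr:
      "\<lbrakk>a \<in> carrier R; x \<in> carrier M; y \<in> carrier M\<rbrakk> \<Longrightarrow>
        a \<odot>\<^bsub>M\<^esub> (x \<oplus>\<^bsub>M\<^esub> y) = a \<odot>\<^bsub>M\<^esub> x \<oplus>\<^bsub>M\<^esub> a \<odot>\<^bsub>M\<^esub> y"
    and smult_assoc:
      "\<lbrakk>a \<in> carrier R; b \<in> carrier R; x \<in> carrier M\<rbrakk> \<Longrightarrow>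
        (a \<otimes> b) \<odot>\<^bsub>M\<^esub> x = a \<odot>\<^bsub>M\<^esub> (b \<odot>\<^bsub>M\<^esub> x)"
    and smult_one:
      "x \<in> carrier M \<Longrightarrow> \<one> \<odot>\<^bsub>M\<^esub> x = x"

text \<open>
  \<open>Module.submodule\<close> has to be qualified: the locale of the same name from the vector space
  library presupposes commutative scalars.
\<close>

definition simple_module :: "('a, 'c) ring_scheme \<Rightarrow> ('a, 'm) module \<Rightarrow> bool" where
  "simple_module A M \<longleftrightarrow> left_module A M \<and> carrier M \<noteq> {\<zero>\<^bsub>M\<^esub>} \<and>
     (\<forall>H. Module.submodule H A M \<longrightarrow> H = {\<zero>\<^bsub>M\<^esub>} \<or> H = carrier M)"

definition modules_isomorphic ::
    "('a, 'c) ring_scheme \<Rightarrow> ('a, 'm) module \<Rightarrow> ('a, 'n) module \<Rightarrow> bool" where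
  "modules_isomorphic A M N \<longleftrightarrow> (\<exists>f \<in> module_hom A M N. bij_betw f (carrier M) (carrier N))"

definition quotient_module :: "('a, 'm) module \<Rightarrow> 'm set \<Rightarrow> ('a, 'm set) module" where
  "quotient_module M H = \<lparr>carrier = a_rcosets\<^bsub>M\<^esub> H, mult = undefined, one = undefined,
     zero = H, add = set_add M, smult = (\<lambda>a S. \<Union>x\<in>S. H +>\<^bsub>M\<^esub> (a \<odot>\<^bsub>M\<^esub> x))\<rparr>"

section \<open>The first Ext space\<close>

text \<open>
  A \<open>K\<close>-algebra is given by a record of type \<^typ>\<open>('k, 'a) module\<close>, whose ring part is the underlying
  ring and whose scalar multiplication is the action of \<open>K\<close>. For a \<open>K\<close>-algebra \<open>A\<close>, a scalar \<open>c\<close>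
  acts on an \<open>A\<close>-module through \<open>c \<cdot> 1\<close>; this makes \<open>Hom\<^sub>A(M, N)\<close> a space over \<open>K\<close>.
\<close>

definition hom_space ::
    "('k, 'a) module \<Rightarrow> ('a, 'm) module \<Rightarrow> ('a, 'n) module \<Rightarrow> ('k, 'm \<Rightarrow> 'n) module" where
  "hom_space A M N = \<lparr>carrier = module_hom A M N \<inter> extensional (carrier M),
     mult = undefined, one = undefined,
     zero = (\<lambda>x\<in>carrier M. \<zero>\<^bsub>N\<^esub>),
     add = (\<lambda>f g. \<lambda>x\<in>carrier M. f x \<oplus>\<^bsub>N\<^esub> g x),
     smult = (\<lambda>c f. \<lambda>x\<in>carrier M. (c \<odot>\<^bsub>A\<^esub> \<one>\<^bsub>A\<^esub>) \<odot>\<^bsub>N\<^esub> f x)\<rparr>"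

definition free_module :: "('a, 'c) ring_scheme \<Rightarrow> 's set \<Rightarrow> ('a, 's \<Rightarrow> 'a) module" where
  "free_module A S = \<lparr>carrier = {f. (\<forall>s. f s \<in> carrier A) \<and> (\<forall>s. s \<notin> S \<longrightarrow> f s = \<zero>\<^bsub>A\<^esub>) \<and>
       finite {s. f s \<noteq> \<zero>\<^bsub>A\<^esub>}},
     mult = undefined, one = undefined,
     zero = (\<lambda>s. \<zero>\<^bsub>A\<^esub>),
     add = (\<lambda>f g s. f s \<oplus>\<^bsub>A\<^esub> g s),
     smult = (\<lambda>a f s. a \<otimes>\<^bsub>A\<^esub> f s)\<rparr>"

text \<open>
  For \<open>S \<subseteq> carrier M\<close>, the linear map from the free module on \<open>S\<close> to \<open>M\<close> that extends the inclusion
  of \<open>S\<close>; its image is the submodule generated by \<open>S\<close>.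
\<close>

definition free_eval :: "('a, 'c) ring_scheme \<Rightarrow> ('a, 'm) module \<Rightarrow> ('m \<Rightarrow> 'a) \<Rightarrow> 'm" where
  "free_eval A M f = (\<Oplus>\<^bsub>M\<^esub>s\<in>{s. f s \<noteq> \<zero>\<^bsub>A\<^esub>}. f s \<odot>\<^bsub>M\<^esub> s)"

text \<open>
  The beginning \<open>F\<^sub>2 \<rightarrow> F\<^sub>1 \<rightarrow> F\<^sub>0 \<rightarrow> M \<rightarrow> 0\<close> of the canonical free resolution of \<open>M\<close>: \<open>F\<^sub>0\<close> is free on
  the elements of \<open>M\<close>, and each further term is free on the elements of the kernel of the preceding
  map. All the maps are given by \<^const>\<open>free_eval\<close>.
\<close>

definition resolution0 :: "('a, 'c) ring_scheme \<Rightarrow> ('a, 'm) module \<Rightarrow> ('a, 'm \<Rightarrow> 'a) module" where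
  "resolution0 A M = free_module A (carrier M)"

definition resolution1 ::
    "('a, 'c) ring_scheme \<Rightarrow> ('a, 'm) module \<Rightarrow> ('a, ('m \<Rightarrow> 'a) \<Rightarrow> 'a) module" where
  "resolution1 A M = free_module A (a_kernel (resolution0 A M) M (free_eval A M))"

definition resolution2 ::
    "('a, 'c) ring_scheme \<Rightarrow> ('a, 'm) module \<Rightarrow> ('a, (('m \<Rightarrow> 'a) \<Rightarrow> 'a) \<Rightarrow> 'a) module" where
  "resolution2 A M =
     free_module A (a_kernel (resolution1 A M) (resolution0 A M) (free_eval A (resolution0 A M)))"

definition ext1_cocycles ::
    "('a, 'c) ring_scheme \<Rightarrow> ('a, 'm) module \<Rightarrow> ('a, 'n) module \<Rightarrow> ((('m \<Rightarrow> 'a) \<Rightarrow> 'a) \<Rightarrow> 'n) set" where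
  "ext1_cocycles A M N =
     {f \<in> module_hom A (resolution1 A M) N \<inter> extensional (carrier (resolution1 A M)).
        \<forall>x\<in>carrier (resolution2 A M). f (free_eval A (resolution1 A M) x) = \<zero>\<^bsub>N\<^esub>}"

definition ext1_coboundaries ::
    "('a, 'c) ring_scheme \<Rightarrow> ('a, 'm) module \<Rightarrow> ('a, 'n) module \<Rightarrow> ((('m \<Rightarrow> 'a) \<Rightarrow> 'a) \<Rightarrow> 'n) set" where
  "ext1_coboundaries A M N =
     (\<lambda>g. \<lambda>x\<in>carrier (resolution1 A M). g (free_eval A (resolution0 A M) x)) `
       module_hom A (resolution0 A M) N"

definition ext1 :: "('k, 'a) module \<Rightarrow> ('a, 'm) module \<Rightarrow> ('a, 'n) module \<Rightarrow>
    ('k, ((('m \<Rightarrow> 'a) \<Rightarrow> 'a) \<Rightarrow> 'n) set) module" where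
  "ext1 A M N =
     quotient_module ((hom_space A (resolution1 A M) N)\<lparr>carrier := ext1_cocycles A M N\<rparr>)
       (ext1_coboundaries A M N)"

text \<open>The library's \<^const>\<open>vectorspace.dim\<close> is meaningful for finite dimensional spaces only.\<close>

definition vs_dim :: "('k, 'c) ring_scheme \<Rightarrow> ('k, 'v) module \<Rightarrow> enat" where
  "vs_dim K V = (if vectorspace.fin_dim K V then enat (vectorspace.dim K V) else \<infinity>)"

section \<open>The Gabriel quiver\<close>

record 'v quiver =
  verts :: "'v set"
  num_arrows :: "'v \<Rightarrow> 'v \<Rightarrow> enat"

text \<open>
  An isomorphism class of simple \<open>A\<close>-modules is represented by its members whose elements belong to
  the type of the elements of \<open>A\<close>. By \<open>simple_module_realization\<close> below, every simple \<open>A\<close>-module,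
  whatever the type of its elements, has an isomorphic copy of that kind, so no class is lost.
\<close>

definition simple_class :: "('a, 'c) ring_scheme \<Rightarrow> ('a, 'm) module \<Rightarrow> ('a, 'a) module set" where
  "simple_class A S = {T. simple_module A T \<and> modules_isomorphic A T S}"

definition gabriel_quiver ::
    "('k, 'c) ring_scheme \<Rightarrow> ('k, 'a) module \<Rightarrow> ('a, 'a) module set quiver" where
  "gabriel_quiver K A = \<lparr>verts = {simple_class A S | S. simple_module A (S :: ('a, 'a) module)},
     num_arrows = (\<lambda>C D. vs_dim K (ext1 A (SOME S. S \<in> C) (SOME T. T \<in> D)))\<rparr>"

lemma simple_module_realization:
  fixes A :: "('a, 'c) ring_scheme" and S :: "('a, 'm) module"
  assumes "simple_module A S"
  shows "\<exists>T :: ('a, 'a) module. simple_module A T \<and> modules_isomorphic A T S"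
proof -
  interpret left_module A S using assms by (simp add: simple_module_def)
  have nz: "carrier S \<noteq> {\<zero>\<^bsub>S\<^esub>}"
    and sub: "\<And>H. Module.submodule H A S \<Longrightarrow> H = {\<zero>\<^bsub>S\<^esub>} \<or> H = carrier S"
    using assms by (auto simp: simple_module_def)
  obtain s where s: "s \<in> carrier S" "s \<noteq> \<zero>\<^bsub>S\<^esub>"
    using nz M.zero_closed by blast
  define p where "p = (\<lambda>a. a \<odot>\<^bsub>S\<^esub> s)"
  have pc: "p a \<in> carrier S" if "a \<in> carrier A" for a
    using that s by (simp add: p_def smult_closed)
  have padd: "p (a \<oplus>\<^bsub>A\<^esub> b) = p a \<oplus>\<^bsub>S\<^esub> p b" if "a \<in> carrier A" "b \<in> carrier A" for a b
    using that s by (simp add: p_def smult_l_distr)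
  have p0: "p \<zero>\<^bsub>A\<^esub> = \<zero>\<^bsub>S\<^esub>"
    using padd[of "\<zero>\<^bsub>A\<^esub>" "\<zero>\<^bsub>A\<^esub>"] pc[of "\<zero>\<^bsub>A\<^esub>"] by simp
  have pneg: "\<ominus>\<^bsub>S\<^esub> (p a) = p (\<ominus>\<^bsub>A\<^esub> a)" if "a \<in> carrier A" for a
  proof -
    have "p (\<ominus>\<^bsub>A\<^esub> a) \<oplus>\<^bsub>S\<^esub> p a = \<zero>\<^bsub>S\<^esub>"
      using that p0 by (simp flip: padd add: R.l_neg)
    then show ?thesis
      using that pc by (simp add: M.minus_equality)
  qed
  have subm: "Module.submodule (p ` carrier A) A S"
  proof (intro Module.submodule.intro subgroup.intro Module.submodule_axioms.intro)
    show "p ` carrier A \<subseteq> carrier (add_monoid S)" using pc by auto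
    show "\<one>\<^bsub>add_monoid S\<^esub> \<in> p ` carrier A" using p0 by (auto intro!: image_eqI[of _ p "\<zero>\<^bsub>A\<^esub>"])
    show "x \<otimes>\<^bsub>add_monoid S\<^esub> y \<in> p ` carrier A" if "x \<in> p ` carrier A" "y \<in> p ` carrier A" for x y
      using that by (auto simp flip: padd)
    show "inv\<^bsub>add_monoid S\<^esub> x \<in> p ` carrier A" if "x \<in> p ` carrier A" for x
      using that pneg by (auto simp flip: a_inv_def)
    show "a \<odot>\<^bsub>S\<^esub> x \<in> p ` carrier A" if "a \<in> carrier A" "x \<in> p ` carrier A" for a x
    proof -
      obtain b where b: "b \<in> carrier A" "x = p b" using \<open>x \<in> p ` carrier A\<close> by auto
      then have "a \<odot>\<^bsub>S\<^esub> x = p (a \<otimes>\<^bsub>A\<^esub> b)"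
        using that s by (simp add: p_def smult_assoc)
      then show ?thesis using that b by auto
    qed
  qed
  have "p \<one>\<^bsub>A\<^esub> = s" using s by (simp add: p_def smult_one)
  then have "s \<in> p ` carrier A" by (auto intro!: image_eqI[of _ p "\<one>\<^bsub>A\<^esub>"])
  then have im: "p ` carrier A = carrier S" using sub[OF subm] s by auto
  define g where "g = inv_into (carrier A) p"
  have pg[simp]: "p (g x) = x" if "x \<in> carrier S" for x
    using that im by (auto simp: g_def f_inv_into_f)
  define T :: "('a, 'a) module" where "T = \<lparr>carrier = g ` carrier S, mult = undefined,
    one = undefined, zero = g \<zero>\<^bsub>S\<^esub>, add = (\<lambda>x y. g (p x \<oplus>\<^bsub>S\<^esub> p y)),
    smult = (\<lambda>a x. g (a \<odot>\<^bsub>S\<^esub> p x))\<rparr>"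
  have bij: "bij_betw p (carrier T) (carrier S)"
    by (auto simp: bij_betw_def T_def inj_on_def image_iff)
  have T: "carrier T = g ` carrier S" "\<zero>\<^bsub>T\<^esub> = g \<zero>\<^bsub>S\<^esub>"
    "\<And>x y. x \<oplus>\<^bsub>T\<^esub> y = g (p x \<oplus>\<^bsub>S\<^esub> p y)" "\<And>a x. a \<odot>\<^bsub>T\<^esub> x = g (a \<odot>\<^bsub>S\<^esub> p x)"
    by (auto simp: T_def)
  have agT: "abelian_group T"
  proof (rule abelian_groupI)
    fix x assume "x \<in> carrier T"
    then obtain u where u: "u \<in> carrier S" "x = g u" by (auto simp: T)
    show "\<exists>y\<in>carrier T. y \<oplus>\<^bsub>T\<^esub> x = \<zero>\<^bsub>T\<^esub>"
      using u by (intro bexI[of _ "g (\<ominus>\<^bsub>S\<^esub> u)"]) (auto simp: T M.l_neg)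
  qed (auto simp: T M.add.m_ac)
  have lmT: "left_module A T"
    by (intro left_module.intro R.ring_axioms agT left_module_axioms.intro)
      (auto simp: T smult_closed smult_l_distr smult_r_distr smult_assoc smult_one)
  have hom: "p \<in> module_hom A T S"
    by (auto simp: module_hom_def T smult_closed)
  have ntT: "carrier T \<noteq> {\<zero>\<^bsub>T\<^esub>}"
  proof
    assume "carrier T = {\<zero>\<^bsub>T\<^esub>}"
    then have "g s = g \<zero>\<^bsub>S\<^esub>" using s by (auto simp: T)
    then show False using s pg[of s] pg[of "\<zero>\<^bsub>S\<^esub>"] by simp
  qed
  have "H = {\<zero>\<^bsub>T\<^esub>} \<or> H = carrier T" if H: "Module.submodule H A T" for H
  proof -
    interpret T: left_module A T by (rule lmT)
    have Hsub: "H \<subseteq> carrier T" and H0: "\<zero>\<^bsub>T\<^esub> \<in> H"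
      and Hadd: "\<And>x y. x \<in> H \<Longrightarrow> y \<in> H \<Longrightarrow> x \<oplus>\<^bsub>T\<^esub> y \<in> H"
      and Hinv: "\<And>x. x \<in> H \<Longrightarrow> \<ominus>\<^bsub>T\<^esub> x \<in> H"
      and Hsm: "\<And>a x. a \<in> carrier A \<Longrightarrow> x \<in> H \<Longrightarrow> a \<odot>\<^bsub>T\<^esub> x \<in> H"
      using H unfolding Module.submodule_def subgroup_def Module.submodule_axioms_def
      by (auto simp: a_inv_def)
    have gp: "g (p x) = x" if "x \<in> H" for x
      using that Hsub by (auto simp: T)
    have pS: "p x \<in> carrier S" if "x \<in> H" for x
      using that Hsub bij by (auto simp: bij_betw_def)
    have "Module.submodule (p ` H) A S"
    proof (intro Module.submodule.intro subgroup.intro Module.submodule_axioms.intro)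
      show "p ` H \<subseteq> carrier (add_monoid S)" using pS by auto
      show "\<one>\<^bsub>add_monoid S\<^esub> \<in> p ` H"
        using H0 by (auto simp: T intro!: image_eqI[of _ p "g \<zero>\<^bsub>S\<^esub>"])
      show "x \<otimes>\<^bsub>add_monoid S\<^esub> y \<in> p ` H" if xy: "x \<in> p ` H" "y \<in> p ` H" for x y
      proof -
        obtain u v where uv: "u \<in> H" "v \<in> H" "x = p u" "y = p v" using xy by auto
        then have "x \<oplus>\<^bsub>S\<^esub> y = p (u \<oplus>\<^bsub>T\<^esub> v)" using pS by (simp add: T)
        then show ?thesis using Hadd uv by simp
      qed
      show "inv\<^bsub>add_monoid S\<^esub> x \<in> p ` H" if x: "x \<in> p ` H" for x
      proof -
        obtain u where u: "u \<in> H" "x = p u" using x by auto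
        have "\<zero>\<^bsub>S\<^esub> = p (\<ominus>\<^bsub>T\<^esub> u \<oplus>\<^bsub>T\<^esub> u)"
          using u Hsub by (subst T.M.l_neg) (auto simp: T(2))
        also have "\<dots> = p (\<ominus>\<^bsub>T\<^esub> u) \<oplus>\<^bsub>S\<^esub> p u"
          using u pS Hinv by (simp add: T(3))
        finally have "\<ominus>\<^bsub>S\<^esub> x = p (\<ominus>\<^bsub>T\<^esub> u)"
          using u pS Hinv by (simp add: M.minus_equality)
        then show ?thesis using Hinv u by (simp add: a_inv_def)
      qed
      show "a \<odot>\<^bsub>S\<^esub> x \<in> p ` H" if "a \<in> carrier A" and x: "x \<in> p ` H" for a x
      proof -
        obtain u where u: "u \<in> H" "x = p u" using x by auto
        then have "a \<odot>\<^bsub>S\<^esub> x = p (a \<odot>\<^bsub>T\<^esub> u)" using pS that by (simp add: T smult_closed)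
        then show ?thesis using Hsm u that by simp
      qed
    qed
    then have "p ` H = {\<zero>\<^bsub>S\<^esub>} \<or> p ` H = carrier S" by (rule sub)
    moreover have "g ` p ` H = H" using gp by (force simp: image_iff)
    ultimately show ?thesis by (auto simp: T(1,2))
  qed
  with lmT ntT have "simple_module A T" by (simp add: simple_module_def)
  with hom bij show ?thesis by (auto simp: modules_isomorphic_def)
qed

section \<open>Left regular bands\<close>

locale left_regular_band = monoid B for B (structure) +
  assumes idem: "x \<in> carrier B \<Longrightarrow> x \<otimes> x = x"
    and regular: "\<lbrakk>x \<in> carrier B; y \<in> carrier B\<rbrakk> \<Longrightarrow> x \<otimes> y \<otimes> x = x \<otimes> y"

definition support :: "('b, 'd) monoid_scheme \<Rightarrow> 'b \<Rightarrow> 'b set" where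
  "support B b = carrier B #>\<^bsub>B\<^esub> b"

definition support_lattice :: "('b, 'd) monoid_scheme \<Rightarrow> 'b set set" where
  "support_lattice B = support B ` carrier B"

definition band_le :: "('b, 'd) monoid_scheme \<Rightarrow> 'b \<Rightarrow> 'b \<Rightarrow> bool" where
  "band_le B a b \<longleftrightarrow> b \<otimes>\<^bsub>B\<^esub> a = a"

text \<open>The set \<open>B[X, Y)\<close> as computed from an element \<open>e\<close> with support \<open>Y\<close>.\<close>

definition band_interval :: "('b, 'd) monoid_scheme \<Rightarrow> 'b set \<Rightarrow> 'b \<Rightarrow> 'b set" where
  "band_interval B X e = {b \<in> carrier B. band_le B b e \<and> b \<noteq> e \<and> X \<subseteq> support B b}"

text \<open>Convolution is written for finite \<open>B\<close>, where no condition on supports is needed.\<close>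

definition monoid_algebra ::
    "('k, 'c) ring_scheme \<Rightarrow> ('b, 'd) monoid_scheme \<Rightarrow> ('k, 'b \<Rightarrow> 'k) module" where
  "monoid_algebra K B = \<lparr>carrier = carrier B \<rightarrow>\<^sub>E carrier K,
     mult = (\<lambda>f g. \<lambda>x\<in>carrier B.
       \<Oplus>\<^bsub>K\<^esub>p\<in>{p \<in> carrier B \<times> carrier B. fst p \<otimes>\<^bsub>B\<^esub> snd p = x}. f (fst p) \<otimes>\<^bsub>K\<^esub> g (snd p)),
     one = (\<lambda>x\<in>carrier B. if x = \<one>\<^bsub>B\<^esub> then \<one>\<^bsub>K\<^esub> else \<zero>\<^bsub>K\<^esub>),
     zero = (\<lambda>x\<in>carrier B. \<zero>\<^bsub>K\<^esub>),
     add = (\<lambda>f g. \<lambda>x\<in>carrier B. f x \<oplus>\<^bsub>K\<^esub> g x),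
     smult = (\<lambda>c f. \<lambda>x\<in>carrier B. c \<otimes>\<^bsub>K\<^esub> f x)\<rparr>"

text \<open>
  The module \<open>\<bbbk>\<^sub>X\<close>: \<open>b\<close> acts as the identity if \<open>\<sigma>(b) \<ge> X\<close> and as zero otherwise, extended linearly
  to the monoid algebra.
\<close>

definition support_module ::
    "('k, 'c) ring_scheme \<Rightarrow> ('b, 'd) monoid_scheme \<Rightarrow> 'b set \<Rightarrow> ('b \<Rightarrow> 'k, 'k) module" where
  "support_module K B X = \<lparr>carrier = carrier K, mult = undefined, one = undefined,
     zero = \<zero>\<^bsub>K\<^esub>, add = add K,
     smult = (\<lambda>f \<alpha>. \<Oplus>\<^bsub>K\<^esub>b\<in>carrier B. f b \<otimes>\<^bsub>K\<^esub> (if X \<subseteq> support B b then \<alpha> else \<zero>\<^bsub>K\<^esub>))\<rparr>"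

section \<open>Order complexes\<close>

definition order_complex :: "('p \<Rightarrow> 'p \<Rightarrow> bool) \<Rightarrow> 'p set \<Rightarrow> 'p set set" where
  "order_complex ord P = {s. finite s \<and> s \<subseteq> P \<and> Complete_Partial_Order.chain ord s}"

text \<open>
  A connected component of a simplicial complex is given by its set of vertices: two vertices lie in
  the same component iff they are joined by a path of edges. This agrees with the connected
  components of the geometric realization.
\<close>

definition complex_components :: "'p set set \<Rightarrow> 'p set set" where
  "complex_components \<Delta> = \<Union>\<Delta> // {(v, w) \<in> \<Union>\<Delta> \<times> \<Union>\<Delta>. (v, w) \<in> {(x, y). {x, y} \<in> \<Delta>}\<^sup>*}"

end

theory Submission
  imports Defs "HOL-Algebra.RingHom"
begin

text \<open>
  The group \<open>Ext\<^sup>1(\<bbbk>\<^sub>X, \<bbbk>\<^sub>Y)\<close> is the space of derivations \<open>d\<close> of \<open>B\<close>, that is, of functions with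
  \<open>d(ab) = \<chi>\<^sub>Y(a) d(b) + d(a) \<chi>\<^sub>X(b)\<close>, modulo the multiples of \<open>\<chi>\<^sub>Y - \<chi>\<^sub>X\<close>: a homomorphism \<open>h\<close> from the
  first syzygy of \<open>\<bbbk>\<^sub>X = \<bbbk>s\<close> to \<open>\<bbbk>\<^sub>Y\<close> corresponds to \<open>d(b) = h(b[s] - \<chi>\<^sub>X(b)[s])\<close>. If \<open>Y\<close> does not lie
  above \<open>X\<close>, expanding \<open>d(eb) = d(ebe)\<close> for an \<open>e\<close> with support \<open>Y\<close> shows that every derivation is inner.
  If \<open>X < Y = \<sigma>(e)\<close>, then \<open>d(b) = d(eb)\<close>, and restriction to \<open>B[X,Y)\<close> identifies the derivations with
  the functions that are constant on the connected components of \<open>\<Delta>(X,Y)\<close>, the inner ones being the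
  constant functions.
\<close>

section \<open>Finite sums\<close>

text \<open>\<open>ext1\<close> is built from the canonical free resolution, whose terms are free on
  whole modules and kernels; passing between cocycles and derivations is most of the work. A
  derivation remembers a homomorphism h on the first syzygy only at the elements (a - \<chi>(a))[s].
  That every derivation D arises is seen from the two-dimensional module with corner D, to which the
  free module maps. That h extends to the free module once its derivation is inner is seen from an
  additive, nonlinear retraction onto the syzygy, whose defect of linearity is measured by the
  derivation.

  No isomorphism of spaces is written down. Dimensions come from finitely many functionals that have
  a dual family of vectors and whose common kernel is the space divided out. For X < Y they are
  d(r_C) - d(r_0), where r_C is a chosen vertex of the component C and r_0 that of a fixed
  component; the fixed component accounts for the one that is subtracted.

  The quiver picks representatives with \<open>SOME\<close>, so Ext is computed for arbitrary
  modules isomorphic to those of X and Y, through coordinate maps to the field.\<close>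

lemma finsum_hom:
  assumes "abelian_monoid G" and "abelian_monoid H"
    and "f \<in> carrier G \<rightarrow> carrier H" and "f \<zero>\<^bsub>G\<^esub> = \<zero>\<^bsub>H\<^esub>"
    and "\<And>x y. \<lbrakk>x \<in> carrier G; y \<in> carrier G\<rbrakk> \<Longrightarrow> f (x \<oplus>\<^bsub>G\<^esub> y) = f x \<oplus>\<^bsub>H\<^esub> f y"
    and "finite I" and "g \<in> I \<rightarrow> carrier G"
  shows "f (finsum G g I) = (\<Oplus>\<^bsub>H\<^esub>i\<in>I. f (g i))"
proof -
  interpret G: abelian_monoid G by fact
  interpret H: abelian_monoid H by fact
  from \<open>finite I\<close> \<open>g \<in> I \<rightarrow> carrier G\<close> show ?thesis
  proof (induction I rule: finite_induct)
    case empty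
    then show ?case by (simp add: assms)
  next
    case (insert i I)
    then have "g \<in> I \<rightarrow> carrier G" "g i \<in> carrier G" "(\<lambda>i. f (g i)) \<in> I \<rightarrow> carrier H"
      "f (g i) \<in> carrier H"
      using assms(3) by auto
    then show ?case
      using insert by (simp add: assms(5))
  qed
qed

lemma (in abelian_monoid) finsum_single:
  assumes "finite I" "i \<in> I" "x \<in> carrier G"
  shows "(\<Oplus>j\<in>I. if j = i then x else \<zero>) = x"
  using add.finprod_singleton_swap[OF assms(2,1), of "\<lambda>_. x"] assms(3) by simp

lemma (in abelian_monoid) finsum_Times:
  assumes "finite I" "finite J" "f \<in> I \<times> J \<rightarrow> carrier G"
  shows "(\<Oplus>p\<in>I \<times> J. f p) = (\<Oplus>i\<in>I. \<Oplus>j\<in>J. f (i, j))"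
proof -
  have "(\<Oplus>p\<in>(\<Union>i\<in>I. Pair i ` J). f p) = (\<Oplus>i\<in>I. \<Oplus>p\<in>Pair i ` J. f p)"
    using assms by (intro add.finprod_UN_disjoint) (auto simp: pairwise_def disjnt_def)
  also have "(\<Union>i\<in>I. Pair i ` J) = I \<times> J" by auto
  also have "(\<Oplus>i\<in>I. \<Oplus>p\<in>Pair i ` J. f p) = (\<Oplus>i\<in>I. \<Oplus>j\<in>J. f (i, j))"
  proof (rule finsum_cong')
    show "(\<lambda>i. \<Oplus>j\<in>J. f (i, j)) \<in> I \<rightarrow> carrier G"
      using assms(3) by (auto intro!: finsum_closed)
    show "(\<Oplus>p\<in>Pair i ` J. f p) = (\<Oplus>j\<in>J. f (i, j))" if "i \<in> I" for i
      using assms that by (subst finsum_reindex) (auto simp: inj_on_def)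
  qed simp
  finally show ?thesis .
qed

text \<open>Applied in \<open>lin_mult\<close> with \<open>h\<close> the multiplication of the
  monoid: pairs are sorted by their product.\<close>

lemma (in abelian_monoid) finsum_fibres:
  assumes "finite I" "finite J" "h \<in> I \<rightarrow> J" "f \<in> I \<rightarrow> carrier G"
  shows "(\<Oplus>j\<in>J. \<Oplus>i\<in>{i \<in> I. h i = j}. f i) = finsum G f I"
proof -
  have "finsum G f (\<Union>j\<in>J. {i \<in> I. h i = j}) = (\<Oplus>j\<in>J. \<Oplus>i\<in>{i \<in> I. h i = j}. f i)"
    using assms by (intro add.finprod_UN_disjoint) (auto simp: pairwise_def disjnt_def)
  moreover have "(\<Union>j\<in>J. {i \<in> I. h i = j}) = I" using assms(3) by auto
  ultimately show ?thesis by simp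
qed

section \<open>Dimension by coordinates\<close>

text \<open>Independence: \<open>x i\<close> applied to a linear combination of the vectors
  \<open>u j\<close> returns its i-th coefficient. Spanning: \<open>v\<close> minus the combination
  with coefficients \<open>x i v\<close> is killed by every functional, hence zero.\<close>

lemma vs_dim_dual_basis:
  fixes V :: "('k, 'v) module" and I :: "'i set"
  assumes "vectorspace K V" and "finite I"
    and u: "u \<in> I \<rightarrow> carrier V"
    and x: "\<And>i. i \<in> I \<Longrightarrow> x i \<in> carrier V \<rightarrow> carrier K"
    and x_add: "\<And>i v w. \<lbrakk>i \<in> I; v \<in> carrier V; w \<in> carrier V\<rbrakk> \<Longrightarrow> x i (v \<oplus>\<^bsub>V\<^esub> w) = x i v \<oplus>\<^bsub>K\<^esub> x i w"
    and x_smult: "\<And>i c v. \<lbrakk>i \<in> I; c \<in> carrier K; v \<in> carrier V\<rbrakk> \<Longrightarrow> x i (c \<odot>\<^bsub>V\<^esub> v) = c \<otimes>\<^bsub>K\<^esub> x i v"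
    and dual: "\<And>i j. \<lbrakk>i \<in> I; j \<in> I\<rbrakk> \<Longrightarrow> x i (u j) = (if i = j then \<one>\<^bsub>K\<^esub> else \<zero>\<^bsub>K\<^esub>)"
    and zero: "\<And>v. \<lbrakk>v \<in> carrier V; \<And>i. i \<in> I \<Longrightarrow> x i v = \<zero>\<^bsub>K\<^esub>\<rbrakk> \<Longrightarrow> v = \<zero>\<^bsub>V\<^esub>"
  shows "vs_dim K V = enat (card I)"
proof -
  interpret vectorspace K V by fact
  have inj: "inj_on u I"
    using dual by (metis inj_onI zero_not_one)
  have x0: "x i \<zero>\<^bsub>V\<^esub> = \<zero>\<^bsub>K\<^esub>" if "i \<in> I" for i
    using x_smult[of i "\<zero>\<^bsub>K\<^esub>" "\<zero>\<^bsub>V\<^esub>"] x[OF that] that by (auto simp: Pi_def)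
  have uV: "u ` I \<subseteq> carrier V" using u by auto
  have coord: "x j (lincomb a (u ` I)) = a (u j)" if a: "a \<in> u ` I \<rightarrow> carrier K" and j: "j \<in> I" for a j
  proof -
    have "x j (lincomb a (u ` I)) = (\<Oplus>\<^bsub>K\<^esub>v\<in>u ` I. x j (a v \<odot>\<^bsub>V\<^esub> v))"
      unfolding lincomb_def
      by (rule finsum_hom) (use a j u x x0 x_add \<open>finite I\<close> in \<open>auto intro!: M.abelian_monoid_axioms R.abelian_monoid_axioms\<close>)
    also have "\<dots> = (\<Oplus>\<^bsub>K\<^esub>i\<in>I. x j (a (u i) \<odot>\<^bsub>V\<^esub> u i))"
      using inj a u x[OF j] by (intro R.finsum_reindex) auto
    also have "\<dots> = (\<Oplus>\<^bsub>K\<^esub>i\<in>I. if i = j then a (u j) else \<zero>\<^bsub>K\<^esub>)"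
      using a u j by (intro R.finsum_cong') (auto simp: x_smult dual Pi_def)
    also have "\<dots> = a (u j)" using a j \<open>finite I\<close> by (intro R.finsum_single) auto
    finally show ?thesis .
  qed
  have li: "lin_indpt (u ` I)"
  proof (rule finite_lin_indpt2)
    show "\<forall>v\<in>u ` I. a v = \<zero>\<^bsub>K\<^esub>"
      if "a \<in> u ` I \<rightarrow> carrier K" "lincomb a (u ` I) = \<zero>\<^bsub>V\<^esub>" for a
      using coord[OF that(1)] that(2) x0 by simp
  qed (use uV \<open>finite I\<close> in auto)
  have "v \<in> span (u ` I)" if v: "v \<in> carrier V" for v
  proof -
    \<comment> \<open>\<open>lincomb\<close> takes coefficients as a function of the vectors, so the
      index is recovered from the vector through the inverse of \<open>u\<close>.\<close>
    define a where "a = (\<lambda>w. x (inv_into I u w) v)"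
    have au: "a (u i) = x i v" if "i \<in> I" for i
      using inj that by (simp add: a_def)
    have a: "a \<in> u ` I \<rightarrow> carrier K" using inj x v by (auto simp: a_def Pi_def)
    define w where "w = lincomb a (u ` I)"
    have w: "w \<in> carrier V" unfolding w_def using uV a by (rule lincomb_closed)
    have neg: "x i (\<ominus>\<^bsub>V\<^esub> w) = \<ominus>\<^bsub>K\<^esub> x i w" if "i \<in> I" for i
    proof -
      have "x i (\<ominus>\<^bsub>V\<^esub> w) \<oplus>\<^bsub>K\<^esub> x i w = \<zero>\<^bsub>K\<^esub>"
        using x_add[of i "\<ominus>\<^bsub>V\<^esub> w" w] that w x0 by (simp add: M.l_neg)
      then show ?thesis using x[OF that] w by (metis M.a_inv_closed PiE R.minus_equality)
    qed
    have "v \<oplus>\<^bsub>V\<^esub> (\<ominus>\<^bsub>V\<^esub> w) = \<zero>\<^bsub>V\<^esub>"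
    proof (rule zero)
      show "x i (v \<oplus>\<^bsub>V\<^esub> (\<ominus>\<^bsub>V\<^esub> w)) = \<zero>\<^bsub>K\<^esub>" if "i \<in> I" for i
        using that v w coord[OF a that] au[OF that] x[OF that] neg
        by (simp add: x_add w_def[symmetric] R.r_neg Pi_def)
    qed (use v w in simp)
    then have "v = w" using v w M.minus_equality by fastforce
    then show ?thesis unfolding span_def w_def using a \<open>finite I\<close> by blast
  qed
  then have gen: "gen_set (u ` I)"
    using uV span_is_subset2 by auto
  have "dim = card (u ` I)"
    using li gen uV \<open>finite I\<close> by (intro dim_basis) (auto simp: basis_def)
  moreover have "fin_dim" unfolding fin_dim_def using gen uV \<open>finite I\<close> by blast
  ultimately show ?thesis
    using inj by (simp add: vs_dim_def card_image)
qed

lemma quotient_module_simps: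
  "carrier (quotient_module M H) = a_rcosets\<^bsub>M\<^esub> H"
  "\<zero>\<^bsub>quotient_module M H\<^esub> = H"
  "S \<oplus>\<^bsub>quotient_module M H\<^esub> T = S <+>\<^bsub>M\<^esub> T"
  "c \<odot>\<^bsub>quotient_module M H\<^esub> S = (\<Union>x\<in>S. H +>\<^bsub>M\<^esub> (c \<odot>\<^bsub>M\<^esub> x))"
  by (simp_all add: quotient_module_def)

locale vectorspace_quotient = vectorspace K V for K :: "('k, 'c) ring_scheme" and V :: "('k, 'v) module" +
  fixes H
  assumes H: "additive_subgroup H V"
    and H_smult: "\<And>c h. \<lbrakk>c \<in> carrier K; h \<in> H\<rbrakk> \<Longrightarrow> c \<odot>\<^bsub>V\<^esub> h \<in> H"
begin

sublocale abelian_subgroup H V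
  using H M.abelian_group_axioms by (rule abelian_subgroupI3)

lemma coset_add:
  "\<lbrakk>x \<in> carrier V; y \<in> carrier V\<rbrakk> \<Longrightarrow>
    (H +>\<^bsub>V\<^esub> x) \<oplus>\<^bsub>quotient_module V H\<^esub> (H +>\<^bsub>V\<^esub> y) = H +>\<^bsub>V\<^esub> (x \<oplus>\<^bsub>V\<^esub> y)"
  by (simp add: quotient_module_simps a_rcos_sum)

text \<open>The scalar multiple is defined as a union over all members of the coset; as
  \<open>H\<close> is closed under scalars, every member contributes the same coset and the union
  collapses.\<close>

lemma coset_smult:
  assumes "c \<in> carrier K" "x \<in> carrier V"
  shows "c \<odot>\<^bsub>quotient_module V H\<^esub> (H +>\<^bsub>V\<^esub> x) = H +>\<^bsub>V\<^esub> (c \<odot>\<^bsub>V\<^esub> x)"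
proof -
  have "H +>\<^bsub>V\<^esub> (c \<odot>\<^bsub>V\<^esub> y) = H +>\<^bsub>V\<^esub> (c \<odot>\<^bsub>V\<^esub> x)" if "y \<in> H +>\<^bsub>V\<^esub> x" for y
  proof -
    obtain h where h: "h \<in> H" "y = h \<oplus>\<^bsub>V\<^esub> x" using \<open>y \<in> _\<close> by (auto simp: a_r_coset_def')
    then have "c \<odot>\<^bsub>V\<^esub> y = c \<odot>\<^bsub>V\<^esub> h \<oplus>\<^bsub>V\<^esub> c \<odot>\<^bsub>V\<^esub> x"
      using assms by (simp add: smult_r_distr)
    then have "c \<odot>\<^bsub>V\<^esub> y \<in> H +>\<^bsub>V\<^esub> (c \<odot>\<^bsub>V\<^esub> x)"
      using h assms H_smult by (auto simp: a_r_coset_def')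
    then show ?thesis using assms by (simp add: a_repr_independence'[symmetric])
  qed
  moreover have "x \<in> H +>\<^bsub>V\<^esub> x" using assms by (simp add: a_rcos_self)
  ultimately show ?thesis unfolding quotient_module_simps by blast
qed

lemma coset_cases:
  assumes "C \<in> carrier (quotient_module V H)"
  obtains x where "x \<in> carrier V" "C = H +>\<^bsub>V\<^esub> x"
  using assms by (auto simp: quotient_module_simps A_RCOSETS_def')

lemma coset_closed: "x \<in> carrier V \<Longrightarrow> H +>\<^bsub>V\<^esub> x \<in> carrier (quotient_module V H)"
  by (auto simp: quotient_module_simps A_RCOSETS_def')

lemma coset_zero: "\<zero>\<^bsub>quotient_module V H\<^esub> = H +>\<^bsub>V\<^esub> \<zero>\<^bsub>V\<^esub>"
  using a_coset_add_zero[OF a_subset] by (simp add: quotient_module_simps)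

lemma vectorspace_quotient_module: "vectorspace K (quotient_module V H)"
proof -
  have "abelian_group (quotient_module V H)"
  proof (rule abelian_groupI)
    fix C assume "C \<in> carrier (quotient_module V H)"
    then obtain x where x: "x \<in> carrier V" "C = H +>\<^bsub>V\<^esub> x" by (rule coset_cases)
    show "\<exists>D\<in>carrier (quotient_module V H). D \<oplus>\<^bsub>quotient_module V H\<^esub> C = \<zero>\<^bsub>quotient_module V H\<^esub>"
      using x by (intro bexI[of _ "H +>\<^bsub>V\<^esub> (\<ominus>\<^bsub>V\<^esub> x)"])
        (auto simp: coset_add coset_zero coset_closed M.l_neg simp del: a_coset_add_zero)
  qed (auto elim!: coset_cases simp: coset_add coset_zero coset_closed M.a_ac simp del: a_coset_add_zero)
  then have "module K (quotient_module V H)"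
    by (rule moduleI[OF R.is_cring]; elim coset_cases)
      (simp_all add: coset_add coset_smult coset_closed smult_l_distr smult_r_distr smult_assoc1)
  then show ?thesis by (intro vectorspace.intro field_axioms)
qed

lemma vs_dim_quotient_module:
  assumes "finite I"
    and u: "u \<in> I \<rightarrow> carrier V"
    and x: "\<And>i. i \<in> I \<Longrightarrow> x i \<in> carrier V \<rightarrow> carrier K"
    and x_add: "\<And>i v w. \<lbrakk>i \<in> I; v \<in> carrier V; w \<in> carrier V\<rbrakk> \<Longrightarrow> x i (v \<oplus>\<^bsub>V\<^esub> w) = x i v \<oplus>\<^bsub>K\<^esub> x i w"
    and x_smult: "\<And>i c v. \<lbrakk>i \<in> I; c \<in> carrier K; v \<in> carrier V\<rbrakk> \<Longrightarrow> x i (c \<odot>\<^bsub>V\<^esub> v) = c \<otimes>\<^bsub>K\<^esub> x i v"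
    and dual: "\<And>i j. \<lbrakk>i \<in> I; j \<in> I\<rbrakk> \<Longrightarrow> x i (u j) = (if i = j then \<one>\<^bsub>K\<^esub> else \<zero>\<^bsub>K\<^esub>)"
    and kernel: "\<And>v. v \<in> carrier V \<Longrightarrow> v \<in> H \<longleftrightarrow> (\<forall>i\<in>I. x i v = \<zero>\<^bsub>K\<^esub>)"
  shows "vs_dim K (quotient_module V H) = enat (card I)"
proof -
  \<comment> \<open>The functional on the quotient, evaluated at some representative; the choice is
    harmless because \<open>x i\<close> vanishes on \<open>H\<close>.\<close>
  define y where "y = (\<lambda>i C. x i (SOME v. v \<in> C))"
  have y: "y i (H +>\<^bsub>V\<^esub> v) = x i v" if i: "i \<in> I" and v: "v \<in> carrier V" for i v
  proof -
    have "\<exists>w. w \<in> H +>\<^bsub>V\<^esub> v" using a_rcos_self v by blast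
    then obtain w where w: "w = (SOME w. w \<in> H +>\<^bsub>V\<^esub> v)" "w \<in> H +>\<^bsub>V\<^esub> v" by (metis someI_ex)
    then obtain h where h: "h \<in> H" "w = h \<oplus>\<^bsub>V\<^esub> v" by (auto simp: a_r_coset_def')
    then have "x i w = x i h \<oplus>\<^bsub>K\<^esub> x i v" using i v by (simp add: x_add)
    also have "x i h = \<zero>\<^bsub>K\<^esub>" using h i kernel a_Hcarr by blast
    finally show ?thesis using x[OF i] v by (simp add: y_def w(1)[symmetric] Pi_def)
  qed
  show ?thesis
  proof (rule vs_dim_dual_basis[where x = y and u = "\<lambda>i. H +>\<^bsub>V\<^esub> u i"])
    show "C = \<zero>\<^bsub>quotient_module V H\<^esub>" if C: "C \<in> carrier (quotient_module V H)"
      and z: "\<And>i. i \<in> I \<Longrightarrow> y i C = \<zero>\<^bsub>K\<^esub>" for C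
    proof -
      obtain v where v: "v \<in> carrier V" "C = H +>\<^bsub>V\<^esub> v" using C by (rule coset_cases)
      then have "v \<in> H" using kernel z y by auto
      then show ?thesis using v by (simp add: quotient_module_simps a_rcos_const)
    qed
  qed (use x u in \<open>auto elim!: coset_cases simp: vectorspace_quotient_module assms(1) y coset_add
      coset_smult coset_closed x_add x_smult dual Pi_def\<close>)
qed

end

text \<open>A common kernel of linear functionals is a subspace. For \<open>ext1\<close>, the
  subspace property of the coboundaries thus comes with the single set equality
  \<open>H\<close>.\<close>

lemma vs_dim_quotient_module_kernel:
  fixes V :: "('k, 'v) module" and I :: "'i set"
  assumes "vectorspace K V" and "finite I"
    and u: "u \<in> I \<rightarrow> carrier V"
    and x: "\<And>i. i \<in> I \<Longrightarrow> x i \<in> carrier V \<rightarrow> carrier K"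
    and x_add: "\<And>i v w. \<lbrakk>i \<in> I; v \<in> carrier V; w \<in> carrier V\<rbrakk> \<Longrightarrow> x i (v \<oplus>\<^bsub>V\<^esub> w) = x i v \<oplus>\<^bsub>K\<^esub> x i w"
    and x_smult: "\<And>i c v. \<lbrakk>i \<in> I; c \<in> carrier K; v \<in> carrier V\<rbrakk> \<Longrightarrow> x i (c \<odot>\<^bsub>V\<^esub> v) = c \<otimes>\<^bsub>K\<^esub> x i v"
    and dual: "\<And>i j. \<lbrakk>i \<in> I; j \<in> I\<rbrakk> \<Longrightarrow> x i (u j) = (if i = j then \<one>\<^bsub>K\<^esub> else \<zero>\<^bsub>K\<^esub>)"
    and H: "H = {v \<in> carrier V. \<forall>i\<in>I. x i v = \<zero>\<^bsub>K\<^esub>}"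
  shows "vs_dim K (quotient_module V H) = enat (card I)"
proof -
  interpret vectorspace K V by fact
  have smult: "c \<odot>\<^bsub>V\<^esub> v \<in> H" if "c \<in> carrier K" "v \<in> H" for c v
    using that by (auto simp: H x_smult)
  have add: "v \<oplus>\<^bsub>V\<^esub> w \<in> H" if "v \<in> H" "w \<in> H" for v w
    using that by (auto simp: H x_add)
  have zero: "\<zero>\<^bsub>V\<^esub> \<in> H"
    using x_smult[of _ "\<zero>\<^bsub>K\<^esub>" "\<zero>\<^bsub>V\<^esub>"] x by (auto simp: H Pi_def)
  have kernel: "v \<in> H \<longleftrightarrow> (\<forall>i\<in>I. x i v = \<zero>\<^bsub>K\<^esub>)" if "v \<in> carrier V" for v
    using that by (simp add: H)
  have "subgroup H (add_monoid V)"
  proof (rule M.add.subgroupI)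
    show "\<ominus>\<^bsub>V\<^esub> v \<in> H" if "v \<in> H" for v
    proof -
      have "\<ominus>\<^bsub>V\<^esub> v = (\<ominus>\<^bsub>K\<^esub> \<one>\<^bsub>K\<^esub>) \<odot>\<^bsub>V\<^esub> v"
        using that by (simp add: H smult_l_minus)
      then show ?thesis using smult that by simp
    qed
  qed (use zero add in \<open>auto simp: H\<close>)
  then interpret vectorspace_quotient K V H
    by (intro vectorspace_quotient.intro vectorspace_axioms vectorspace_quotient_axioms.intro
        additive_subgroup.intro smult)
  show ?thesis
    by (rule vs_dim_quotient_module[OF \<open>finite I\<close> u x x_add x_smult dual kernel])
qed

section \<open>Free modules\<close>

lemma (in left_module) smult_zero_left [simp]:
  assumes "x \<in> carrier M" shows "\<zero> \<odot>\<^bsub>M\<^esub> x = \<zero>\<^bsub>M\<^esub>"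
proof -
  have "\<zero> \<odot>\<^bsub>M\<^esub> x \<oplus>\<^bsub>M\<^esub> \<zero> \<odot>\<^bsub>M\<^esub> x = \<zero> \<odot>\<^bsub>M\<^esub> x"
    using smult_l_distr[of \<zero> \<zero> x] assms by simp
  then show ?thesis using assms smult_closed[of \<zero> x] M.add.r_cancel_one by auto
qed

lemma (in left_module) smult_zero_right [simp]:
  assumes "a \<in> carrier R" shows "a \<odot>\<^bsub>M\<^esub> \<zero>\<^bsub>M\<^esub> = \<zero>\<^bsub>M\<^esub>"
proof -
  have "a \<odot>\<^bsub>M\<^esub> \<zero>\<^bsub>M\<^esub> \<oplus>\<^bsub>M\<^esub> a \<odot>\<^bsub>M\<^esub> \<zero>\<^bsub>M\<^esub> = a \<odot>\<^bsub>M\<^esub> \<zero>\<^bsub>M\<^esub>"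
    using smult_r_distr[of a "\<zero>\<^bsub>M\<^esub>" "\<zero>\<^bsub>M\<^esub>"] assms by simp
  then show ?thesis using assms smult_closed[of a "\<zero>\<^bsub>M\<^esub>"] M.add.r_cancel_one by auto
qed

lemma module_hom_zero:
  assumes "left_module A M" "left_module A N" "f \<in> module_hom A M N"
  shows "f \<zero>\<^bsub>M\<^esub> = \<zero>\<^bsub>N\<^esub>"
proof -
  interpret M: left_module A M by fact
  interpret N: left_module A N by fact
  have "f \<zero>\<^bsub>M\<^esub> = \<zero>\<^bsub>A\<^esub> \<odot>\<^bsub>N\<^esub> f \<zero>\<^bsub>M\<^esub>"
    using module_hom_smult[OF assms(3), of "\<zero>\<^bsub>A\<^esub>" "\<zero>\<^bsub>M\<^esub>"] by simp
  then show ?thesis using assms(3) by (simp add: module_hom_def Pi_def)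
qed

lemma free_module_simps:
  "\<zero>\<^bsub>free_module A S\<^esub> = (\<lambda>s. \<zero>\<^bsub>A\<^esub>)"
  "f \<oplus>\<^bsub>free_module A S\<^esub> g = (\<lambda>s. f s \<oplus>\<^bsub>A\<^esub> g s)"
  "a \<odot>\<^bsub>free_module A S\<^esub> f = (\<lambda>s. a \<otimes>\<^bsub>A\<^esub> f s)"
  by (simp_all add: free_module_def)

lemma carrier_free_module_iff:
  "f \<in> carrier (free_module A S) \<longleftrightarrow> (\<forall>s. f s \<in> carrier A) \<and> (\<forall>s. s \<notin> S \<longrightarrow> f s = \<zero>\<^bsub>A\<^esub>) \<and>
    finite {s. f s \<noteq> \<zero>\<^bsub>A\<^esub>}"
  by (simp add: free_module_def)

text \<open>The basis element [s] of the free module.\<close>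

definition free_unit :: "('a, 'c) ring_scheme \<Rightarrow> 's \<Rightarrow> 's \<Rightarrow> 'a" where
  "free_unit A s = (\<lambda>t. if t = s then \<one>\<^bsub>A\<^esub> else \<zero>\<^bsub>A\<^esub>)"

text \<open>The universal property of a free module: the linear extension of an arbitrary map
  \<open>u\<close> on the basis. \<open>free_eval\<close> is the case of an inclusion; a general
  \<open>u\<close> gives the maps from \<open>resolution0\<close> to the target of Ext and to the
  extension module.\<close>

definition free_lift ::
    "('a, 'c) ring_scheme \<Rightarrow> ('a, 'n, 'd) module_scheme \<Rightarrow> ('s \<Rightarrow> 'n) \<Rightarrow> ('s \<Rightarrow> 'a) \<Rightarrow> 'n" where
  "free_lift A N u f = (\<Oplus>\<^bsub>N\<^esub>s\<in>{s. f s \<noteq> \<zero>\<^bsub>A\<^esub>}. f s \<odot>\<^bsub>N\<^esub> u s)"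

lemma free_eval_eq_free_lift: "free_eval A M = free_lift A M (\<lambda>s. s)"
  by (simp add: free_eval_def free_lift_def fun_eq_iff)

context ring
begin

lemma free_module_add_closed:
  assumes "f \<in> carrier (free_module R S)" "g \<in> carrier (free_module R S)"
  shows "f \<oplus>\<^bsub>free_module R S\<^esub> g \<in> carrier (free_module R S)"
proof -
  have "{s. f s \<oplus> g s \<noteq> \<zero>} \<subseteq> {s. f s \<noteq> \<zero>} \<union> {s. g s \<noteq> \<zero>}" by auto
  then have "finite {s. f s \<oplus> g s \<noteq> \<zero>}"
    by (rule finite_subset) (use assms in \<open>simp add: carrier_free_module_iff\<close>)
  then show ?thesis
    using assms by (simp add: carrier_free_module_iff free_module_simps)
qed

lemma free_module_smult_closed:
  assumes "a \<in> carrier R" "f \<in> carrier (free_module R S)"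
  shows "a \<odot>\<^bsub>free_module R S\<^esub> f \<in> carrier (free_module R S)"
proof -
  have "{s. a \<otimes> f s \<noteq> \<zero>} \<subseteq> {s. f s \<noteq> \<zero>}" using assms by auto
  then have "finite {s. a \<otimes> f s \<noteq> \<zero>}"
    by (rule finite_subset) (use assms in \<open>simp add: carrier_free_module_iff\<close>)
  then show ?thesis
    using assms by (simp add: carrier_free_module_iff free_module_simps)
qed

lemma free_unit_closed: "s \<in> S \<Longrightarrow> free_unit R s \<in> carrier (free_module R S)"
proof -
  have "{t. free_unit R s t \<noteq> \<zero>} \<subseteq> {s}" by (auto simp: free_unit_def)
  then have "finite {t. free_unit R s t \<noteq> \<zero>}" by (rule finite_subset) simp
  then show "s \<in> S \<Longrightarrow> free_unit R s \<in> carrier (free_module R S)"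
    by (auto simp: carrier_free_module_iff) (auto simp: free_unit_def)
qed

lemma left_module_free_module: "left_module R (free_module R S)"
proof -
  have "abelian_group (free_module R S)"
  proof (rule abelian_groupI)
    fix f assume f: "f \<in> carrier (free_module R S)"
    then have "(\<ominus> \<one>) \<odot>\<^bsub>free_module R S\<^esub> f \<in> carrier (free_module R S)"
      by (simp add: free_module_smult_closed)
    moreover have "((\<ominus> \<one>) \<odot>\<^bsub>free_module R S\<^esub> f) \<oplus>\<^bsub>free_module R S\<^esub> f = \<zero>\<^bsub>free_module R S\<^esub>"
      using f by (auto simp: free_module_simps carrier_free_module_iff l_minus l_neg)
    ultimately show "\<exists>g\<in>carrier (free_module R S). g \<oplus>\<^bsub>free_module R S\<^esub> f = \<zero>\<^bsub>free_module R S\<^esub>"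
      by blast
  qed (auto simp: free_module_add_closed, auto simp: free_module_simps carrier_free_module_iff a_ac)
  then show ?thesis
    by (intro left_module.intro left_module_axioms.intro ring_axioms)
      (auto simp: free_module_smult_closed,
       auto simp: free_module_simps carrier_free_module_iff l_distr r_distr m_assoc)
qed

text \<open>For identities between additive maps that may fail to be linear, such as
  \<open>proj\<close> in \<open>coboundary_if_inner\<close>; hence they are checked on all multiples
  a[s] and not only on basis elements.\<close>

lemma free_module_induct [consumes 1, case_names zero unit add]:
  assumes "f \<in> carrier (free_module R S)"
    and "P \<zero>\<^bsub>free_module R S\<^esub>"
    and unit: "\<And>a s. \<lbrakk>a \<in> carrier R; s \<in> S\<rbrakk> \<Longrightarrow> P (a \<odot>\<^bsub>free_module R S\<^esub> free_unit R s)"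
    and add: "\<And>f g. \<lbrakk>f \<in> carrier (free_module R S); g \<in> carrier (free_module R S); P f; P g\<rbrakk> \<Longrightarrow>
      P (f \<oplus>\<^bsub>free_module R S\<^esub> g)"
  shows "P f"
proof -
  have "finite {s. f s \<noteq> \<zero>}" using assms(1) by (simp add: carrier_free_module_iff)
  then show ?thesis using assms(1)
  proof (induction "{s. f s \<noteq> \<zero>}" arbitrary: f rule: finite_induct)
    case empty
    then have "f = \<zero>\<^bsub>free_module R S\<^esub>" by (auto simp: free_module_simps)
    then show ?case using assms(2) by simp
  next
    case (insert s T)
    define g where "g = f(s := \<zero>)"
    have T: "T = {t. g t \<noteq> \<zero>}" using insert(2,4) by (auto simp: g_def)
    have g: "g \<in> carrier (free_module R S)"
      using insert(1,5) T by (auto simp: carrier_free_module_iff g_def)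
    have s: "s \<in> S" "f s \<in> carrier R" using insert(4,5) by (auto simp: carrier_free_module_iff)
    have "f = (f s \<odot>\<^bsub>free_module R S\<^esub> free_unit R s) \<oplus>\<^bsub>free_module R S\<^esub> g"
      using insert(5) by (auto simp: free_module_simps carrier_free_module_iff g_def free_unit_def)
    then show ?case
      using add[of "f s \<odot>\<^bsub>free_module R S\<^esub> free_unit R s" g] unit insert(3)[OF T g] s g
      by (simp add: free_module_smult_closed free_unit_closed)
  qed
qed

end

context left_module
begin

text \<open>The defining sum runs over the support of \<open>f\<close>, which changes under addition
  and scaling; over a common finite superset such sums can be compared termwise.\<close>

lemma free_lift_superset:
  assumes f: "f \<in> carrier (free_module R S)" and u: "u \<in> S \<rightarrow> carrier M"
    and "finite T" "T \<subseteq> S" "{s. f s \<noteq> \<zero>} \<subseteq> T"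
  shows "free_lift R M u f = (\<Oplus>\<^bsub>M\<^esub>s\<in>T. f s \<odot>\<^bsub>M\<^esub> u s)"
  unfolding free_lift_def using assms
  by (intro M.add.finprod_mono_neutral_cong_left)
    (auto simp: carrier_free_module_iff Pi_def subset_iff intro!: smult_closed)

lemma free_lift_closed:
  assumes "f \<in> carrier (free_module R S)" "u \<in> S \<rightarrow> carrier M"
  shows "free_lift R M u f \<in> carrier M"
  unfolding free_lift_def using assms
  by (intro M.finsum_closed) (auto simp: carrier_free_module_iff Pi_def intro!: smult_closed)

lemma free_lift_hom:
  assumes u: "u \<in> S \<rightarrow> carrier M"
  shows "free_lift R M u \<in> module_hom R (free_module R S) M"
proof -
  let ?F = "free_module R S"
  have "free_lift R M u (f \<oplus>\<^bsub>?F\<^esub> g) = free_lift R M u f \<oplus>\<^bsub>M\<^esub> free_lift R M u g"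
    if f: "f \<in> carrier ?F" and g: "g \<in> carrier ?F" for f g
  proof -
    define T where "T = {s. f s \<noteq> \<zero>} \<union> {s. g s \<noteq> \<zero>}"
    have T: "finite T" "T \<subseteq> S" using f g by (auto simp: T_def carrier_free_module_iff)
    have fg: "f \<oplus>\<^bsub>?F\<^esub> g \<in> carrier ?F" using f g by (rule R.free_module_add_closed)
    have c: "f s \<in> carrier R" "g s \<in> carrier R" for s
      using f g by (auto simp: carrier_free_module_iff)
    have uT: "u s \<in> carrier M" if "s \<in> T" for s using that T u by auto
    have "free_lift R M u (f \<oplus>\<^bsub>?F\<^esub> g) = (\<Oplus>\<^bsub>M\<^esub>s\<in>T. (f s \<oplus> g s) \<odot>\<^bsub>M\<^esub> u s)"
      by (subst free_lift_superset[OF fg u T]) (auto simp: T_def free_module_simps)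
    also have "\<dots> = (\<Oplus>\<^bsub>M\<^esub>s\<in>T. f s \<odot>\<^bsub>M\<^esub> u s \<oplus>\<^bsub>M\<^esub> g s \<odot>\<^bsub>M\<^esub> u s)"
      using c uT by (intro M.finsum_cong') (auto simp: smult_l_distr smult_closed)
    also have "\<dots> = (\<Oplus>\<^bsub>M\<^esub>s\<in>T. f s \<odot>\<^bsub>M\<^esub> u s) \<oplus>\<^bsub>M\<^esub> (\<Oplus>\<^bsub>M\<^esub>s\<in>T. g s \<odot>\<^bsub>M\<^esub> u s)"
      using c uT by (intro M.finsum_addf) (auto simp: smult_closed)
    also have "\<dots> = free_lift R M u f \<oplus>\<^bsub>M\<^esub> free_lift R M u g"
      using free_lift_superset[OF f u T] free_lift_superset[OF g u T] by (auto simp: T_def)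
    finally show ?thesis .
  qed
  moreover have "free_lift R M u (a \<odot>\<^bsub>?F\<^esub> f) = a \<odot>\<^bsub>M\<^esub> free_lift R M u f"
    if a: "a \<in> carrier R" and f: "f \<in> carrier ?F" for a f
  proof -
    define T where "T = {s. f s \<noteq> \<zero>}"
    have T: "finite T" "T \<subseteq> S" using f by (auto simp: T_def carrier_free_module_iff)
    have af: "a \<odot>\<^bsub>?F\<^esub> f \<in> carrier ?F" using a f by (rule R.free_module_smult_closed)
    have c: "f s \<in> carrier R" for s
      using f by (auto simp: carrier_free_module_iff)
    have uT: "u s \<in> carrier M" if "s \<in> T" for s using that T u by auto
    have "free_lift R M u (a \<odot>\<^bsub>?F\<^esub> f) = (\<Oplus>\<^bsub>M\<^esub>s\<in>T. (a \<otimes> f s) \<odot>\<^bsub>M\<^esub> u s)"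
      using a by (subst free_lift_superset[OF af u T]) (auto simp: T_def free_module_simps)
    also have "\<dots> = (\<Oplus>\<^bsub>M\<^esub>s\<in>T. a \<odot>\<^bsub>M\<^esub> (f s \<odot>\<^bsub>M\<^esub> u s))"
      using c uT a by (intro M.finsum_cong') (auto simp: smult_assoc smult_closed)
    also have "\<dots> = a \<odot>\<^bsub>M\<^esub> (\<Oplus>\<^bsub>M\<^esub>s\<in>T. f s \<odot>\<^bsub>M\<^esub> u s)"
      by (rule finsum_hom[symmetric])
        (use a c uT T in \<open>auto simp: smult_r_distr smult_closed M.abelian_monoid_axioms\<close>)
    also have "\<dots> = a \<odot>\<^bsub>M\<^esub> free_lift R M u f"
      using free_lift_superset[OF f u T] by (auto simp: T_def)
    finally show ?thesis .
  qed
  ultimately show ?thesis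
    using free_lift_closed[OF _ u] by (auto simp: module_hom_def)
qed

lemma free_lift_unit:
  assumes "u s \<in> carrier M"
  shows "free_lift R M u (free_unit R s) = u s"
proof -
  have "free_lift R M u (free_unit R s) = (\<Oplus>\<^bsub>M\<^esub>t\<in>{s}. free_unit R s t \<odot>\<^bsub>M\<^esub> u t)"
    using assms by (intro free_lift_superset[where S = "{s}"] R.free_unit_closed)
      (auto simp: free_unit_def)
  also have "\<dots> = u s" using assms by (simp add: free_unit_def smult_one)
  finally show ?thesis .
qed

end

lemma free_eval_hom:
  assumes "left_module A M" and "S \<subseteq> carrier M"
  shows "free_eval A M \<in> module_hom A (free_module A S) M"
  unfolding free_eval_eq_free_lift using assms by (intro left_module.free_lift_hom) auto

lemma free_eval_unit:
  assumes "left_module A M" and "x \<in> carrier M"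
  shows "free_eval A M (free_unit A x) = x"
  using assms by (simp add: free_eval_eq_free_lift left_module.free_lift_unit)

text \<open>Two consecutive maps of the resolution compose to zero: the generators of the next free
  module are kernel elements, and \<open>free_eval\<close> sends each generator to the element it
  stands for.\<close>

lemma module_hom_free_eval_kernel:
  assumes "left_module A M" and "left_module A N" and d: "d \<in> module_hom A M N"
    and x: "x \<in> carrier (free_module A (a_kernel M N d))"
  shows "d (free_eval A M x) = \<zero>\<^bsub>N\<^esub>"
proof -
  interpret M: left_module A M by fact
  interpret N: left_module A N by fact
  have eval: "free_eval A M \<in> module_hom A (free_module A (a_kernel M N d)) M"
    using assms(1) by (rule free_eval_hom) (auto simp: a_kernel_def')
  show ?thesis using x
  proof (induction x rule: M.R.free_module_induct)
    case zero
    show ?case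
      using module_hom_zero[OF M.R.left_module_free_module assms(1) eval]
        module_hom_zero[OF assms(1,2) d] by simp
  next
    case (unit a s)
    then have "s \<in> carrier M" "d s = \<zero>\<^bsub>N\<^esub>" by (auto simp: a_kernel_def')
    then show ?case
      using unit module_hom_smult[OF eval unit(1)] module_hom_smult[OF d]
      by (simp add: M.R.free_unit_closed free_eval_unit[OF assms(1)])
  next
    case (add f g)
    then show ?case
      using module_hom_add[OF eval] module_hom_add[OF d] module_hom_closed[OF eval]
      by (simp add: Pi_def)
  qed
qed

section \<open>Extensions of one-dimensional modules\<close>

text \<open>The K-algebra enters through the central ring homomorphism from K given by the multiples
  of the identity. \<open>\<chi>\<close> is the character of the source and \<open>\<psi>\<close>
  that of the target of Ext; the band appears only when the characters are specialized
  later.\<close>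

locale algebra_characters =
  K: field K + A: ring A
  for K :: "('k, 'c) ring_scheme" and A :: "('k, 'a) module" +
  fixes \<chi> \<psi> :: "'a \<Rightarrow> 'k"
  assumes scalar_hom: "(\<lambda>c. c \<odot>\<^bsub>A\<^esub> \<one>\<^bsub>A\<^esub>) \<in> ring_hom K A"
    and scalar_central: "\<lbrakk>c \<in> carrier K; a \<in> carrier A\<rbrakk> \<Longrightarrow>
      (c \<odot>\<^bsub>A\<^esub> \<one>\<^bsub>A\<^esub>) \<otimes>\<^bsub>A\<^esub> a = a \<otimes>\<^bsub>A\<^esub> (c \<odot>\<^bsub>A\<^esub> \<one>\<^bsub>A\<^esub>)"
    and chi_hom: "\<chi> \<in> ring_hom A K" and psi_hom: "\<psi> \<in> ring_hom A K"
    and chi_scalar: "c \<in> carrier K \<Longrightarrow> \<chi> (c \<odot>\<^bsub>A\<^esub> \<one>\<^bsub>A\<^esub>) = c"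
    and psi_scalar: "c \<in> carrier K \<Longrightarrow> \<psi> (c \<odot>\<^bsub>A\<^esub> \<one>\<^bsub>A\<^esub>) = c"
begin

definition scalar :: "'k \<Rightarrow> 'a" where "scalar c = c \<odot>\<^bsub>A\<^esub> \<one>\<^bsub>A\<^esub>"

text \<open>Hochschild 1-cocycles with values in K, where the algebra acts through
  \<open>\<psi>\<close> on the left and through \<open>\<chi>\<close> on the right. Given the other
  conditions, vanishing on scalars amounts to K-linearity.\<close>

definition derivation :: "('a \<Rightarrow> 'k) \<Rightarrow> bool" where
  "derivation D \<longleftrightarrow> D \<in> carrier A \<rightarrow> carrier K \<and>
     (\<forall>a\<in>carrier A. \<forall>b\<in>carrier A. D (a \<oplus>\<^bsub>A\<^esub> b) = D a \<oplus>\<^bsub>K\<^esub> D b) \<and>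
     (\<forall>a\<in>carrier A. \<forall>b\<in>carrier A. D (a \<otimes>\<^bsub>A\<^esub> b) = \<psi> a \<otimes>\<^bsub>K\<^esub> D b \<oplus>\<^bsub>K\<^esub> D a \<otimes>\<^bsub>K\<^esub> \<chi> b) \<and>
     (\<forall>c\<in>carrier K. D (scalar c) = \<zero>\<^bsub>K\<^esub>)"

sublocale chi: ring_hom_ring A K \<chi>
  using chi_hom by (intro ring_hom_ringI2) (unfold_locales)

sublocale psi: ring_hom_ring A K \<psi>
  using psi_hom by (intro ring_hom_ringI2) (unfold_locales)

sublocale scalar: ring_hom_ring K A scalar
  unfolding scalar_def using scalar_hom by (intro ring_hom_ringI2) (unfold_locales)

lemma chi_scalar' [simp]: "c \<in> carrier K \<Longrightarrow> \<chi> (scalar c) = c"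
  and psi_scalar' [simp]: "c \<in> carrier K \<Longrightarrow> \<psi> (scalar c) = c"
  by (simp_all add: scalar_def chi_scalar psi_scalar)

lemma scalar_comm: "\<lbrakk>c \<in> carrier K; a \<in> carrier A\<rbrakk> \<Longrightarrow> scalar c \<otimes>\<^bsub>A\<^esub> a = a \<otimes>\<^bsub>A\<^esub> scalar c"
  by (simp add: scalar_def scalar_central)

lemma derivationD:
  assumes "derivation D"
  shows "\<And>a. a \<in> carrier A \<Longrightarrow> D a \<in> carrier K"
    and "\<And>a b. \<lbrakk>a \<in> carrier A; b \<in> carrier A\<rbrakk> \<Longrightarrow> D (a \<oplus>\<^bsub>A\<^esub> b) = D a \<oplus>\<^bsub>K\<^esub> D b"
    and "\<And>a b. \<lbrakk>a \<in> carrier A; b \<in> carrier A\<rbrakk> \<Longrightarrow> D (a \<otimes>\<^bsub>A\<^esub> b) = \<psi> a \<otimes>\<^bsub>K\<^esub> D b \<oplus>\<^bsub>K\<^esub> D a \<otimes>\<^bsub>K\<^esub> \<chi> b"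
    and "\<And>c. c \<in> carrier K \<Longrightarrow> D (scalar c) = \<zero>\<^bsub>K\<^esub>"
  using assms by (auto simp: derivation_def)

text \<open>A derivation is the upper right corner of a two-dimensional upper triangular representation.\<close>

definition extension_module :: "('a \<Rightarrow> 'k) \<Rightarrow> ('a, 'k \<times> 'k) module" where
  "extension_module D = \<lparr>carrier = carrier K \<times> carrier K, mult = undefined, one = undefined,
     zero = (\<zero>\<^bsub>K\<^esub>, \<zero>\<^bsub>K\<^esub>), add = (\<lambda>v w. (fst v \<oplus>\<^bsub>K\<^esub> fst w, snd v \<oplus>\<^bsub>K\<^esub> snd w)),
     smult = (\<lambda>a v. (\<psi> a \<otimes>\<^bsub>K\<^esub> fst v \<oplus>\<^bsub>K\<^esub> D a \<otimes>\<^bsub>K\<^esub> snd v, \<chi> a \<otimes>\<^bsub>K\<^esub> snd v))\<rparr>"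

text \<open>The corner entry of the associative law is the product rule for \<open>D\<close>; the
  identity acts trivially because it is a scalar, so that \<open>D\<close> vanishes on it.\<close>

lemma left_module_extension_module:
  assumes D: "derivation D"
  shows "left_module A (extension_module D)"
proof -
  have D1: "D \<one>\<^bsub>A\<^esub> = \<zero>\<^bsub>K\<^esub>" using derivationD(4)[OF D, of "\<one>\<^bsub>K\<^esub>"] by simp
  have "abelian_group (extension_module D)"
  proof (rule abelian_groupI)
    show "\<exists>w\<in>carrier (extension_module D). w \<oplus>\<^bsub>extension_module D\<^esub> v = \<zero>\<^bsub>extension_module D\<^esub>"
      if "v \<in> carrier (extension_module D)" for v
      using that by (intro bexI[of _ "(\<ominus>\<^bsub>K\<^esub> fst v, \<ominus>\<^bsub>K\<^esub> snd v)"])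
        (auto simp: extension_module_def K.l_neg)
  qed (auto simp: extension_module_def K.a_ac)
  then show ?thesis
    by (intro left_module.intro left_module_axioms.intro A.ring_axioms)
      (auto simp: extension_module_def derivationD[OF D] D1 K.l_distr K.r_distr K.m_assoc K.a_ac K.m_lcomm)
qed

end

text \<open>\<open>\<theta>\<close> and \<open>\<eta>\<close> are coordinates: they identify
  \<open>S\<close> and \<open>T\<close> with the field, on which the algebra acts through
  \<open>\<chi>\<close> and \<open>\<psi>\<close> respectively.\<close>

locale one_dim_module_pair = algebra_characters K A \<chi> \<psi> + S: left_module A S + T: left_module A T
  for K :: "('k, 'c) ring_scheme" and A :: "('k, 'a) module" and \<chi> \<psi>
    and S :: "('a, 's) module" and T :: "('a, 't) module" +
  fixes \<theta> :: "'s \<Rightarrow> 'k" and \<eta> :: "'t \<Rightarrow> 'k"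
  assumes theta_bij: "bij_betw \<theta> (carrier S) (carrier K)"
    and theta_add: "\<lbrakk>s \<in> carrier S; s' \<in> carrier S\<rbrakk> \<Longrightarrow> \<theta> (s \<oplus>\<^bsub>S\<^esub> s') = \<theta> s \<oplus>\<^bsub>K\<^esub> \<theta> s'"
    and theta_smult: "\<lbrakk>a \<in> carrier A; s \<in> carrier S\<rbrakk> \<Longrightarrow> \<theta> (a \<odot>\<^bsub>S\<^esub> s) = \<chi> a \<otimes>\<^bsub>K\<^esub> \<theta> s"
    and eta_bij: "bij_betw \<eta> (carrier T) (carrier K)"
    and eta_add: "\<lbrakk>t \<in> carrier T; t' \<in> carrier T\<rbrakk> \<Longrightarrow> \<eta> (t \<oplus>\<^bsub>T\<^esub> t') = \<eta> t \<oplus>\<^bsub>K\<^esub> \<eta> t'"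
    and eta_smult: "\<lbrakk>a \<in> carrier A; t \<in> carrier T\<rbrakk> \<Longrightarrow> \<eta> (a \<odot>\<^bsub>T\<^esub> t) = \<psi> a \<otimes>\<^bsub>K\<^esub> \<eta> t"
begin

section \<open>The start of the canonical resolution of \<open>S\<close>\<close>

abbreviation F0 where "F0 \<equiv> resolution0 A S"
abbreviation F1 where "F1 \<equiv> resolution1 A S"
abbreviation F2 where "F2 \<equiv> resolution2 A S"
abbreviation d0 where "d0 \<equiv> free_eval A S"
abbreviation d1 where "d1 \<equiv> free_eval A F0"
abbreviation d2 where "d2 \<equiv> free_eval A F1"
abbreviation Z0 where "Z0 \<equiv> a_kernel F0 S d0"
abbreviation Z1 where "Z1 \<equiv> a_kernel F1 F0 d1"

sublocale F0: left_module A F0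
  unfolding resolution0_def by (rule A.left_module_free_module)
sublocale F1: left_module A F1
  unfolding resolution1_def by (rule A.left_module_free_module)
sublocale F2: left_module A F2
  unfolding resolution2_def by (rule A.left_module_free_module)

lemma Z0_iff: "x \<in> Z0 \<longleftrightarrow> x \<in> carrier F0 \<and> d0 x = \<zero>\<^bsub>S\<^esub>"
  by (simp add: a_kernel_def')
lemma Z1_iff: "x \<in> Z1 \<longleftrightarrow> x \<in> carrier F1 \<and> d1 x = \<zero>\<^bsub>F0\<^esub>"
  by (simp add: a_kernel_def')

lemma d0_hom: "d0 \<in> module_hom A F0 S"
  unfolding resolution0_def by (rule free_eval_hom[OF S.left_module_axioms]) simp
lemma d1_hom: "d1 \<in> module_hom A F1 F0"
  unfolding resolution1_def by (rule free_eval_hom[OF F0.left_module_axioms]) (auto simp: Z0_iff)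
lemma d2_hom: "d2 \<in> module_hom A F2 F1"
  unfolding resolution2_def by (rule free_eval_hom[OF F1.left_module_axioms]) (auto simp: Z1_iff)

lemmas d0_simps [simp] = module_hom_add[OF d0_hom] module_hom_smult[OF d0_hom]
  module_hom_zero[OF F0.left_module_axioms S.left_module_axioms d0_hom]
  module_hom_closed[OF d0_hom, THEN funcset_mem]
lemmas d1_simps [simp] = module_hom_add[OF d1_hom] module_hom_smult[OF d1_hom]
  module_hom_zero[OF F1.left_module_axioms F0.left_module_axioms d1_hom]
  module_hom_closed[OF d1_hom, THEN funcset_mem]
lemmas d2_simps [simp] = module_hom_add[OF d2_hom] module_hom_smult[OF d2_hom]
  module_hom_zero[OF F2.left_module_axioms F1.left_module_axioms d2_hom]
  module_hom_closed[OF d2_hom, THEN funcset_mem]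

lemma d1_in_Z0: "z \<in> carrier F1 \<Longrightarrow> d1 z \<in> Z0"
  using module_hom_free_eval_kernel[OF F0.left_module_axioms S.left_module_axioms d0_hom, of z]
  by (simp add: Z0_iff resolution1_def[symmetric])

lemma d2_in_Z1: "z \<in> carrier F2 \<Longrightarrow> d2 z \<in> Z1"
  using module_hom_free_eval_kernel[OF F1.left_module_axioms F0.left_module_axioms d1_hom, of z]
  by (simp add: Z1_iff resolution2_def[symmetric])

lemma unit0_closed [simp]: "s \<in> carrier S \<Longrightarrow> free_unit A s \<in> carrier F0"
  unfolding resolution0_def by (rule A.free_unit_closed)
lemma unit1_closed [simp]: "x \<in> Z0 \<Longrightarrow> free_unit A x \<in> carrier F1"
  unfolding resolution1_def by (rule A.free_unit_closed)
lemma unit2_closed [simp]: "x \<in> Z1 \<Longrightarrow> free_unit A x \<in> carrier F2"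
  unfolding resolution2_def by (rule A.free_unit_closed)

lemma d0_unit [simp]: "s \<in> carrier S \<Longrightarrow> d0 (free_unit A s) = s"
  by (rule free_eval_unit[OF S.left_module_axioms])
lemma d1_unit [simp]: "x \<in> Z0 \<Longrightarrow> d1 (free_unit A x) = x"
  by (rule free_eval_unit[OF F0.left_module_axioms]) (simp add: Z0_iff)
lemma d2_unit [simp]: "x \<in> Z1 \<Longrightarrow> d2 (free_unit A x) = x"
  by (rule free_eval_unit[OF F1.left_module_axioms]) (simp add: Z1_iff)

lemma Z0_add: "\<lbrakk>x \<in> Z0; y \<in> Z0\<rbrakk> \<Longrightarrow> x \<oplus>\<^bsub>F0\<^esub> y \<in> Z0"
  and Z0_smult: "\<lbrakk>a \<in> carrier A; x \<in> Z0\<rbrakk> \<Longrightarrow> a \<odot>\<^bsub>F0\<^esub> x \<in> Z0"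
  by (simp_all add: Z0_iff F0.smult_closed)

lemma theta_closed [simp]: "s \<in> carrier S \<Longrightarrow> \<theta> s \<in> carrier K"
  using theta_bij by (auto simp: bij_betw_def)
lemma eta_closed [simp]: "t \<in> carrier T \<Longrightarrow> \<eta> t \<in> carrier K"
  using eta_bij by (auto simp: bij_betw_def)
lemma theta_eqD: "\<lbrakk>\<theta> s = \<theta> s'; s \<in> carrier S; s' \<in> carrier S\<rbrakk> \<Longrightarrow> s = s'"
  using theta_bij by (auto simp: bij_betw_def inj_on_def)
lemma eta_eqD: "\<lbrakk>\<eta> s = \<eta> s'; s \<in> carrier T; s' \<in> carrier T\<rbrakk> \<Longrightarrow> s = s'"
  using eta_bij by (auto simp: bij_betw_def inj_on_def)
lemma theta_zero [simp]: "\<theta> \<zero>\<^bsub>S\<^esub> = \<zero>\<^bsub>K\<^esub>"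
  using theta_smult[of "\<zero>\<^bsub>A\<^esub>" "\<zero>\<^bsub>S\<^esub>"] by simp
lemma eta_zero [simp]: "\<eta> \<zero>\<^bsub>T\<^esub> = \<zero>\<^bsub>K\<^esub>"
  using eta_smult[of "\<zero>\<^bsub>A\<^esub>" "\<zero>\<^bsub>T\<^esub>"] by simp

definition vec :: "'k \<Rightarrow> 't" where "vec = inv_into (carrier T) \<eta>"

lemma vec_closed [simp]: "c \<in> carrier K \<Longrightarrow> vec c \<in> carrier T"
  unfolding vec_def using eta_bij by (metis bij_betw_def inv_into_into)
lemma eta_vec [simp]: "c \<in> carrier K \<Longrightarrow> \<eta> (vec c) = c"
  unfolding vec_def using eta_bij by (metis bij_betw_def f_inv_into_f)

definition s0 :: 's where "s0 = inv_into (carrier S) \<theta> \<one>\<^bsub>K\<^esub>"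

lemma s0_closed [simp]: "s0 \<in> carrier S"
  unfolding s0_def using theta_bij by (metis K.one_closed bij_betw_def inv_into_into)
lemma theta_s0 [simp]: "\<theta> s0 = \<one>\<^bsub>K\<^esub>"
  unfolding s0_def using theta_bij by (metis K.one_closed bij_betw_def f_inv_into_f)

section \<open>Cocycles, the first syzygy and derivations\<close>

definition syzygy :: "'a \<Rightarrow> 's \<Rightarrow> 'a" where
  "syzygy a = (a \<ominus>\<^bsub>A\<^esub> scalar (\<chi> a)) \<odot>\<^bsub>F0\<^esub> free_unit A s0"

text \<open>\<open>a\<close> and \<open>scalar (\<chi> a)\<close> act alike on \<open>S\<close>, so
  their difference kills \<open>s0\<close>.\<close>

lemma syzygy_closed [simp]: "a \<in> carrier A \<Longrightarrow> syzygy a \<in> Z0"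
  unfolding syzygy_def Z0_iff
  by (auto simp: F0.smult_closed S.smult_closed theta_smult A.minus_eq K.r_neg intro!: theta_eqD)

text \<open>Pullback along \<open>d1\<close> of a map on the kernel \<open>Z0\<close>. Cocycles are
  the pullbacks of linear maps on \<open>Z0\<close>, coboundaries those of linear maps defined on
  all of \<open>F0\<close>; cutting off at the carrier makes the result extensional.\<close>

definition restrict_hom :: "(('s \<Rightarrow> 'a) \<Rightarrow> 't) \<Rightarrow> (('s \<Rightarrow> 'a) \<Rightarrow> 'a) \<Rightarrow> 't" where
  "restrict_hom h = (\<lambda>z\<in>carrier F1. h (d1 z))"

lemma restrict_hom_cocycle:
  assumes "h \<in> Z0 \<rightarrow> carrier T"
    and add: "\<And>x y. \<lbrakk>x \<in> Z0; y \<in> Z0\<rbrakk> \<Longrightarrow> h (x \<oplus>\<^bsub>F0\<^esub> y) = h x \<oplus>\<^bsub>T\<^esub> h y"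
    and smult: "\<And>a x. \<lbrakk>a \<in> carrier A; x \<in> Z0\<rbrakk> \<Longrightarrow> h (a \<odot>\<^bsub>F0\<^esub> x) = a \<odot>\<^bsub>T\<^esub> h x"
  shows "restrict_hom h \<in> ext1_cocycles A S T"
proof -
  have z: "\<zero>\<^bsub>F0\<^esub> \<in> Z0" by (simp add: Z0_iff)
  have "h \<zero>\<^bsub>F0\<^esub> = \<zero>\<^bsub>T\<^esub>"
    using smult[OF A.zero_closed z] assms(1) z by (simp add: Pi_def)
  then show ?thesis
    using assms(1) d1_in_Z0 d2_in_Z1
    by (auto simp: ext1_cocycles_def module_hom_def restrict_hom_def F1.smult_closed add smult Z1_iff Pi_def)
qed

lemma coboundaries_eq: "ext1_coboundaries A S T = restrict_hom ` module_hom A F0 T"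
  by (simp add: ext1_coboundaries_def restrict_hom_def[abs_def])

lemma coboundaries_subset: "ext1_coboundaries A S T \<subseteq> ext1_cocycles A S T"
  unfolding coboundaries_eq
  by (auto intro!: restrict_hom_cocycle simp: Z0_iff module_hom_def Pi_def)

context
  fixes f assumes f: "f \<in> ext1_cocycles A S T"
begin

lemma cocycle_hom: "f \<in> module_hom A F1 T"
  using f by (simp add: ext1_cocycles_def)

lemma cocycle_closed: "z \<in> carrier F1 \<Longrightarrow> f z \<in> carrier T"
  using module_hom_closed[OF cocycle_hom] by auto

text \<open>A cocycle vanishes on the kernel of \<open>d1\<close>, because an element of
  \<open>Z1\<close> is the image under \<open>d2\<close> of its own basis element. Hence it factors
  through \<open>d1\<close>.\<close>

lemma cocycle_eq:
  assumes z: "z \<in> carrier F1" "z' \<in> carrier F1" and "d1 z = d1 z'"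
  shows "f z = f z'"
proof -
  \<comment> \<open>This is z - z', written with the action of -1 so that linearity of
    \<open>d1\<close> and \<open>f\<close> applies.\<close>
  let ?w = "z \<oplus>\<^bsub>F1\<^esub> (\<ominus>\<^bsub>A\<^esub> \<one>\<^bsub>A\<^esub>) \<odot>\<^bsub>F1\<^esub> z'"
  have "d1 ?w = (\<one>\<^bsub>A\<^esub> \<oplus>\<^bsub>A\<^esub> (\<ominus>\<^bsub>A\<^esub> \<one>\<^bsub>A\<^esub>)) \<odot>\<^bsub>F0\<^esub> d1 z'"
    using assms by (simp add: F1.smult_closed F0.smult_l_distr F0.smult_one del: A.r_neg)
  then have w: "?w \<in> Z1" using z by (simp add: Z1_iff F1.smult_closed A.r_neg)
  have "f ?w = \<zero>\<^bsub>T\<^esub>" 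
    using f unit2_closed[OF w] d2_unit[OF w] unfolding ext1_cocycles_def by fastforce
  then have "\<eta> (f ?w) = \<zero>\<^bsub>K\<^esub>" by simp
  moreover have "\<eta> (f ?w) = \<eta> (f z) \<oplus>\<^bsub>K\<^esub> (\<ominus>\<^bsub>K\<^esub> \<eta> (f z'))"
    using z by (simp add: module_hom_add[OF cocycle_hom] module_hom_smult[OF cocycle_hom]
      F1.smult_closed cocycle_closed T.smult_closed eta_add eta_smult K.l_minus)
  ultimately have "\<eta> (f z) = \<eta> (f z')"
    using z K.minus_equality[of "\<eta> (f z)" "\<ominus>\<^bsub>K\<^esub> \<eta> (f z')"] by (simp add: cocycle_closed)
  then show ?thesis using z cocycle_closed by (intro eta_eqD) auto
qed

lemma cocycle_via_d1: "z \<in> carrier F1 \<Longrightarrow> f z = f (free_unit A (d1 z))"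
  using d1_in_Z0 by (intro cocycle_eq) auto

text \<open>\<open>free_unit\<close> is not additive, but [x + y] and [x] + [y] have the same image
  under \<open>d1\<close>, and a cocycle sees nothing else. So x -> f[x] is the linear map on
  \<open>Z0\<close> from which \<open>f\<close> is pulled back.\<close>

lemma cocycle_unit_add:
  "\<lbrakk>x \<in> Z0; y \<in> Z0\<rbrakk> \<Longrightarrow> f (free_unit A (x \<oplus>\<^bsub>F0\<^esub> y)) = f (free_unit A x) \<oplus>\<^bsub>T\<^esub> f (free_unit A y)"
  using cocycle_via_d1[of "free_unit A x \<oplus>\<^bsub>F1\<^esub> free_unit A y"]
  by (simp add: module_hom_add[OF cocycle_hom])

lemma cocycle_unit_smult:
  "\<lbrakk>a \<in> carrier A; x \<in> Z0\<rbrakk> \<Longrightarrow> f (free_unit A (a \<odot>\<^bsub>F0\<^esub> x)) = a \<odot>\<^bsub>T\<^esub> f (free_unit A x)"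
  using cocycle_via_d1[of "a \<odot>\<^bsub>F1\<^esub> free_unit A x"]
  by (simp add: module_hom_smult[OF cocycle_hom] F1.smult_closed)

end

definition derivation_of :: "((('s \<Rightarrow> 'a) \<Rightarrow> 'a) \<Rightarrow> 't) \<Rightarrow> 'a \<Rightarrow> 'k" where
  "derivation_of f a = \<eta> (f (free_unit A (syzygy a)))"

lemma derivation_derivation_of:
  assumes f: "f \<in> ext1_cocycles A S T"
  shows "derivation (derivation_of f)"
  unfolding derivation_def
proof (intro conjI ballI)
  note [simp] = cocycle_closed[OF f] Z0_smult
  let ?h = "\<lambda>x. \<eta> (f (free_unit A x))"
  have h: "?h (x \<oplus>\<^bsub>F0\<^esub> y) = ?h x \<oplus>\<^bsub>K\<^esub> ?h y" "?h (a \<odot>\<^bsub>F0\<^esub> x) = \<psi> a \<otimes>\<^bsub>K\<^esub> ?h x"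
    if "x \<in> Z0" "y \<in> Z0" "a \<in> carrier A" for x y a
    using that by (simp_all add: cocycle_unit_add[OF f] cocycle_unit_smult[OF f] eta_add eta_smult)
  show "derivation_of f \<in> carrier A \<rightarrow> carrier K"
    by (auto simp: derivation_of_def)
  show "derivation_of f (scalar c) = \<zero>\<^bsub>K\<^esub>" if "c \<in> carrier K" for c
  proof -
    \<comment> \<open>This syzygy is zero; writing it as a multiple by zero lets \<open>h(2)\<close>
      conclude.\<close>
    have "syzygy (scalar c) = \<zero>\<^bsub>A\<^esub> \<odot>\<^bsub>F0\<^esub> syzygy (scalar c)"
      using that by (simp add: syzygy_def A.minus_eq A.r_neg)
    then show ?thesis
      using h(2)[of "syzygy (scalar c)" "syzygy (scalar c)" "\<zero>\<^bsub>A\<^esub>"] that by (simp add: derivation_of_def)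
  qed
  fix a b assume a: "a \<in> carrier A" and b: "b \<in> carrier A"
  have "syzygy (a \<oplus>\<^bsub>A\<^esub> b) = syzygy a \<oplus>\<^bsub>F0\<^esub> syzygy b"
    using a b by (simp add: syzygy_def A.minus_eq A.minus_add A.a_ac flip: F0.smult_l_distr)
  then show "derivation_of f (a \<oplus>\<^bsub>A\<^esub> b) = derivation_of f a \<oplus>\<^bsub>K\<^esub> derivation_of f b"
    using h(1)[of "syzygy a" "syzygy b"] a b by (simp add: derivation_of_def)
  \<comment> \<open>This is ab - \<chi>(ab) = a(b - \<chi>(b)) + \<chi>(b)(a - \<chi>(a)), applied
    to [s0]. The linear map on \<open>Z0\<close> turns it into the product rule.\<close>
  have "syzygy (a \<otimes>\<^bsub>A\<^esub> b) = (a \<odot>\<^bsub>F0\<^esub> syzygy b) \<oplus>\<^bsub>F0\<^esub> (scalar (\<chi> b) \<odot>\<^bsub>F0\<^esub> syzygy a)"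
  proof -
    let ?s = scalar
    \<comment> \<open>The product of a and \<chi>(b) is subtracted and added; centrality of the
      scalars then lets \<chi>(b) be factored out on the left.\<close>
    have "a \<otimes>\<^bsub>A\<^esub> b \<ominus>\<^bsub>A\<^esub> ?s (\<chi> (a \<otimes>\<^bsub>A\<^esub> b)) =
      a \<otimes>\<^bsub>A\<^esub> b \<ominus>\<^bsub>A\<^esub> a \<otimes>\<^bsub>A\<^esub> ?s (\<chi> b) \<oplus>\<^bsub>A\<^esub> (a \<otimes>\<^bsub>A\<^esub> ?s (\<chi> b) \<ominus>\<^bsub>A\<^esub> ?s (\<chi> b) \<otimes>\<^bsub>A\<^esub> ?s (\<chi> a))"
      using a b K.m_comm[of "\<chi> a" "\<chi> b"] by (simp add: A.minus_eq A.a_assoc A.r_neg1)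
    also have "\<dots> = a \<otimes>\<^bsub>A\<^esub> (b \<ominus>\<^bsub>A\<^esub> ?s (\<chi> b)) \<oplus>\<^bsub>A\<^esub> ?s (\<chi> b) \<otimes>\<^bsub>A\<^esub> (a \<ominus>\<^bsub>A\<^esub> ?s (\<chi> a))"
      using a b scalar_comm[of "\<chi> b" a] by (simp add: A.minus_eq A.r_distr A.r_minus)
    finally show ?thesis
      using a b by (simp add: syzygy_def F0.smult_l_distr F0.smult_assoc)
  qed
  then show "derivation_of f (a \<otimes>\<^bsub>A\<^esub> b) = \<psi> a \<otimes>\<^bsub>K\<^esub> derivation_of f b \<oplus>\<^bsub>K\<^esub> derivation_of f a \<otimes>\<^bsub>K\<^esub> \<chi> b"
    using h(1)[of "a \<odot>\<^bsub>F0\<^esub> syzygy b" "scalar (\<chi> b) \<odot>\<^bsub>F0\<^esub> syzygy a"] h(2)[of "syzygy b" "syzygy b" a]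
      h(2)[of "syzygy a" "syzygy a" "scalar (\<chi> b)"] a b
    by (simp add: derivation_of_def K.m_comm)
qed

text \<open>The connecting map of the extension 0 -> T -> E -> S -> 0 given by \<open>D\<close>: a
  lift of \<open>d0\<close> to E takes the syzygy into the first coordinate, which is a copy of
  \<open>T\<close>.\<close>

lemma derivation_of_surj:
  assumes D: "derivation D"
  obtains f where "f \<in> ext1_cocycles A S T" "\<And>a. a \<in> carrier A \<Longrightarrow> derivation_of f a = D a"
proof -
  let ?E = "extension_module D"
  interpret E: left_module A ?E using D by (rule left_module_extension_module)
  have E: "carrier ?E = carrier K \<times> carrier K"
    "\<And>v w. v \<oplus>\<^bsub>?E\<^esub> w = (fst v \<oplus>\<^bsub>K\<^esub> fst w, snd v \<oplus>\<^bsub>K\<^esub> snd w)"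
    "\<And>a v. a \<odot>\<^bsub>?E\<^esub> v = (\<psi> a \<otimes>\<^bsub>K\<^esub> fst v \<oplus>\<^bsub>K\<^esub> D a \<otimes>\<^bsub>K\<^esub> snd v, \<chi> a \<otimes>\<^bsub>K\<^esub> snd v)"
    "\<zero>\<^bsub>?E\<^esub> = (\<zero>\<^bsub>K\<^esub>, \<zero>\<^bsub>K\<^esub>)"
    by (simp_all add: extension_module_def)
  \<comment> \<open>A section of the second coordinate. It need not commute with the algebra, as it
    only prescribes values on a basis.\<close>
  define u where "u = (\<lambda>s. (\<zero>\<^bsub>K\<^esub>, \<theta> s))"
  define L where "L = free_lift A ?E u"
  have L: "L \<in> module_hom A F0 ?E"
    unfolding L_def resolution0_def by (rule E.free_lift_hom) (auto simp: u_def E)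
  have L_unit: "L (free_unit A s) = u s" if "s \<in> carrier S" for s
    unfolding L_def using that by (intro E.free_lift_unit) (simp add: u_def E)
  have L_closed: "fst (L x) \<in> carrier K" "snd (L x) \<in> carrier K" if "x \<in> carrier F0" for x
    using module_hom_closed[OF L] that by (auto simp: E Pi_def mem_Times_iff)
  have "snd (L x) = \<theta> (d0 x)" if "x \<in> carrier F0" for x
    using that unfolding resolution0_def
  proof (induction x rule: A.free_module_induct)
    case zero
    show ?case
      unfolding resolution0_def[symmetric]
      using module_hom_zero[OF F0.left_module_axioms E.left_module_axioms L] by (simp add: E)
  next
    case (unit a s)
    then show ?case
      unfolding resolution0_def[symmetric]
      by (simp add: module_hom_smult[OF L] E L_unit u_def theta_smult)
  next
    case (add f g)
    then show ?case
      unfolding resolution0_def[symmetric]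
      by (simp add: module_hom_add[OF L] E theta_add)
  qed
  then have L_snd: "snd (L x) = \<zero>\<^bsub>K\<^esub>" if "x \<in> Z0" for x using that by (simp add: Z0_iff)
  define h where "h = (\<lambda>x. vec (fst (L x)))"
  have eta_h: "\<eta> (h x) = fst (L x)" and h_closed: "h x \<in> carrier T" if "x \<in> Z0" for x
    using that L_closed by (simp_all add: h_def Z0_iff)
  have coc: "restrict_hom h \<in> ext1_cocycles A S T"
  proof (rule restrict_hom_cocycle)
    show "h (x \<oplus>\<^bsub>F0\<^esub> y) = h x \<oplus>\<^bsub>T\<^esub> h y" if "x \<in> Z0" "y \<in> Z0" for x y
      by (rule eta_eqD)
        (use that in \<open>simp_all add: eta_h h_closed Z0_add eta_add, simp add: Z0_iff module_hom_add[OF L] E\<close>)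
    \<comment> \<open>The term with \<open>D a\<close> is multiplied by the second coordinate, which
      vanishes on \<open>Z0\<close>.\<close>
    show "h (a \<odot>\<^bsub>F0\<^esub> x) = a \<odot>\<^bsub>T\<^esub> h x" if a: "a \<in> carrier A" and x: "x \<in> Z0" for a x
    proof (rule eta_eqD)
      have "x \<in> carrier F0" using x by (simp add: Z0_iff)
      then show "\<eta> (h (a \<odot>\<^bsub>F0\<^esub> x)) = \<eta> (a \<odot>\<^bsub>T\<^esub> h x)"
        using a x by (simp add: eta_h h_closed Z0_smult eta_smult module_hom_smult[OF L] E
          L_snd derivationD[OF D] L_closed)
    qed (use a x in \<open>simp_all add: h_closed Z0_smult T.smult_closed\<close>)
  qed (use h_closed in auto)
  moreover have "derivation_of (restrict_hom h) a = D a" if a: "a \<in> carrier A" for a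
  proof -
    \<comment> \<open>Since \<open>L\<close> sends [s0] to (0, 1), its first coordinate at the
      syzygy of a is D(a - \<chi>(a)); subtracting the scalar does not change the value of
      \<open>D\<close>.\<close>
    have "D (\<ominus>\<^bsub>A\<^esub> scalar (\<chi> a)) = \<zero>\<^bsub>K\<^esub>"
      using derivationD(4)[OF D, of "\<ominus>\<^bsub>K\<^esub> \<chi> a"] a by simp
    then have "D (a \<ominus>\<^bsub>A\<^esub> scalar (\<chi> a)) = D a"
      using a by (simp add: A.minus_eq derivationD[OF D])
    moreover have "derivation_of (restrict_hom h) a = fst (L (syzygy a))"
      using a by (simp add: derivation_of_def restrict_hom_def eta_h)
    ultimately show ?thesis
      using a by (simp add: syzygy_def module_hom_smult[OF L] L_unit u_def E derivationD[OF D])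
  qed
  ultimately show ?thesis by (rule that)
qed

text \<open>Every syzygy in the image of \<open>syzygy\<close> is a multiple of [s0], so of a
  homomorphism on \<open>F0\<close> the derivation sees only the value at [s0]; its coordinate is
  the constant \<open>c\<close>.\<close>

lemma derivation_of_coboundary:
  assumes "f \<in> ext1_coboundaries A S T"
  obtains c where "c \<in> carrier K"
    "\<And>a. a \<in> carrier A \<Longrightarrow> derivation_of f a = c \<otimes>\<^bsub>K\<^esub> (\<psi> a \<ominus>\<^bsub>K\<^esub> \<chi> a)"
proof -
  obtain g where g: "g \<in> module_hom A F0 T" "f = restrict_hom g"
    using assms by (auto simp: coboundaries_eq)
  have c: "g (free_unit A s0) \<in> carrier T" using module_hom_closed[OF g(1)] by auto
  have "derivation_of f a = \<eta> (g (free_unit A s0)) \<otimes>\<^bsub>K\<^esub> (\<psi> a \<ominus>\<^bsub>K\<^esub> \<chi> a)" if "a \<in> carrier A" for a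
  proof -
    have "derivation_of f a = \<eta> (g (syzygy a))"
      using that by (simp add: derivation_of_def g(2) restrict_hom_def)
    also have "\<dots> = \<psi> (a \<ominus>\<^bsub>A\<^esub> scalar (\<chi> a)) \<otimes>\<^bsub>K\<^esub> \<eta> (g (free_unit A s0))"
      using that c by (simp add: syzygy_def module_hom_smult[OF g(1)] eta_smult)
    finally show ?thesis using that c by (simp add: K.minus_eq A.minus_eq K.m_comm)
  qed
  with c show ?thesis by (intro that) auto
qed

text \<open>The linear map h on \<open>Z0\<close> has to be extended to \<open>F0\<close>. The
  retraction \<open>proj\<close>, sending x to x - \<theta>(d0 x)[s0], is only additive. Its defect
  of linearity is a syzygy, at which h is a value of the inner derivation; adding c \<theta>(d0 x)
  to h(proj x) compensates this.\<close>

lemma coboundary_if_inner: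
  assumes f: "f \<in> ext1_cocycles A S T" and c: "c \<in> carrier K"
    and inner: "\<And>a. a \<in> carrier A \<Longrightarrow> derivation_of f a = c \<otimes>\<^bsub>K\<^esub> (\<psi> a \<ominus>\<^bsub>K\<^esub> \<chi> a)"
  shows "f \<in> ext1_coboundaries A S T"
proof -
  note [simp] = cocycle_closed[OF f]
  define h where "h = (\<lambda>x. \<eta> (f (free_unit A x)))"
  have h_closed [simp]: "h x \<in> carrier K" if "x \<in> Z0" for x
    using that by (simp add: h_def)
  have h_add: "h (x \<oplus>\<^bsub>F0\<^esub> y) = h x \<oplus>\<^bsub>K\<^esub> h y" if "x \<in> Z0" "y \<in> Z0" for x y
    using that by (simp add: h_def cocycle_unit_add[OF f] eta_add)
  have h_smult: "h (a \<odot>\<^bsub>F0\<^esub> x) = \<psi> a \<otimes>\<^bsub>K\<^esub> h x" if "x \<in> Z0" "a \<in> carrier A" for x a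
    using that by (simp add: h_def cocycle_unit_smult[OF f] eta_smult)
  define proj where "proj x = x \<oplus>\<^bsub>F0\<^esub> scalar (\<ominus>\<^bsub>K\<^esub> \<theta> (d0 x)) \<odot>\<^bsub>F0\<^esub> free_unit A s0" for x
  have proj_closed [simp]: "proj x \<in> Z0" if "x \<in> carrier F0" for x
    unfolding Z0_iff proj_def using that
    by (auto simp: F0.smult_closed S.smult_closed theta_add theta_smult K.r_neg intro!: theta_eqD)
  have proj_add: "proj (x \<oplus>\<^bsub>F0\<^esub> y) = proj x \<oplus>\<^bsub>F0\<^esub> proj y" if "x \<in> carrier F0" "y \<in> carrier F0" for x y
    using that by (simp add: proj_def theta_add K.minus_add F0.smult_l_distr F0.smult_closed F0.a_ac)
  \<comment> \<open>The coordinate is that of h(proj x) + c \<theta>(d0 x) at x = [s]. The lift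
    \<open>g\<close> is linear by construction; that it agrees with this expression everywhere is
    \<open>key\<close>.\<close>
  define u where "u s = vec (\<theta> s \<otimes>\<^bsub>K\<^esub> c \<oplus>\<^bsub>K\<^esub> h (proj (free_unit A s)))" for s
  have u_closed: "u s \<in> carrier T" if "s \<in> carrier S" for s using that c by (simp add: u_def)
  define g where "g = free_lift A T u"
  have g: "g \<in> module_hom A F0 T"
    unfolding g_def resolution0_def by (rule T.free_lift_hom) (use u_closed in auto)
  have g_unit: "g (free_unit A s) = u s" if "s \<in> carrier S" for s
    unfolding g_def using that u_closed by (intro T.free_lift_unit)
  have "\<eta> (g x) = h (proj x) \<oplus>\<^bsub>K\<^esub> \<theta> (d0 x) \<otimes>\<^bsub>K\<^esub> c" if "x \<in> carrier F0" for x
    using that unfolding resolution0_def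
  proof (induction x rule: A.free_module_induct)
    case zero
    have "proj \<zero>\<^bsub>F0\<^esub> = \<zero>\<^bsub>A\<^esub> \<odot>\<^bsub>F0\<^esub> \<zero>\<^bsub>F0\<^esub>" by (simp add: proj_def)
    moreover have "\<zero>\<^bsub>F0\<^esub> \<in> Z0" by (simp add: Z0_iff)
    ultimately have "h (proj \<zero>\<^bsub>F0\<^esub>) = \<zero>\<^bsub>K\<^esub>" using h_smult[of "\<zero>\<^bsub>F0\<^esub>" "\<zero>\<^bsub>A\<^esub>"] by simp
    then show ?case
      unfolding resolution0_def[symmetric]
      using module_hom_zero[OF F0.left_module_axioms T.left_module_axioms g] c by simp
  next
    case (unit a s)
    let ?b = "a \<otimes>\<^bsub>A\<^esub> scalar (\<theta> s)"
    let ?e = "free_unit A s" and ?u = "free_unit A s0"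
    have cl [simp]: "a \<in> carrier A" "s \<in> carrier S" "?b \<in> carrier A" using unit by auto
    \<comment> \<open>The defect of linearity: proj(a[s]) and a proj([s]) differ by a syzygy, at
      which h takes an inner value.\<close>
    have *: "proj (a \<odot>\<^bsub>F0\<^esub> ?e) = a \<odot>\<^bsub>F0\<^esub> proj ?e \<oplus>\<^bsub>F0\<^esub> syzygy ?b"
    proof -
      have "a \<odot>\<^bsub>F0\<^esub> proj ?e \<oplus>\<^bsub>F0\<^esub> syzygy ?b = a \<odot>\<^bsub>F0\<^esub> ?e \<oplus>\<^bsub>F0\<^esub>
        ((\<ominus>\<^bsub>A\<^esub> ?b) \<odot>\<^bsub>F0\<^esub> ?u \<oplus>\<^bsub>F0\<^esub> (?b \<ominus>\<^bsub>A\<^esub> scalar (\<chi> ?b)) \<odot>\<^bsub>F0\<^esub> ?u)"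
      proof -
        have "a \<odot>\<^bsub>F0\<^esub> (scalar (\<ominus>\<^bsub>K\<^esub> \<theta> s) \<odot>\<^bsub>F0\<^esub> ?u) = (\<ominus>\<^bsub>A\<^esub> ?b) \<odot>\<^bsub>F0\<^esub> ?u"
          by (subst F0.smult_assoc[symmetric]) (simp_all add: A.r_minus)
        then show ?thesis
          by (simp add: proj_def syzygy_def F0.smult_r_distr F0.smult_closed F0.a_assoc
              del: scalar.hom_a_inv chi.hom_mult)
      qed
      also have "\<dots> = a \<odot>\<^bsub>F0\<^esub> ?e \<oplus>\<^bsub>F0\<^esub> (\<ominus>\<^bsub>A\<^esub> ?b \<oplus>\<^bsub>A\<^esub> (?b \<ominus>\<^bsub>A\<^esub> scalar (\<chi> ?b))) \<odot>\<^bsub>F0\<^esub> ?u"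
        by (subst F0.smult_l_distr) auto
      also have "\<ominus>\<^bsub>A\<^esub> ?b \<oplus>\<^bsub>A\<^esub> (?b \<ominus>\<^bsub>A\<^esub> scalar (\<chi> ?b)) = scalar (\<ominus>\<^bsub>K\<^esub> (\<chi> a \<otimes>\<^bsub>K\<^esub> \<theta> s))"
        by (simp add: A.minus_eq A.r_neg1)
      finally show ?thesis by (simp add: proj_def theta_smult)
    qed
    have "h (proj (a \<odot>\<^bsub>F0\<^esub> ?e)) = \<psi> a \<otimes>\<^bsub>K\<^esub> h (proj ?e) \<oplus>\<^bsub>K\<^esub> c \<otimes>\<^bsub>K\<^esub> (\<psi> ?b \<ominus>\<^bsub>K\<^esub> \<chi> ?b)"
    proof -
      have "h (syzygy ?b) = c \<otimes>\<^bsub>K\<^esub> (\<psi> ?b \<ominus>\<^bsub>K\<^esub> \<chi> ?b)"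
        using inner[of ?b] by (simp add: derivation_of_def h_def)
      then show ?thesis unfolding * by (simp add: h_add Z0_smult h_smult)
    qed
    also have "\<dots> \<oplus>\<^bsub>K\<^esub> \<theta> (d0 (a \<odot>\<^bsub>F0\<^esub> ?e)) \<otimes>\<^bsub>K\<^esub> c = \<psi> a \<otimes>\<^bsub>K\<^esub> (\<theta> s \<otimes>\<^bsub>K\<^esub> c \<oplus>\<^bsub>K\<^esub> h (proj ?e))"
    proof -
      \<comment> \<open>The part of the inner value that involves \<chi> cancels against c
        \<theta>(d0 x), and what remains is \<psi>(a) times the value at [s].\<close>
      have cancel: "c \<otimes>\<^bsub>K\<^esub> (p \<ominus>\<^bsub>K\<^esub> q) \<oplus>\<^bsub>K\<^esub> q \<otimes>\<^bsub>K\<^esub> c = c \<otimes>\<^bsub>K\<^esub> p"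
        if "p \<in> carrier K" "q \<in> carrier K" for p q
        using that c K.m_comm[of q c]
        by (simp add: K.minus_eq K.r_distr K.r_minus K.a_assoc K.l_neg)
      show ?thesis
        using c by (simp add: theta_smult K.a_assoc cancel) (simp add: K.r_distr K.m_ac K.a_comm)
    qed
    also have "\<dots> = \<eta> (g (a \<odot>\<^bsub>F0\<^esub> ?e))"
      using c by (simp add: module_hom_smult[OF g] g_unit u_closed eta_smult) (simp add: u_def)
    finally show ?case unfolding resolution0_def[symmetric] by simp
  next
    case (add x y)
    then have [simp]: "x \<in> carrier F0" "y \<in> carrier F0" by (simp_all add: resolution0_def)
    have [simp]: "g x \<in> carrier T" "g y \<in> carrier T" using module_hom_closed[OF g] by auto
    show ?case
      using add(3,4) c unfolding resolution0_def[symmetric]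
      by (simp add: module_hom_add[OF g] eta_add proj_add h_add theta_add K.l_distr K.a_ac)
  qed
  note key = this
  have g_eq: "g x = f (free_unit A x)" if "x \<in> Z0" for x
  proof (rule eta_eqD)
    have x: "x \<in> carrier F0" "d0 x = \<zero>\<^bsub>S\<^esub>" using that by (simp_all add: Z0_iff)
    then have "proj x = x" by (simp add: proj_def)
    then show "\<eta> (g x) = \<eta> (f (free_unit A x))" using key[OF x(1)] x c that by (simp add: h_def)
    show "g x \<in> carrier T" using module_hom_closed[OF g] x by auto
  qed (use that in simp)
  have "f = restrict_hom g"
  proof
    fix z show "f z = restrict_hom g z"
    proof (cases "z \<in> carrier F1")
      case True
      then show ?thesis using cocycle_via_d1[OF f True] g_eq[OF d1_in_Z0] by (simp add: restrict_hom_def)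
    next
      case False
      then show ?thesis using f by (simp add: restrict_hom_def ext1_cocycles_def extensional_def)
    qed
  qed
  then show ?thesis using g by (auto simp: coboundaries_eq)
qed

section \<open>The space of cocycles and the dimension of Ext\<close>

abbreviation cocycle_space where
  "cocycle_space \<equiv> (hom_space A F1 T)\<lparr>carrier := ext1_cocycles A S T\<rparr>"

lemma cocycle_space_simps:
  "f \<oplus>\<^bsub>cocycle_space\<^esub> g = (\<lambda>x\<in>carrier F1. f x \<oplus>\<^bsub>T\<^esub> g x)"
  "c \<odot>\<^bsub>cocycle_space\<^esub> f = (\<lambda>x\<in>carrier F1. scalar c \<odot>\<^bsub>T\<^esub> f x)"
  "\<zero>\<^bsub>cocycle_space\<^esub> = (\<lambda>x\<in>carrier F1. \<zero>\<^bsub>T\<^esub>)"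
  "f \<oplus>\<^bsub>hom_space A F1 T\<^esub> g = (\<lambda>x\<in>carrier F1. f x \<oplus>\<^bsub>T\<^esub> g x)"
  "c \<odot>\<^bsub>hom_space A F1 T\<^esub> f = (\<lambda>x\<in>carrier F1. scalar c \<odot>\<^bsub>T\<^esub> f x)"
  "\<zero>\<^bsub>hom_space A F1 T\<^esub> = (\<lambda>x\<in>carrier F1. \<zero>\<^bsub>T\<^esub>)"
  by (simp_all add: hom_space_def scalar_def)

lemma cocycle_iff: "f \<in> ext1_cocycles A S T \<longleftrightarrow>
  f \<in> carrier F1 \<rightarrow>\<^sub>E carrier T \<and>
  (\<forall>x\<in>carrier F1. \<forall>y\<in>carrier F1. f (x \<oplus>\<^bsub>F1\<^esub> y) = f x \<oplus>\<^bsub>T\<^esub> f y) \<and>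
  (\<forall>a\<in>carrier A. \<forall>x\<in>carrier F1. f (a \<odot>\<^bsub>F1\<^esub> x) = a \<odot>\<^bsub>T\<^esub> f x) \<and>
  (\<forall>x\<in>carrier F2. f (d2 x) = \<zero>\<^bsub>T\<^esub>)"
  by (auto simp: ext1_cocycles_def module_hom_def PiE_iff)

text \<open>Scaling keeps a cocycle linear over the algebra because scalars commute with every
  element of it.\<close>

lemma vectorspace_cocycle_space: "vectorspace K cocycle_space"
proof -
  have T: "f x \<in> carrier T" if "f \<in> ext1_cocycles A S T" "x \<in> carrier F1" for f x
    using cocycle_closed that by blast
  have add: "f \<oplus>\<^bsub>cocycle_space\<^esub> g \<in> ext1_cocycles A S T"
    if f: "f \<in> ext1_cocycles A S T" and g: "g \<in> ext1_cocycles A S T" for f g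
    using f g T[OF f] T[OF g] unfolding cocycle_iff cocycle_space_simps
    by (auto simp: F1.smult_closed T.smult_closed T.smult_r_distr T.a_ac)
  have smult: "c \<odot>\<^bsub>cocycle_space\<^esub> f \<in> ext1_cocycles A S T"
    if c: "c \<in> carrier K" and f: "f \<in> ext1_cocycles A S T" for c f
    using f c T[OF f] scalar_comm[OF c] unfolding cocycle_iff cocycle_space_simps
    by (auto simp: F1.smult_closed T.smult_closed T.smult_r_distr simp flip: T.smult_assoc)
  have ext: "f = g" if "f \<in> ext1_cocycles A S T" "g \<in> ext1_cocycles A S T"
    "\<And>x. x \<in> carrier F1 \<Longrightarrow> f x = g x" for f g
    using that by (auto simp: ext1_cocycles_def intro: extensionalityI)
  have zero: "\<zero>\<^bsub>cocycle_space\<^esub> \<in> ext1_cocycles A S T"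
    by (auto simp: cocycle_iff cocycle_space_simps F1.smult_closed)
  have "abelian_group cocycle_space"
  proof (rule abelian_groupI)
    show "\<exists>g\<in>carrier cocycle_space. g \<oplus>\<^bsub>cocycle_space\<^esub> f = \<zero>\<^bsub>cocycle_space\<^esub>"
      if "f \<in> carrier cocycle_space" for f
    proof (intro bexI[of _ "(\<ominus>\<^bsub>K\<^esub> \<one>\<^bsub>K\<^esub>) \<odot>\<^bsub>cocycle_space\<^esub> f"] ext)
      fix x assume x: "x \<in> carrier F1"
      have "scalar (\<ominus>\<^bsub>K\<^esub> \<one>\<^bsub>K\<^esub>) \<odot>\<^bsub>T\<^esub> f x \<oplus>\<^bsub>T\<^esub> f x = (\<ominus>\<^bsub>A\<^esub> \<one>\<^bsub>A\<^esub> \<oplus>\<^bsub>A\<^esub> \<one>\<^bsub>A\<^esub>) \<odot>\<^bsub>T\<^esub> f x"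
        using x that T by (subst T.smult_l_distr) (auto simp: T.smult_one)
      then show "((\<ominus>\<^bsub>K\<^esub> \<one>\<^bsub>K\<^esub>) \<odot>\<^bsub>cocycle_space\<^esub> f \<oplus>\<^bsub>cocycle_space\<^esub> f) x = \<zero>\<^bsub>cocycle_space\<^esub> x"
        using x that T by (simp add: cocycle_space_simps A.l_neg)
    qed (use that add smult zero in auto)
    show "f \<oplus>\<^bsub>cocycle_space\<^esub> g \<oplus>\<^bsub>cocycle_space\<^esub> h = f \<oplus>\<^bsub>cocycle_space\<^esub> (g \<oplus>\<^bsub>cocycle_space\<^esub> h)"
      if "f \<in> carrier cocycle_space" "g \<in> carrier cocycle_space" "h \<in> carrier cocycle_space" for f g h
      by (rule ext; (intro add)?) (use that in \<open>simp_all add: cocycle_space_simps T T.a_assoc\<close>)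
    show "f \<oplus>\<^bsub>cocycle_space\<^esub> g = g \<oplus>\<^bsub>cocycle_space\<^esub> f"
      if "f \<in> carrier cocycle_space" "g \<in> carrier cocycle_space" for f g
      by (rule ext; (intro add)?) (use that in \<open>simp_all add: cocycle_space_simps T T.a_comm\<close>)
    show "\<zero>\<^bsub>cocycle_space\<^esub> \<oplus>\<^bsub>cocycle_space\<^esub> f = f" if "f \<in> carrier cocycle_space" for f
      by (rule ext; (intro add zero)?) (use that in \<open>simp_all add: cocycle_space_simps T\<close>)
  qed (use add zero in auto)
  then have "module K cocycle_space"
  proof (rule moduleI[OF K.is_cring])
    fix c d f g
    note simps = cocycle_space_simps T T.smult_one T.smult_closed T.smult_assoc T.smult_l_distr T.smult_r_distr
    show "(c \<oplus>\<^bsub>K\<^esub> d) \<odot>\<^bsub>cocycle_space\<^esub> f =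
        c \<odot>\<^bsub>cocycle_space\<^esub> f \<oplus>\<^bsub>cocycle_space\<^esub> d \<odot>\<^bsub>cocycle_space\<^esub> f"
      if "c \<in> carrier K" "d \<in> carrier K" "f \<in> carrier cocycle_space"
      by (rule ext; (intro add smult)?) (use that in \<open>simp_all add: simps\<close>)
    show "c \<odot>\<^bsub>cocycle_space\<^esub> (f \<oplus>\<^bsub>cocycle_space\<^esub> g) =
        c \<odot>\<^bsub>cocycle_space\<^esub> f \<oplus>\<^bsub>cocycle_space\<^esub> c \<odot>\<^bsub>cocycle_space\<^esub> g"
      if "c \<in> carrier K" "f \<in> carrier cocycle_space" "g \<in> carrier cocycle_space"
      by (rule ext; (intro add smult)?) (use that in \<open>simp_all add: simps\<close>)
    show "(c \<otimes>\<^bsub>K\<^esub> d) \<odot>\<^bsub>cocycle_space\<^esub> f =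
        c \<odot>\<^bsub>cocycle_space\<^esub> (d \<odot>\<^bsub>cocycle_space\<^esub> f)"
      if "c \<in> carrier K" "d \<in> carrier K" "f \<in> carrier cocycle_space"
      by (rule ext; (intro smult)?) (use that in \<open>simp_all add: simps\<close>)
    show "\<one>\<^bsub>K\<^esub> \<odot>\<^bsub>cocycle_space\<^esub> f = f" if "f \<in> carrier cocycle_space"
      by (rule ext; (intro smult)?) (use that in \<open>simp_all add: simps\<close>)
  qed (use smult in auto)
  then show ?thesis by (intro vectorspace.intro K.field_axioms)
qed

text \<open>The functionals evaluate derivations at the elements \<open>p i\<close>. Both characters
  agree there, so inner derivations vanish and evaluation is well defined on Ext;
  \<open>dual\<close> makes the functionals independent, and \<open>inner\<close> says that they
  separate classes.\<close>

theorem vs_dim_ext1: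
  assumes "finite I" and p: "p \<in> I \<rightarrow> carrier A"
    and p_eq: "\<And>i. i \<in> I \<Longrightarrow> \<psi> (p i) = \<chi> (p i)"
    and dual: "\<And>j. j \<in> I \<Longrightarrow> \<exists>D. derivation D \<and> (\<forall>i\<in>I. D (p i) = (if i = j then \<one>\<^bsub>K\<^esub> else \<zero>\<^bsub>K\<^esub>))"
    and inner: "\<And>D. \<lbrakk>derivation D; \<forall>i\<in>I. D (p i) = \<zero>\<^bsub>K\<^esub>\<rbrakk> \<Longrightarrow>
      \<exists>c\<in>carrier K. \<forall>a\<in>carrier A. D a = c \<otimes>\<^bsub>K\<^esub> (\<psi> a \<ominus>\<^bsub>K\<^esub> \<chi> a)"
  shows "vs_dim K (ext1 A S T) = enat (card I)"
proof -
  have "\<exists>f. f \<in> ext1_cocycles A S T \<and> (\<forall>i\<in>I. derivation_of f (p i) = (if i = j then \<one>\<^bsub>K\<^esub> else \<zero>\<^bsub>K\<^esub>))"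
    if j: "j \<in> I" for j
  proof -
    obtain D where D: "derivation D" "\<forall>i\<in>I. D (p i) = (if i = j then \<one>\<^bsub>K\<^esub> else \<zero>\<^bsub>K\<^esub>)"
      using dual[OF j] by blast
    obtain f where "f \<in> ext1_cocycles A S T" "\<And>a. a \<in> carrier A \<Longrightarrow> derivation_of f a = D a"
      using derivation_of_surj[OF D(1)] by blast
    then show ?thesis using D(2) p by (intro exI[of _ f]) (auto simp: Pi_def)
  qed
  then obtain u where u: "\<And>j. j \<in> I \<Longrightarrow> u j \<in> ext1_cocycles A S T"
    "\<And>i j. \<lbrakk>i \<in> I; j \<in> I\<rbrakk> \<Longrightarrow> derivation_of (u j) (p i) = (if i = j then \<one>\<^bsub>K\<^esub> else \<zero>\<^bsub>K\<^esub>)"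
    by metis
  show ?thesis unfolding ext1_def
  proof (rule vs_dim_quotient_module_kernel[OF vectorspace_cocycle_space \<open>finite I\<close>,
      where x = "\<lambda>i f. derivation_of f (p i)" and u = u])
    show "ext1_coboundaries A S T =
      {f \<in> carrier cocycle_space. \<forall>i\<in>I. derivation_of f (p i) = \<zero>\<^bsub>K\<^esub>}" (is "_ = ?N")
    proof
      show "ext1_coboundaries A S T \<subseteq> ?N"
      proof
        fix f assume f: "f \<in> ext1_coboundaries A S T"
        then obtain c where "c \<in> carrier K"
          "\<And>a. a \<in> carrier A \<Longrightarrow> derivation_of f a = c \<otimes>\<^bsub>K\<^esub> (\<psi> a \<ominus>\<^bsub>K\<^esub> \<chi> a)"
          using derivation_of_coboundary by blast
        then show "f \<in> ?N"
          using p p_eq f coboundaries_subset by (auto simp: K.minus_eq K.r_neg Pi_def)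
      qed
      show "?N \<subseteq> ext1_coboundaries A S T"
        using inner derivation_derivation_of by (force intro: coboundary_if_inner)
    qed
  qed (use p u in \<open>auto simp: cocycle_space_simps derivation_of_def cocycle_closed Pi_def eta_add eta_smult\<close>)
qed

end

section \<open>Monoid algebras\<close>

locale finite_monoid_algebra = K: cring K + B: monoid B
  for K :: "('k, 'c) ring_scheme" and B :: "('b, 'd) monoid_scheme" +
  assumes finite_B: "finite (carrier B)"
begin

abbreviation A where "A \<equiv> monoid_algebra K B"

text \<open>The linear extension of a function \<open>u\<close> from the monoid to its algebra.
  Coefficients are the case of an indicator function (\<open>lin_coeff\<close>), so identities in
  the algebra reduce to identities between nested \<open>lin\<close> expressions.\<close>

definition lin :: "('b \<Rightarrow> 'k) \<Rightarrow> ('b \<Rightarrow> 'k) \<Rightarrow> 'k" where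
  "lin u f = (\<Oplus>\<^bsub>K\<^esub>b\<in>carrier B. f b \<otimes>\<^bsub>K\<^esub> u b)"

definition single :: "'b \<Rightarrow> 'b \<Rightarrow> 'k" where
  "single b = (\<lambda>x\<in>carrier B. if x = b then \<one>\<^bsub>K\<^esub> else \<zero>\<^bsub>K\<^esub>)"

lemma algebra_simps:
  "carrier A = carrier B \<rightarrow>\<^sub>E carrier K"
  "\<zero>\<^bsub>A\<^esub> = (\<lambda>x\<in>carrier B. \<zero>\<^bsub>K\<^esub>)"
  "f \<oplus>\<^bsub>A\<^esub> g = (\<lambda>x\<in>carrier B. f x \<oplus>\<^bsub>K\<^esub> g x)"
  "c \<odot>\<^bsub>A\<^esub> f = (\<lambda>x\<in>carrier B. c \<otimes>\<^bsub>K\<^esub> f x)"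
  by (simp_all add: monoid_algebra_def)

lemma one_eq_single: "\<one>\<^bsub>A\<^esub> = single \<one>\<^bsub>B\<^esub>"
  by (simp add: monoid_algebra_def single_def)

lemma coeff_closed [simp]: "\<lbrakk>f \<in> carrier A; b \<in> carrier B\<rbrakk> \<Longrightarrow> f b \<in> carrier K"
  by (auto simp: algebra_simps)

lemma algebra_eqI:
  "\<lbrakk>f \<in> carrier A; g \<in> carrier A; \<And>b. b \<in> carrier B \<Longrightarrow> f b = g b\<rbrakk> \<Longrightarrow> f = g"
  by (auto simp: algebra_simps intro: PiE_ext)

lemma single_closed [simp]: "single b \<in> carrier A"
  by (auto simp: single_def algebra_simps)

lemma add_closed: "\<lbrakk>f \<in> carrier A; g \<in> carrier A\<rbrakk> \<Longrightarrow> f \<oplus>\<^bsub>A\<^esub> g \<in> carrier A"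
  and smult_closed: "\<lbrakk>c \<in> carrier K; f \<in> carrier A\<rbrakk> \<Longrightarrow> c \<odot>\<^bsub>A\<^esub> f \<in> carrier A"
  and zero_closed: "\<zero>\<^bsub>A\<^esub> \<in> carrier A"
  by (auto simp: algebra_simps PiE_mem)

lemma mult_closed: "\<lbrakk>f \<in> carrier A; g \<in> carrier A\<rbrakk> \<Longrightarrow> f \<otimes>\<^bsub>A\<^esub> g \<in> carrier A"
  by (auto simp: monoid_algebra_def PiE_mem intro!: K.finsum_closed)

lemma lin_closed [simp]: "\<lbrakk>f \<in> carrier A; u \<in> carrier B \<rightarrow> carrier K\<rbrakk> \<Longrightarrow> lin u f \<in> carrier K"
  unfolding lin_def by (intro K.finsum_closed) auto

lemma lin_cong:
  "\<lbrakk>\<And>b. b \<in> carrier B \<Longrightarrow> u b = v b; f \<in> carrier A; v \<in> carrier B \<rightarrow> carrier K\<rbrakk> \<Longrightarrow> lin u f = lin v f"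
  unfolding lin_def by (intro K.finsum_cong') auto

lemma lin_zero: "u \<in> carrier B \<rightarrow> carrier K \<Longrightarrow> lin u \<zero>\<^bsub>A\<^esub> = \<zero>\<^bsub>K\<^esub>"
  unfolding lin_def by (intro K.add.finprod_one_eqI) (auto simp: algebra_simps Pi_def)

lemma lin_add:
  assumes "f \<in> carrier A" "g \<in> carrier A" "u \<in> carrier B \<rightarrow> carrier K"
  shows "lin u (f \<oplus>\<^bsub>A\<^esub> g) = lin u f \<oplus>\<^bsub>K\<^esub> lin u g"
proof -
  have "lin u (f \<oplus>\<^bsub>A\<^esub> g) = (\<Oplus>\<^bsub>K\<^esub>b\<in>carrier B. f b \<otimes>\<^bsub>K\<^esub> u b \<oplus>\<^bsub>K\<^esub> g b \<otimes>\<^bsub>K\<^esub> u b)"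
    unfolding lin_def using assms
    by (intro K.finsum_cong') (auto simp: algebra_simps(3) K.l_distr Pi_def)
  also have "\<dots> = lin u f \<oplus>\<^bsub>K\<^esub> lin u g"
    unfolding lin_def using assms by (intro K.finsum_addf) auto
  finally show ?thesis .
qed

lemma lin_smult:
  assumes "c \<in> carrier K" "f \<in> carrier A" "u \<in> carrier B \<rightarrow> carrier K"
  shows "lin u (c \<odot>\<^bsub>A\<^esub> f) = c \<otimes>\<^bsub>K\<^esub> lin u f"
proof -
  have "lin u (c \<odot>\<^bsub>A\<^esub> f) = (\<Oplus>\<^bsub>K\<^esub>b\<in>carrier B. c \<otimes>\<^bsub>K\<^esub> (f b \<otimes>\<^bsub>K\<^esub> u b))"
    unfolding lin_def using assms
    by (intro K.finsum_cong') (auto simp: algebra_simps(4) K.m_assoc Pi_def)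
  also have "\<dots> = c \<otimes>\<^bsub>K\<^esub> lin u f"
    unfolding lin_def using assms finite_B by (intro K.finsum_rdistr[symmetric]) auto
  finally show ?thesis .
qed

lemma lin_add_right:
  assumes "f \<in> carrier A" "u \<in> carrier B \<rightarrow> carrier K" "v \<in> carrier B \<rightarrow> carrier K"
  shows "lin (\<lambda>b. u b \<oplus>\<^bsub>K\<^esub> v b) f = lin u f \<oplus>\<^bsub>K\<^esub> lin v f"
proof -
  have "lin (\<lambda>b. u b \<oplus>\<^bsub>K\<^esub> v b) f = (\<Oplus>\<^bsub>K\<^esub>b\<in>carrier B. f b \<otimes>\<^bsub>K\<^esub> u b \<oplus>\<^bsub>K\<^esub> f b \<otimes>\<^bsub>K\<^esub> v b)"
    unfolding lin_def using assms by (intro K.finsum_cong') (auto simp: K.r_distr Pi_def)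
  also have "\<dots> = lin u f \<oplus>\<^bsub>K\<^esub> lin v f"
    unfolding lin_def using assms by (intro K.finsum_addf) auto
  finally show ?thesis .
qed

lemma lin_smult_right:
  assumes "f \<in> carrier A" "c \<in> carrier K" "u \<in> carrier B \<rightarrow> carrier K"
  shows "lin (\<lambda>b. c \<otimes>\<^bsub>K\<^esub> u b) f = c \<otimes>\<^bsub>K\<^esub> lin u f"
proof -
  have "lin (\<lambda>b. c \<otimes>\<^bsub>K\<^esub> u b) f = (\<Oplus>\<^bsub>K\<^esub>b\<in>carrier B. c \<otimes>\<^bsub>K\<^esub> (f b \<otimes>\<^bsub>K\<^esub> u b))"
    unfolding lin_def using assms by (intro K.finsum_cong') (auto simp: K.m_lcomm Pi_def)
  also have "\<dots> = c \<otimes>\<^bsub>K\<^esub> lin u f"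
    unfolding lin_def using assms finite_B by (intro K.finsum_rdistr[symmetric]) auto
  finally show ?thesis .
qed

lemma lin_single [simp]:
  assumes "b \<in> carrier B" "u \<in> carrier B \<rightarrow> carrier K"
  shows "lin u (single b) = u b"
proof -
  have "lin u (single b) = (\<Oplus>\<^bsub>K\<^esub>x\<in>carrier B. if x = b then u b else \<zero>\<^bsub>K\<^esub>)"
    unfolding lin_def single_def using assms by (intro K.finsum_cong') (auto simp: Pi_def)
  also have "\<dots> = u b" using assms finite_B by (intro K.finsum_single) auto
  finally show ?thesis .
qed

lemma lin_coeff:
  assumes "b \<in> carrier B" "f \<in> carrier A"
  shows "lin (\<lambda>x. if x = b then \<one>\<^bsub>K\<^esub> else \<zero>\<^bsub>K\<^esub>) f = f b"
proof -
  have "lin (\<lambda>x. if x = b then \<one>\<^bsub>K\<^esub> else \<zero>\<^bsub>K\<^esub>) f = (\<Oplus>\<^bsub>K\<^esub>x\<in>carrier B. if x = b then f b else \<zero>\<^bsub>K\<^esub>)"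
    unfolding lin_def using assms by (intro K.finsum_cong') auto
  also have "\<dots> = f b" using assms finite_B by (intro K.finsum_single) auto
  finally show ?thesis .
qed

text \<open>The shape in which \<open>mult_coeff\<close> leaves a product whose left factor is a
  multiple of the identity.\<close>

lemma lin_coeff_one_mult:
  assumes "b \<in> carrier B" "f \<in> carrier A"
  shows "lin (\<lambda>x. if \<one>\<^bsub>B\<^esub> \<otimes>\<^bsub>B\<^esub> x = b then \<one>\<^bsub>K\<^esub> else \<zero>\<^bsub>K\<^esub>) f = f b"
  using assms lin_cong[of "\<lambda>x. if \<one>\<^bsub>B\<^esub> \<otimes>\<^bsub>B\<^esub> x = b then \<one>\<^bsub>K\<^esub> else \<zero>\<^bsub>K\<^esub>"
    "\<lambda>x. if x = b then \<one>\<^bsub>K\<^esub> else \<zero>\<^bsub>K\<^esub>" f] lin_coeff by simp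

text \<open>Convolution groups pairs by their product; undoing the grouping leaves the double sum of
  f(a) g(b) u(ab).\<close>

lemma lin_mult:
  assumes f: "f \<in> carrier A" and g: "g \<in> carrier A" and u: "u \<in> carrier B \<rightarrow> carrier K"
  shows "lin u (f \<otimes>\<^bsub>A\<^esub> g) = lin (\<lambda>a. lin (\<lambda>b. u (a \<otimes>\<^bsub>B\<^esub> b)) g) f"
proof -
  let ?P = "carrier B \<times> carrier B"
  let ?m = "\<lambda>p. fst p \<otimes>\<^bsub>B\<^esub> snd p"
  let ?F = "\<lambda>p. f (fst p) \<otimes>\<^bsub>K\<^esub> g (snd p)"
  have F: "?F p \<in> carrier K" "?m p \<in> carrier B" "u (?m p) \<in> carrier K" if "p \<in> ?P" for p
    using that f g u by auto
  have "lin u (f \<otimes>\<^bsub>A\<^esub> g) =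
    (\<Oplus>\<^bsub>K\<^esub>x\<in>carrier B. \<Oplus>\<^bsub>K\<^esub>p\<in>{p \<in> ?P. ?m p = x}. ?F p \<otimes>\<^bsub>K\<^esub> u (?m p))"
    unfolding lin_def
  proof (rule K.finsum_cong')
    fix x assume x: "x \<in> carrier B"
    have "(f \<otimes>\<^bsub>A\<^esub> g) x \<otimes>\<^bsub>K\<^esub> u x = (\<Oplus>\<^bsub>K\<^esub>p\<in>{p \<in> ?P. ?m p = x}. ?F p \<otimes>\<^bsub>K\<^esub> u x)"
      using x F finite_B u by (subst K.finsum_ldistr[symmetric]) (auto simp: monoid_algebra_def)
    also have "\<dots> = (\<Oplus>\<^bsub>K\<^esub>p\<in>{p \<in> ?P. ?m p = x}. ?F p \<otimes>\<^bsub>K\<^esub> u (?m p))"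
      using F by (intro K.finsum_cong') auto
    finally show "(f \<otimes>\<^bsub>A\<^esub> g) x \<otimes>\<^bsub>K\<^esub> u x = (\<Oplus>\<^bsub>K\<^esub>p\<in>{p \<in> ?P. ?m p = x}. ?F p \<otimes>\<^bsub>K\<^esub> u (?m p))" .
  qed (use F in \<open>auto intro!: K.finsum_closed\<close>)
  also have "\<dots> = (\<Oplus>\<^bsub>K\<^esub>p\<in>?P. ?F p \<otimes>\<^bsub>K\<^esub> u (?m p))"
    using finite_B F by (intro K.finsum_fibres) auto
  also have "\<dots> = (\<Oplus>\<^bsub>K\<^esub>a\<in>carrier B. \<Oplus>\<^bsub>K\<^esub>b\<in>carrier B. f a \<otimes>\<^bsub>K\<^esub> g b \<otimes>\<^bsub>K\<^esub> u (a \<otimes>\<^bsub>B\<^esub> b))"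
    using K.finsum_Times[OF finite_B finite_B, where f = "\<lambda>p. ?F p \<otimes>\<^bsub>K\<^esub> u (?m p)"] F by fastforce
  also have "\<dots> = lin (\<lambda>a. lin (\<lambda>b. u (a \<otimes>\<^bsub>B\<^esub> b)) g) f"
    unfolding lin_def
  proof (rule K.finsum_cong')
    fix a assume a: "a \<in> carrier B"
    have "(\<Oplus>\<^bsub>K\<^esub>b\<in>carrier B. f a \<otimes>\<^bsub>K\<^esub> g b \<otimes>\<^bsub>K\<^esub> u (a \<otimes>\<^bsub>B\<^esub> b)) =
        (\<Oplus>\<^bsub>K\<^esub>b\<in>carrier B. f a \<otimes>\<^bsub>K\<^esub> (g b \<otimes>\<^bsub>K\<^esub> u (a \<otimes>\<^bsub>B\<^esub> b)))"
      using a f g u by (intro K.finsum_cong') (auto simp: K.m_assoc Pi_def)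
    also have "\<dots> = f a \<otimes>\<^bsub>K\<^esub> (\<Oplus>\<^bsub>K\<^esub>b\<in>carrier B. g b \<otimes>\<^bsub>K\<^esub> u (a \<otimes>\<^bsub>B\<^esub> b))"
      using a f g u finite_B by (intro K.finsum_rdistr[symmetric]) (auto simp: Pi_def)
    finally show "(\<Oplus>\<^bsub>K\<^esub>b\<in>carrier B. f a \<otimes>\<^bsub>K\<^esub> g b \<otimes>\<^bsub>K\<^esub> u (a \<otimes>\<^bsub>B\<^esub> b)) =
        f a \<otimes>\<^bsub>K\<^esub> (\<Oplus>\<^bsub>K\<^esub>b\<in>carrier B. g b \<otimes>\<^bsub>K\<^esub> u (a \<otimes>\<^bsub>B\<^esub> b))" .
  qed (use f g u in \<open>auto simp: Pi_def intro!: K.finsum_closed\<close>)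
  finally show ?thesis .
qed

lemma mult_coeff:
  assumes "f \<in> carrier A" "g \<in> carrier A" "x \<in> carrier B"
  shows "(f \<otimes>\<^bsub>A\<^esub> g) x =
    lin (\<lambda>a. lin (\<lambda>b. if a \<otimes>\<^bsub>B\<^esub> b = x then \<one>\<^bsub>K\<^esub> else \<zero>\<^bsub>K\<^esub>) g) f"
  using lin_mult[of f g "\<lambda>y. if y = x then \<one>\<^bsub>K\<^esub> else \<zero>\<^bsub>K\<^esub>"] assms
  by (simp add: lin_coeff mult_closed)

lemma ring_algebra: "ring A"
proof (rule ringI)
  show "abelian_group A"
  proof (rule abelian_groupI)
    show "\<exists>g\<in>carrier A. g \<oplus>\<^bsub>A\<^esub> f = \<zero>\<^bsub>A\<^esub>" if f: "f \<in> carrier A" for f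
      using f by (intro bexI[of _ "(\<ominus>\<^bsub>K\<^esub> \<one>\<^bsub>K\<^esub>) \<odot>\<^bsub>A\<^esub> f"] algebra_eqI add_closed zero_closed smult_closed)
        (auto simp: algebra_simps(2-4) K.l_minus K.l_neg)
  qed (auto intro!: algebra_eqI add_closed zero_closed, auto simp: algebra_simps(2,3) K.a_ac)
  show "monoid A"
  proof (rule monoidI)
    fix f g h assume f: "f \<in> carrier A" and g: "g \<in> carrier A" and h: "h \<in> carrier A"
    show "f \<otimes>\<^bsub>A\<^esub> g \<otimes>\<^bsub>A\<^esub> h = f \<otimes>\<^bsub>A\<^esub> (g \<otimes>\<^bsub>A\<^esub> h)"
    proof (rule algebra_eqI)
      fix x assume x: "x \<in> carrier B"
      let ?e = "\<lambda>y. if y = x then \<one>\<^bsub>K\<^esub> else \<zero>\<^bsub>K\<^esub>"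
      \<comment> \<open>Both sides of the associative law become the triple sum of the indicator of
        abc = x.\<close>
      have "(f \<otimes>\<^bsub>A\<^esub> g \<otimes>\<^bsub>A\<^esub> h) x = lin (\<lambda>a. lin (\<lambda>b. lin (\<lambda>c. ?e (a \<otimes>\<^bsub>B\<^esub> b \<otimes>\<^bsub>B\<^esub> c)) h) g) f"
        using f g h x by (simp add: mult_coeff mult_closed) (subst lin_mult; auto)
      also have "\<dots> = lin (\<lambda>a. lin (\<lambda>b. lin (\<lambda>c. ?e (a \<otimes>\<^bsub>B\<^esub> (b \<otimes>\<^bsub>B\<^esub> c))) h) g) f"
        using f g h by (intro lin_cong) (auto simp: B.m_assoc)
      also have "\<dots> = lin (\<lambda>a. lin (\<lambda>y. ?e (a \<otimes>\<^bsub>B\<^esub> y)) (g \<otimes>\<^bsub>A\<^esub> h)) f"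
        using f g h by (intro lin_cong lin_mult[symmetric]) (auto simp: mult_closed)
      also have "\<dots> = (f \<otimes>\<^bsub>A\<^esub> (g \<otimes>\<^bsub>A\<^esub> h)) x"
        using f g h x by (simp add: mult_coeff mult_closed)
      finally show "(f \<otimes>\<^bsub>A\<^esub> g \<otimes>\<^bsub>A\<^esub> h) x = (f \<otimes>\<^bsub>A\<^esub> (g \<otimes>\<^bsub>A\<^esub> h)) x" .
    qed (use f g h mult_closed in auto)
    show "\<one>\<^bsub>A\<^esub> \<otimes>\<^bsub>A\<^esub> f = f"
      using f by (intro algebra_eqI) (auto simp: one_eq_single mult_closed mult_coeff lin_coeff_one_mult)
    show "f \<otimes>\<^bsub>A\<^esub> \<one>\<^bsub>A\<^esub> = f"
    proof (rule algebra_eqI)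
      fix x assume x: "x \<in> carrier B"
      have "(f \<otimes>\<^bsub>A\<^esub> \<one>\<^bsub>A\<^esub>) x = lin (\<lambda>a. if a = x then \<one>\<^bsub>K\<^esub> else \<zero>\<^bsub>K\<^esub>) f"
        using f x by (simp add: one_eq_single mult_coeff) (intro lin_cong; auto)
      then show "(f \<otimes>\<^bsub>A\<^esub> \<one>\<^bsub>A\<^esub>) x = f x" using f x by (simp add: lin_coeff)
    qed (use f in \<open>auto simp: one_eq_single mult_closed\<close>)
  qed (auto simp: mult_closed one_eq_single)
  fix f g h assume [simp]: "f \<in> carrier A" "g \<in> carrier A" "h \<in> carrier A"
  note [simp] = add_closed mult_closed
  show "(f \<oplus>\<^bsub>A\<^esub> g) \<otimes>\<^bsub>A\<^esub> h = f \<otimes>\<^bsub>A\<^esub> h \<oplus>\<^bsub>A\<^esub> g \<otimes>\<^bsub>A\<^esub> h"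
  proof (rule algebra_eqI)
    show "((f \<oplus>\<^bsub>A\<^esub> g) \<otimes>\<^bsub>A\<^esub> h) x = (f \<otimes>\<^bsub>A\<^esub> h \<oplus>\<^bsub>A\<^esub> g \<otimes>\<^bsub>A\<^esub> h) x" if "x \<in> carrier B" for x
      using that by (subst algebra_simps(3)) (simp add: mult_coeff lin_add)
  qed auto
  show "h \<otimes>\<^bsub>A\<^esub> (f \<oplus>\<^bsub>A\<^esub> g) = h \<otimes>\<^bsub>A\<^esub> f \<oplus>\<^bsub>A\<^esub> h \<otimes>\<^bsub>A\<^esub> g"
  proof (rule algebra_eqI)
    show "(h \<otimes>\<^bsub>A\<^esub> (f \<oplus>\<^bsub>A\<^esub> g)) x = (h \<otimes>\<^bsub>A\<^esub> f \<oplus>\<^bsub>A\<^esub> h \<otimes>\<^bsub>A\<^esub> g) x" if "x \<in> carrier B" for x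
      using that by (subst algebra_simps(3)) (simp add: mult_coeff lin_add lin_add_right)
  qed auto
qed

sublocale A: ring A by (rule ring_algebra)

text \<open>Multiples of the identity scale the coefficients from either side; in particular they
  are central.\<close>

lemma scalar_mult:
  assumes "c \<in> carrier K" "f \<in> carrier A"
  shows "(c \<odot>\<^bsub>A\<^esub> \<one>\<^bsub>A\<^esub>) \<otimes>\<^bsub>A\<^esub> f = c \<odot>\<^bsub>A\<^esub> f" and "f \<otimes>\<^bsub>A\<^esub> (c \<odot>\<^bsub>A\<^esub> \<one>\<^bsub>A\<^esub>) = c \<odot>\<^bsub>A\<^esub> f"
proof -
  note [simp] = assms smult_closed
  have c: "(c \<odot>\<^bsub>A\<^esub> f) x = c \<otimes>\<^bsub>K\<^esub> f x" if "x \<in> carrier B" for x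
    using that by (simp add: algebra_simps(4))
  show "(c \<odot>\<^bsub>A\<^esub> \<one>\<^bsub>A\<^esub>) \<otimes>\<^bsub>A\<^esub> f = c \<odot>\<^bsub>A\<^esub> f"
    by (rule algebra_eqI) (auto simp: c mult_coeff lin_smult one_eq_single lin_coeff_one_mult)
  show "f \<otimes>\<^bsub>A\<^esub> (c \<odot>\<^bsub>A\<^esub> \<one>\<^bsub>A\<^esub>) = c \<odot>\<^bsub>A\<^esub> f"
  proof (rule algebra_eqI)
    fix x assume x: "x \<in> carrier B"
    have "(f \<otimes>\<^bsub>A\<^esub> (c \<odot>\<^bsub>A\<^esub> \<one>\<^bsub>A\<^esub>)) x = lin (\<lambda>a. c \<otimes>\<^bsub>K\<^esub> (if a = x then \<one>\<^bsub>K\<^esub> else \<zero>\<^bsub>K\<^esub>)) f"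
      using x by (subst mult_coeff) (auto simp: lin_smult one_eq_single intro!: lin_cong)
    also have "\<dots> = (c \<odot>\<^bsub>A\<^esub> f) x" using x by (subst lin_smult_right) (auto simp: lin_coeff c)
    finally show "(f \<otimes>\<^bsub>A\<^esub> (c \<odot>\<^bsub>A\<^esub> \<one>\<^bsub>A\<^esub>)) x = (c \<odot>\<^bsub>A\<^esub> f) x" .
  qed auto
qed

lemma scalar_ring_hom: "(\<lambda>c. c \<odot>\<^bsub>A\<^esub> \<one>\<^bsub>A\<^esub>) \<in> ring_hom K A"
proof (rule ring_hom_memI)
  fix c d assume [simp]: "c \<in> carrier K" "d \<in> carrier K"
  show "(c \<otimes>\<^bsub>K\<^esub> d) \<odot>\<^bsub>A\<^esub> \<one>\<^bsub>A\<^esub> = (c \<odot>\<^bsub>A\<^esub> \<one>\<^bsub>A\<^esub>) \<otimes>\<^bsub>A\<^esub> (d \<odot>\<^bsub>A\<^esub> \<one>\<^bsub>A\<^esub>)"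
    by (subst scalar_mult(1)) (auto simp: smult_closed, auto simp: algebra_simps(4) K.m_assoc intro!: restrict_ext)
  show "(c \<oplus>\<^bsub>K\<^esub> d) \<odot>\<^bsub>A\<^esub> \<one>\<^bsub>A\<^esub> = (c \<odot>\<^bsub>A\<^esub> \<one>\<^bsub>A\<^esub>) \<oplus>\<^bsub>A\<^esub> (d \<odot>\<^bsub>A\<^esub> \<one>\<^bsub>A\<^esub>)"
    by (auto simp: algebra_simps(3,4) K.l_distr intro!: restrict_ext)
next
  show "\<one>\<^bsub>K\<^esub> \<odot>\<^bsub>A\<^esub> \<one>\<^bsub>A\<^esub> = \<one>\<^bsub>A\<^esub>"
    by (rule algebra_eqI) (auto simp: smult_closed, auto simp: algebra_simps(4) one_eq_single single_def)
qed (simp add: smult_closed)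

lemma lin_ring_hom:
  assumes u: "u \<in> carrier B \<rightarrow> carrier K" and one: "u \<one>\<^bsub>B\<^esub> = \<one>\<^bsub>K\<^esub>"
    and mult: "\<And>a b. \<lbrakk>a \<in> carrier B; b \<in> carrier B\<rbrakk> \<Longrightarrow> u (a \<otimes>\<^bsub>B\<^esub> b) = u a \<otimes>\<^bsub>K\<^esub> u b"
  shows "lin u \<in> ring_hom A K"
proof (rule ring_hom_memI)
  fix f g assume f: "f \<in> carrier A" and g: "g \<in> carrier A"
  have "lin u (f \<otimes>\<^bsub>A\<^esub> g) = lin (\<lambda>a. lin (\<lambda>b. u a \<otimes>\<^bsub>K\<^esub> u b) g) f"
    using f g u mult by (subst lin_mult) (auto intro!: lin_cong simp: Pi_def)
  also have "\<dots> = lin (\<lambda>a. lin u g \<otimes>\<^bsub>K\<^esub> u a) f"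
    using f g u by (intro lin_cong) (auto simp: lin_smult_right Pi_def K.m_comm)
  also have "\<dots> = lin u f \<otimes>\<^bsub>K\<^esub> lin u g"
    using f g u by (simp add: lin_smult_right K.m_comm)
  finally show "lin u (f \<otimes>\<^bsub>A\<^esub> g) = lin u f \<otimes>\<^bsub>K\<^esub> lin u g" .
qed (use u one in \<open>auto simp: lin_add one_eq_single\<close>)

lemma lin_scalar: "\<lbrakk>c \<in> carrier K; u \<in> carrier B \<rightarrow> carrier K\<rbrakk> \<Longrightarrow> lin u (c \<odot>\<^bsub>A\<^esub> \<one>\<^bsub>A\<^esub>) = c \<otimes>\<^bsub>K\<^esub> u \<one>\<^bsub>B\<^esub>"
  by (simp add: lin_smult one_eq_single)

text \<open>In the nested form of \<open>lin_mult\<close> each sum is linear in its function, so a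
  product rule on the monoid passes to the algebra.\<close>

lemma lin_leibniz:
  assumes u: "u \<in> carrier B \<rightarrow> carrier K" and v: "v \<in> carrier B \<rightarrow> carrier K"
    and d: "d \<in> carrier B \<rightarrow> carrier K"
    and mult: "\<And>a b. \<lbrakk>a \<in> carrier B; b \<in> carrier B\<rbrakk> \<Longrightarrow>
      d (a \<otimes>\<^bsub>B\<^esub> b) = v a \<otimes>\<^bsub>K\<^esub> d b \<oplus>\<^bsub>K\<^esub> d a \<otimes>\<^bsub>K\<^esub> u b"
    and f: "f \<in> carrier A" and g: "g \<in> carrier A"
  shows "lin d (f \<otimes>\<^bsub>A\<^esub> g) = lin v f \<otimes>\<^bsub>K\<^esub> lin d g \<oplus>\<^bsub>K\<^esub> lin d f \<otimes>\<^bsub>K\<^esub> lin u g"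
proof -
  have cl: "v b \<in> carrier K" "d b \<in> carrier K" "u b \<in> carrier K" if "b \<in> carrier B" for b
    using u v d that by auto
  have "lin d (f \<otimes>\<^bsub>A\<^esub> g) = lin (\<lambda>a. lin (\<lambda>b. v a \<otimes>\<^bsub>K\<^esub> d b \<oplus>\<^bsub>K\<^esub> d a \<otimes>\<^bsub>K\<^esub> u b) g) f"
    using f g d mult cl by (subst lin_mult) (auto intro!: lin_cong)
  also have "\<dots> = lin (\<lambda>a. lin d g \<otimes>\<^bsub>K\<^esub> v a \<oplus>\<^bsub>K\<^esub> lin u g \<otimes>\<^bsub>K\<^esub> d a) f"
    using f g d u v cl by (intro lin_cong) (auto simp: lin_add_right lin_smult_right K.m_comm)
  also have "\<dots> = lin v f \<otimes>\<^bsub>K\<^esub> lin d g \<oplus>\<^bsub>K\<^esub> lin d f \<otimes>\<^bsub>K\<^esub> lin u g"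
    using f g d u v cl by (subst lin_add_right) (auto simp: lin_smult_right K.m_comm)
  finally show ?thesis .
qed

lemma algebra_induct [consumes 1, case_names zero single add]:
  assumes f: "f \<in> carrier A" and zero: "P \<zero>\<^bsub>A\<^esub>"
    and single: "\<And>c b. \<lbrakk>c \<in> carrier K; b \<in> carrier B\<rbrakk> \<Longrightarrow> P (c \<odot>\<^bsub>A\<^esub> single b)"
    and add: "\<And>f g. \<lbrakk>f \<in> carrier A; g \<in> carrier A; P f; P g\<rbrakk> \<Longrightarrow> P (f \<oplus>\<^bsub>A\<^esub> g)"
  shows "P f"
proof -
  \<comment> \<open>\<open>f\<close> cut off to \<open>T\<close>, so that it is built up one monoid
    element at a time.\<close>
  define r where "r T = (\<lambda>x\<in>carrier B. if x \<in> T then f x else \<zero>\<^bsub>K\<^esub>)" for T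
  have r: "r T \<in> carrier A" for T using f by (auto simp: r_def algebra_simps)
  have "P (r T)" if "finite T" "T \<subseteq> carrier B" for T
    using that
  proof (induction T rule: finite_induct)
    case empty
    have "r {} = \<zero>\<^bsub>A\<^esub>" by (auto simp: r_def algebra_simps)
    then show ?case using zero by simp
  next
    case (insert b T)
    have "r (insert b T) = (f b \<odot>\<^bsub>A\<^esub> single b) \<oplus>\<^bsub>A\<^esub> r T"
      using insert f by (auto simp: r_def single_def algebra_simps(3,4) intro!: restrict_ext)
    then show ?case using insert f r by (auto intro!: add single smult_closed)
  qed
  then have "P (r (carrier B))" using finite_B by simp
  moreover have "r (carrier B) = f" using f by (intro algebra_eqI r) (auto simp: r_def)
  ultimately show ?thesis by simp
qed

lemma single_mult:
  assumes "a \<in> carrier B" "b \<in> carrier B"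
  shows "single a \<otimes>\<^bsub>A\<^esub> single b = single (a \<otimes>\<^bsub>B\<^esub> b)"
  using assms by (intro algebra_eqI) (auto simp: mult_closed mult_coeff, auto simp: single_def)

end

section \<open>Isomorphisms and simple modules\<close>

lemma modules_isomorphic_sym:
  assumes "left_module A M" and "modules_isomorphic A M N"
  shows "modules_isomorphic A N M"
proof -
  interpret M: left_module A M by fact
  obtain f where f: "f \<in> module_hom A M N" "bij_betw f (carrier M) (carrier N)"
    using assms(2) by (auto simp: modules_isomorphic_def)
  define g where "g = inv_into (carrier M) f"
  have g: "g y \<in> carrier M" "f (g y) = y" if "y \<in> carrier N" for y
    using that f(2) by (simp_all add: g_def bij_betw_def f_inv_into_f inv_into_into)
  have gf: "g (f x) = x" if "x \<in> carrier M" for x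
    using that f(2) by (simp add: g_def bij_betw_inv_into_left)
  have "g (y \<oplus>\<^bsub>N\<^esub> z) = g y \<oplus>\<^bsub>M\<^esub> g z" if "y \<in> carrier N" "z \<in> carrier N" for y z
    using that g gf[of "g y \<oplus>\<^bsub>M\<^esub> g z"] module_hom_add[OF f(1), of "g y" "g z"] by simp
  moreover have "g (a \<odot>\<^bsub>N\<^esub> y) = a \<odot>\<^bsub>M\<^esub> g y" if "a \<in> carrier A" "y \<in> carrier N" for a y
    using that g gf[of "a \<odot>\<^bsub>M\<^esub> g y"] module_hom_smult[OF f(1), of a "g y"] M.smult_closed by simp
  ultimately have "g \<in> module_hom A N M"
    using g(1) by (simp add: module_hom_def)
  moreover have "bij_betw g (carrier N) (carrier M)"
    unfolding g_def using f(2) by (rule bij_betw_inv_into)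
  ultimately show ?thesis by (auto simp: modules_isomorphic_def)
qed

lemma modules_isomorphic_trans:
  assumes "modules_isomorphic A L M" and "modules_isomorphic A M N"
  shows "modules_isomorphic A L N"
proof -
  obtain f g where "f \<in> module_hom A L M" "bij_betw f (carrier L) (carrier M)"
    "g \<in> module_hom A M N" "bij_betw g (carrier M) (carrier N)"
    using assms by (auto simp: modules_isomorphic_def)
  then have "g \<circ> f \<in> module_hom A L N" "bij_betw (g \<circ> f) (carrier L) (carrier N)"
    by (auto simp: module_hom_def Pi_def intro: bij_betw_trans)
  then show ?thesis by (auto simp: modules_isomorphic_def)
qed

lemma simple_class_cong:
  assumes "left_module A M" and "modules_isomorphic A M N"
  shows "simple_class A M = simple_class A N"
proof
  show "simple_class A M \<subseteq> simple_class A N"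
    using assms(2) by (auto simp: simple_class_def intro: modules_isomorphic_trans)
  show "simple_class A N \<subseteq> simple_class A M"
    using modules_isomorphic_sym[OF assms] by (auto simp: simple_class_def intro: modules_isomorphic_trans)
qed

context left_module
begin

lemma smult_minus_right:
  assumes "a \<in> carrier R" "x \<in> carrier M"
  shows "a \<odot>\<^bsub>M\<^esub> (\<ominus>\<^bsub>M\<^esub> x) = \<ominus>\<^bsub>M\<^esub> (a \<odot>\<^bsub>M\<^esub> x)"
proof -
  have "a \<odot>\<^bsub>M\<^esub> (\<ominus>\<^bsub>M\<^esub> x) \<oplus>\<^bsub>M\<^esub> a \<odot>\<^bsub>M\<^esub> x = \<zero>\<^bsub>M\<^esub>"
    using assms by (simp add: M.l_neg flip: smult_r_distr)
  then show ?thesis using assms by (simp add: M.minus_equality smult_closed)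
qed

lemma smult_minus_one: "x \<in> carrier M \<Longrightarrow> (\<ominus> \<one>) \<odot>\<^bsub>M\<^esub> x = \<ominus>\<^bsub>M\<^esub> x"
proof -
  assume x: "x \<in> carrier M"
  have "(\<ominus> \<one>) \<odot>\<^bsub>M\<^esub> x \<oplus>\<^bsub>M\<^esub> x = (\<ominus> \<one> \<oplus> \<one>) \<odot>\<^bsub>M\<^esub> x"
    using x by (subst smult_l_distr) (auto simp: smult_one)
  then show ?thesis using x by (simp add: R.l_neg M.minus_equality smult_closed)
qed

text \<open>Closure under negation comes from the action of -1.\<close>

lemma submoduleI:
  assumes "H \<subseteq> carrier M" "\<zero>\<^bsub>M\<^esub> \<in> H"
    and "\<And>x y. \<lbrakk>x \<in> H; y \<in> H\<rbrakk> \<Longrightarrow> x \<oplus>\<^bsub>M\<^esub> y \<in> H"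
    and smult: "\<And>a x. \<lbrakk>a \<in> carrier R; x \<in> H\<rbrakk> \<Longrightarrow> a \<odot>\<^bsub>M\<^esub> x \<in> H"
  shows "Module.submodule H R M"
proof (intro Module.submodule.intro subgroup.intro Module.submodule_axioms.intro)
  show "inv\<^bsub>add_monoid M\<^esub> x \<in> H" if "x \<in> H" for x
    using smult[of "\<ominus> \<one>" x] that assms(1) smult_minus_one[of x] by (auto simp: a_inv_def)
qed (use assms(1-3) smult in simp_all)

lemma submoduleD:
  assumes "Module.submodule H R M"
  shows "H \<subseteq> carrier M" "\<zero>\<^bsub>M\<^esub> \<in> H"
    "\<And>a x. \<lbrakk>a \<in> carrier R; x \<in> H\<rbrakk> \<Longrightarrow> a \<odot>\<^bsub>M\<^esub> x \<in> H"
proof -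
  have "subgroup H (add_monoid M)" using assms by (rule Module.submodule.axioms)
  then show "H \<subseteq> carrier M" "\<zero>\<^bsub>M\<^esub> \<in> H"
    using subgroup.subset subgroup.one_closed by fastforce+
qed (rule Module.submodule.smult_closed[OF assms])

end

section \<open>Connected components of order complexes\<close>

lemma Union_order_complex:
  assumes "\<And>x. x \<in> P \<Longrightarrow> ord x x"
  shows "\<Union>(order_complex ord P) = P"
proof
  show "\<Union>(order_complex ord P) \<subseteq> P" by (auto simp: order_complex_def)
  have "{x} \<in> order_complex ord P" if "x \<in> P" for x
    using that assms by (simp add: order_complex_def Complete_Partial_Order.chain_def)
  then show "P \<subseteq> \<Union>(order_complex ord P)" by blast
qed

lemma edge_order_complex:
  "(\<And>x. x \<in> P \<Longrightarrow> ord x x) \<Longrightarrow>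
    {x, y} \<in> order_complex ord P \<longleftrightarrow> x \<in> P \<and> y \<in> P \<and> (ord x y \<or> ord y x)"
  by (auto simp: order_complex_def Complete_Partial_Order.chain_def)

text \<open>Reflexivity makes singletons chains, so that the vertices of the complex are all of
  \<open>P\<close>.\<close>

locale order_complex_components =
  fixes ord :: "'p \<Rightarrow> 'p \<Rightarrow> bool" and P :: "'p set"
  assumes ord_refl: "x \<in> P \<Longrightarrow> ord x x"
begin

abbreviation "components \<equiv> complex_components (order_complex ord P)"

definition linked :: "('p \<times> 'p) set" where
  "linked = {(v, w) \<in> P \<times> P. (v, w) \<in> {(x, y). {x, y} \<in> order_complex ord P}\<^sup>*}"

lemma components_eq: "components = P // linked"
  by (simp add: complex_components_def linked_def Union_order_complex ord_refl)

lemma equiv_linked: "equiv P linked"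
proof (rule equivI)
  have "sym ({(x, y). {x, y} \<in> order_complex ord P}\<^sup>*)"
    by (rule sym_rtrancl) (auto simp: sym_def insert_commute)
  then show "sym linked" by (auto simp: linked_def sym_def)
qed (auto simp: linked_def refl_on_def trans_def)

lemma component_nonempty: "C \<in> components \<Longrightarrow> C \<noteq> {}"
  unfolding components_eq using equiv_linked by (metis in_quotient_imp_non_empty)

lemma component_subset: "C \<in> components \<Longrightarrow> C \<subseteq> P"
  unfolding components_eq using equiv_linked by (metis in_quotient_imp_subset)

lemma component_exists: "x \<in> P \<Longrightarrow> \<exists>C\<in>components. x \<in> C"
  using Union_quotient[OF equiv_linked] by (auto simp: components_eq)

lemma component_unique: "\<lbrakk>C \<in> components; D \<in> components; x \<in> C; x \<in> D\<rbrakk> \<Longrightarrow> C = D"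
  unfolding components_eq using quotient_disj[OF equiv_linked] by blast

text \<open>Makes indicator functions of components compatible with the order; they yield the
  derivations of \<open>band_derivation_component\<close>.\<close>

lemma component_closed:
  assumes "C \<in> components" "x \<in> P" "y \<in> P" "ord x y"
  shows "x \<in> C \<longleftrightarrow> y \<in> C"
proof -
  have "(x, y) \<in> linked"
    using assms by (auto simp: linked_def edge_order_complex ord_refl)
  then have "(x, y) \<in> linked" "(y, x) \<in> linked"
    using equiv_linked by (auto simp: equiv_def sym_def)
  then show ?thesis
    using in_quotient_imp_closed[OF equiv_linked, of C] assms(1) unfolding components_eq by blast
qed

text \<open>Induction along an edge path. Edges are unordered, so \<open>f\<close> is used for both
  directions of \<open>ord\<close>.\<close>

lemma component_constant:
  assumes "C \<in> components" "x \<in> C" "y \<in> C"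
    and f: "\<And>x y. \<lbrakk>x \<in> P; y \<in> P; ord x y\<rbrakk> \<Longrightarrow> f x = f y"
  shows "f x = f y"
proof -
  have "(x, y) \<in> linked"
    using quotient_eq_iff[OF equiv_linked, of C C x y] assms(1-3) by (simp add: components_eq)
  then have "(x, y) \<in> {(x, y). {x, y} \<in> order_complex ord P}\<^sup>*" by (simp add: linked_def)
  then show ?thesis
  proof (induction rule: rtrancl_induct)
    case (step y z)
    then have "f y = f z"
      using f[of y z] f[of z y] by (auto simp: edge_order_complex ord_refl)
    then show ?case using step by simp
  qed simp
qed

lemma finite_components: "finite P \<Longrightarrow> finite components"
  unfolding components_eq by (rule finite_quotient) (auto simp: linked_def)

end

section \<open>Left regular bands\<close>

context left_regular_band
begin

text \<open>If Ba lies in Bb then a = cb, and idempotence of b gives ab = a. This turns statements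
  about supports into equations.\<close>

lemma support_subset_iff:
  assumes "a \<in> carrier B" "b \<in> carrier B"
  shows "support B a \<subseteq> support B b \<longleftrightarrow> a \<otimes> b = a"
proof
  assume "support B a \<subseteq> support B b"
  moreover have "a \<in> support B a"
    using assms by (auto simp: support_def r_coset_def intro!: bexI[of _ "\<one>"])
  ultimately obtain c where c: "c \<in> carrier B" "a = c \<otimes> b"
    by (auto simp: support_def r_coset_def)
  then show "a \<otimes> b = a" using assms by (simp add: m_assoc idem)
next
  assume *: "a \<otimes> b = a"
  have "c \<otimes> a = (c \<otimes> a) \<otimes> b" if "c \<in> carrier B" for c
    using that assms by (simp add: m_assoc *)
  then show "support B a \<subseteq> support B b"
    using assms by (force simp: support_def r_coset_def)
qed

text \<open>The support map sends products to meets, which makes the functions \<open>chi X\<close>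
  multiplicative. Regularity handles the left factor: if c(ab) = c, then ca = c(aba) = c(ab) =
  c.\<close>

lemma support_mult_iff:
  assumes "X \<in> support_lattice B" "a \<in> carrier B" "b \<in> carrier B"
  shows "X \<subseteq> support B (a \<otimes> b) \<longleftrightarrow> X \<subseteq> support B a \<and> X \<subseteq> support B b"
proof -
  obtain c where c: "c \<in> carrier B" "X = support B c"
    using assms(1) by (auto simp: support_lattice_def)
  have "c \<otimes> (a \<otimes> b) = c \<longleftrightarrow> c \<otimes> a = c \<and> c \<otimes> b = c"
  proof
    assume *: "c \<otimes> (a \<otimes> b) = c"
    have "c \<otimes> a = c \<otimes> (a \<otimes> b \<otimes> a)"
      using c assms * m_assoc[of c "a \<otimes> b" a] by simp
    also have "\<dots> = c" using assms * by (simp add: regular)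
    finally have "c \<otimes> a = c" .
    moreover have "c \<otimes> b = c \<otimes> (a \<otimes> b) \<otimes> b" using * by simp
    moreover have "\<dots> = c \<otimes> (a \<otimes> (b \<otimes> b))" using assms c by (simp add: m_assoc)
    ultimately show "c \<otimes> a = c \<and> c \<otimes> b = c" using assms * by (simp add: idem)
  qed (use c assms in \<open>simp flip: m_assoc\<close>)
  then show ?thesis using c assms by (simp add: support_subset_iff)
qed

lemma support_one: "X \<in> support_lattice B \<Longrightarrow> X \<subseteq> support B \<one>"
  using support_subset_iff[of _ \<one>] by (auto simp: support_lattice_def)

end

locale lrb_algebra = K: field K + B: left_regular_band B
  for K :: "('k, 'c) ring_scheme" and B :: "('b, 'd) monoid_scheme" +
  assumes finite_band: "finite (carrier B)"
begin

sublocale finite_monoid_algebra K B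
  by unfold_locales (rule finite_band)

definition chi :: "'b set \<Rightarrow> 'b \<Rightarrow> 'k" where
  "chi X b = (if X \<subseteq> support B b then \<one>\<^bsub>K\<^esub> else \<zero>\<^bsub>K\<^esub>)"

lemma chi_closed [simp]: "chi X b \<in> carrier K" and chi_funcset [simp]: "chi X \<in> carrier B \<rightarrow> carrier K"
  by (auto simp: chi_def)

lemma chi_one: "X \<in> support_lattice B \<Longrightarrow> chi X \<one>\<^bsub>B\<^esub> = \<one>\<^bsub>K\<^esub>"
  by (simp add: chi_def B.support_one)

lemma chi_mult:
  "\<lbrakk>X \<in> support_lattice B; a \<in> carrier B; b \<in> carrier B\<rbrakk> \<Longrightarrow>
    chi X (a \<otimes>\<^bsub>B\<^esub> b) = chi X a \<otimes>\<^bsub>K\<^esub> chi X b"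
  by (simp add: chi_def B.support_mult_iff)

lemma lin_chi_hom: "X \<in> support_lattice B \<Longrightarrow> lin (chi X) \<in> ring_hom A K"
  by (rule lin_ring_hom) (auto simp: chi_one chi_mult)

lemma lin_chi_scalar:
  "\<lbrakk>X \<in> support_lattice B; c \<in> carrier K\<rbrakk> \<Longrightarrow> lin (chi X) (c \<odot>\<^bsub>A\<^esub> \<one>\<^bsub>A\<^esub>) = c"
  by (simp add: lin_scalar chi_one)

section \<open>Classification of the simple modules\<close>

lemma support_module_simps:
  "carrier (support_module K B X) = carrier K"
  "\<zero>\<^bsub>support_module K B X\<^esub> = \<zero>\<^bsub>K\<^esub>"
  "\<alpha> \<oplus>\<^bsub>support_module K B X\<^esub> \<beta> = \<alpha> \<oplus>\<^bsub>K\<^esub> \<beta>"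
  by (simp_all add: support_module_def)

lemma support_module_smult:
  assumes "f \<in> carrier A" "\<alpha> \<in> carrier K"
  shows "f \<odot>\<^bsub>support_module K B X\<^esub> \<alpha> = lin (chi X) f \<otimes>\<^bsub>K\<^esub> \<alpha>"
proof -
  have "f \<odot>\<^bsub>support_module K B X\<^esub> \<alpha> = lin (\<lambda>b. \<alpha> \<otimes>\<^bsub>K\<^esub> chi X b) f"
    unfolding lin_def support_module_def using assms
    by (auto simp: chi_def intro!: K.finsum_cong')
  then show ?thesis using assms by (simp add: lin_smult_right K.m_comm)
qed

lemma left_module_support_module:
  assumes X: "X \<in> support_lattice B"
  shows "left_module A (support_module K B X)"
proof -
  interpret chi: ring_hom_ring A K "lin (chi X)"
    using lin_chi_hom[OF X] by (intro ring_hom_ringI2 A.ring_axioms K.ring_axioms)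
  have "abelian_group (support_module K B X)"
    by (rule abelian_groupI)
      (auto simp: support_module_simps K.a_ac intro!: bexI[of _ "\<ominus>\<^bsub>K\<^esub> _"] K.l_neg)
  then show ?thesis
    by (intro left_module.intro left_module_axioms.intro A.ring_axioms)
      (auto simp: support_module_simps support_module_smult K.l_distr K.r_distr K.m_assoc)
qed

lemma simple_support_module:
  assumes X: "X \<in> support_lattice B"
  shows "simple_module A (support_module K B X)"
proof -
  interpret M: left_module A "support_module K B X" using X by (rule left_module_support_module)
  have "H = {\<zero>\<^bsub>K\<^esub>} \<or> H = carrier K" if sub: "Module.submodule H A (support_module K B X)" for H
  proof (cases "H \<subseteq> {\<zero>\<^bsub>K\<^esub>}")
    case True
    then show ?thesis using M.submoduleD(2)[OF sub] by (auto simp: support_module_simps)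
  next
    case False
    then obtain x where x: "x \<in> H" "x \<noteq> \<zero>\<^bsub>K\<^esub>" by auto
    have H: "H \<subseteq> carrier K" using M.submoduleD(1)[OF sub] by (simp add: support_module_simps)
    have "y \<in> H" if y: "y \<in> carrier K" for y
    proof -
      let ?c = "y \<otimes>\<^bsub>K\<^esub> inv\<^bsub>K\<^esub> x"
      have xK: "x \<in> carrier K" "inv\<^bsub>K\<^esub> x \<in> carrier K" "inv\<^bsub>K\<^esub> x \<otimes>\<^bsub>K\<^esub> x = \<one>\<^bsub>K\<^esub>"
        using x H K.field_Units by auto
      then have "(?c \<odot>\<^bsub>A\<^esub> \<one>\<^bsub>A\<^esub>) \<odot>\<^bsub>support_module K B X\<^esub> x \<in> H"
        using y xK by (intro M.submoduleD(3)[OF sub] x smult_closed) (auto simp: one_eq_single)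
      then show ?thesis
        using xK y X by (simp add: support_module_smult smult_closed lin_chi_scalar K.m_assoc)
    qed
    then show ?thesis using H by auto
  qed
  then show ?thesis
    using M.left_module_axioms K.carrier_one_not_zero
    by (auto simp: simple_module_def support_module_simps)
qed

text \<open>An element with support \<open>X\<close> acts as the identity on the module of
  \<open>X\<close>, hence on everything isomorphic to it; on the module of \<open>Y\<close> it does
  so only if \<open>Y\<close> is contained in \<open>X\<close>.\<close>

lemma support_module_isomorphic_imp_subset:
  fixes S :: "('b \<Rightarrow> 'k, 's) module"
  assumes X: "X \<in> support_lattice B" and Y: "Y \<in> support_lattice B" and S: "left_module A S"
    and iX: "modules_isomorphic A S (support_module K B X)"
    and iY: "modules_isomorphic A S (support_module K B Y)"
  shows "Y \<subseteq> X"
proof -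
  obtain f where f: "f \<in> module_hom A S (support_module K B X)" "bij_betw f (carrier S) (carrier K)"
    using iX by (auto simp: modules_isomorphic_def support_module_simps)
  obtain g where g: "g \<in> module_hom A S (support_module K B Y)" "bij_betw g (carrier S) (carrier K)"
    using iY by (auto simp: modules_isomorphic_def support_module_simps)
  interpret S: left_module A S by fact
  obtain b where b: "b \<in> carrier B" "support B b = X" using X by (auto simp: support_lattice_def)
  obtain s where s: "s \<in> carrier S" "g s = \<one>\<^bsub>K\<^esub>"
    using g(2) by (metis K.one_closed bij_betw_imp_surj_on imageE)
  have fs: "f s \<in> carrier K" using f(2) s(1) by (auto simp: bij_betw_def)
  have "f (single b \<odot>\<^bsub>S\<^esub> s) = f s"
    using module_hom_smult[OF f(1), of "single b" s] s(1) fs b by (simp add: support_module_smult chi_def)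
  then have "single b \<odot>\<^bsub>S\<^esub> s = s"
    using f(2) s(1) S.smult_closed by (auto simp: bij_betw_def inj_on_def)
  then have "chi Y b = \<one>\<^bsub>K\<^esub>"
    using module_hom_smult[OF g(1), of "single b" s] s b by (simp add: support_module_smult)
  then show ?thesis using b by (auto simp: chi_def split: if_splits)
qed

text \<open>Let b act nontrivially with least support \<open>X\<close>. Then ba = b if the support
  of a contains \<open>X\<close>, and ba acts as zero otherwise. This makes the band act through
  \<open>chi X\<close> on a vector bm, whose multiples exhaust the simple module.\<close>

lemma simple_module_isomorphic_support_module:
  fixes S :: "('b \<Rightarrow> 'k, 's) module"
  assumes "simple_module A S"
  obtains X where "X \<in> support_lattice B" "modules_isomorphic A (support_module K B X) S"
proof -
  interpret S: left_module A S using assms by (simp add: simple_module_def)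
  have simple: "H = {\<zero>\<^bsub>S\<^esub>} \<or> H = carrier S" if "Module.submodule H A S" for H
    using assms that by (simp add: simple_module_def)
  define act where "act b v = single b \<odot>\<^bsub>S\<^esub> v" for b v
  have act_closed [simp]: "act b v \<in> carrier S" if "v \<in> carrier S" for b v
    using that by (simp add: act_def S.smult_closed)
  have act_add: "act b (v \<oplus>\<^bsub>S\<^esub> w) = act b v \<oplus>\<^bsub>S\<^esub> act b w" if "v \<in> carrier S" "w \<in> carrier S" for b v w
    using that by (simp add: act_def S.smult_r_distr)
  have act_act: "act a (act b v) = act (a \<otimes>\<^bsub>B\<^esub> b) v"
    if "a \<in> carrier B" "b \<in> carrier B" "v \<in> carrier S" for a b v
    using that by (simp add: act_def flip: S.smult_assoc single_mult)
  have act_one: "act \<one>\<^bsub>B\<^esub> v = v" if "v \<in> carrier S" for v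
    using that by (simp add: act_def S.smult_one flip: one_eq_single)
  define scal where "scal c v = (c \<odot>\<^bsub>A\<^esub> \<one>\<^bsub>A\<^esub>) \<odot>\<^bsub>S\<^esub> v" for c v
  have one_A [simp]: "\<one>\<^bsub>A\<^esub> \<in> carrier A" by (rule A.one_closed)
  have scal_closed [simp]: "scal c v \<in> carrier S" if "c \<in> carrier K" "v \<in> carrier S" for c v
    using that by (simp add: scal_def S.smult_closed smult_closed)
  have single_scal: "(c \<odot>\<^bsub>A\<^esub> f) \<odot>\<^bsub>S\<^esub> v = scal c (f \<odot>\<^bsub>S\<^esub> v)" "f \<odot>\<^bsub>S\<^esub> scal c v = scal c (f \<odot>\<^bsub>S\<^esub> v)"
    if "c \<in> carrier K" "f \<in> carrier A" "v \<in> carrier S" for c f v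
    using that by (simp_all add: scal_def scalar_mult smult_closed flip: S.smult_assoc)
  define nontrivial where "nontrivial b \<longleftrightarrow> (\<exists>v\<in>carrier S. act b v \<noteq> \<zero>\<^bsub>S\<^esub>)" for b
  have "nontrivial \<one>\<^bsub>B\<^esub>"
    using assms act_one S.M.zero_closed by (auto simp: nontrivial_def simple_module_def)
  then have "\<one>\<^bsub>B\<^esub> \<in> carrier B \<and> nontrivial \<one>\<^bsub>B\<^esub>" by simp
  \<comment> \<open>Least cardinality suffices, since \<open>vanish\<close> compares nested finite
    supports.\<close>
  then obtain b where b: "b \<in> carrier B" "nontrivial b"
    and b_min: "\<And>c. \<lbrakk>c \<in> carrier B; nontrivial c\<rbrakk> \<Longrightarrow> card (support B b) \<le> card (support B c)"
    using ex_has_least_nat[of "\<lambda>b. b \<in> carrier B \<and> nontrivial b" _ "\<lambda>b. card (support B b)"] by blast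
  define X where "X = support B b"
  have X: "X \<in> support_lattice B" using b by (simp add: X_def support_lattice_def)
  have fix_b: "b \<otimes>\<^bsub>B\<^esub> a = b" if "a \<in> carrier B" "X \<subseteq> support B a" for a
    using that b by (simp add: X_def B.support_subset_iff)
  have vanish: "act (b \<otimes>\<^bsub>B\<^esub> a) v = \<zero>\<^bsub>S\<^esub>"
    if a: "a \<in> carrier B" "\<not> X \<subseteq> support B a" and v: "v \<in> carrier S" for a v
  proof (rule ccontr)
    assume "act (b \<otimes>\<^bsub>B\<^esub> a) v \<noteq> \<zero>\<^bsub>S\<^esub>"
    then have "card X \<le> card (support B (b \<otimes>\<^bsub>B\<^esub> a))"
      unfolding X_def using a b v by (intro b_min) (auto simp: nontrivial_def)
    moreover have "support B (b \<otimes>\<^bsub>B\<^esub> a) \<subseteq> X"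
      unfolding X_def using a b by (simp add: B.support_subset_iff B.regular)
    moreover have "finite X"
      unfolding X_def support_def r_coset_def using finite_band by simp
    ultimately have "support B (b \<otimes>\<^bsub>B\<^esub> a) = X" by (metis card_seteq)
    then show False using B.support_mult_iff[OF X b(1) a(1)] a(2) by simp
  qed
  \<comment> \<open>What is killed by all bc is a proper submodule, hence zero. So vectors may be
    compared after acting with the elements bc, which is \<open>eqI\<close>.\<close>
  define W where "W = {v \<in> carrier S. \<forall>c\<in>carrier B. act (b \<otimes>\<^bsub>B\<^esub> c) v = \<zero>\<^bsub>S\<^esub>}"
  have "Module.submodule W A S"
  proof (rule S.submoduleI)
    show "\<zero>\<^bsub>S\<^esub> \<in> W" by (simp add: W_def act_def)
    show add: "v \<oplus>\<^bsub>S\<^esub> w \<in> W" if "v \<in> W" "w \<in> W" for v w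
      using that by (simp add: W_def act_add)
    show "f \<odot>\<^bsub>S\<^esub> v \<in> W" if "f \<in> carrier A" and v: "v \<in> W" for f v
      using that(1)
    proof (induction f rule: algebra_induct)
      case zero
      show ?case using v by (simp add: W_def act_def)
    next
      case (single k c)
      have "act (b \<otimes>\<^bsub>B\<^esub> d) ((k \<odot>\<^bsub>A\<^esub> single c) \<odot>\<^bsub>S\<^esub> v) = \<zero>\<^bsub>S\<^esub>" if d: "d \<in> carrier B" for d
      proof -
        have "act (b \<otimes>\<^bsub>B\<^esub> d) ((k \<odot>\<^bsub>A\<^esub> single c) \<odot>\<^bsub>S\<^esub> v) = scal k (act (b \<otimes>\<^bsub>B\<^esub> d) (act c v))"
          using single v d by (simp add: W_def act_def single_scal S.smult_closed)
        also have "act (b \<otimes>\<^bsub>B\<^esub> d) (act c v) = act (b \<otimes>\<^bsub>B\<^esub> (d \<otimes>\<^bsub>B\<^esub> c)) v"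
          using single v d b by (simp add: W_def act_act B.m_assoc)
        also have "\<dots> = \<zero>\<^bsub>S\<^esub>" using single v d by (simp add: W_def)
        finally show ?thesis using single by (simp add: scal_def smult_closed)
      qed
      then show ?case using single v by (simp add: W_def S.smult_closed smult_closed)
    next
      case (add f g)
      then show ?case using v \<open>\<And>w v. \<lbrakk>v \<in> W; w \<in> W\<rbrakk> \<Longrightarrow> v \<oplus>\<^bsub>S\<^esub> w \<in> W\<close>
        by (simp add: W_def S.smult_l_distr)
    qed
  qed (auto simp: W_def)
  moreover obtain m where m: "m \<in> carrier S" "act b m \<noteq> \<zero>\<^bsub>S\<^esub>"
    using b by (auto simp: nontrivial_def)
  then have "m \<notin> W" using b by (auto simp: W_def intro!: bexI[of _ "\<one>\<^bsub>B\<^esub>"])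
  ultimately have W: "W = {\<zero>\<^bsub>S\<^esub>}" using simple m by blast
  have eqI: "v = w" if v: "v \<in> carrier S" and w: "w \<in> carrier S"
    and vw: "\<And>c. c \<in> carrier B \<Longrightarrow> act (b \<otimes>\<^bsub>B\<^esub> c) v = act (b \<otimes>\<^bsub>B\<^esub> c) w" for v w
  proof -
    have "act (b \<otimes>\<^bsub>B\<^esub> c) (v \<oplus>\<^bsub>S\<^esub> (\<ominus>\<^bsub>S\<^esub> w)) = \<zero>\<^bsub>S\<^esub>" if "c \<in> carrier B" for c
      using v w vw[OF that] S.smult_minus_right[of "single (b \<otimes>\<^bsub>B\<^esub> c)" w]
      by (simp add: act_add S.M.r_neg) (simp add: act_def S.smult_closed S.M.r_neg)
    then have "v \<oplus>\<^bsub>S\<^esub> (\<ominus>\<^bsub>S\<^esub> w) \<in> W" using v w by (simp add: W_def)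
    then have "v \<oplus>\<^bsub>S\<^esub> (\<ominus>\<^bsub>S\<^esub> w) = \<zero>\<^bsub>S\<^esub>" using W by simp
    then show ?thesis using v w S.M.minus_equality by fastforce
  qed
  define v where "v = act b m"
  have v: "v \<in> carrier S" "v \<noteq> \<zero>\<^bsub>S\<^esub>" using m by (simp_all add: v_def)
  \<comment> \<open>Tested against bc: applying a and then bc to v = bm gives b(cab)m, which is bm
    if the supports of a and c both contain \<open>X\<close>, and zero otherwise. Without a, the
    same computation evaluates bc at v.\<close>
  have act_v: "act a v = (if X \<subseteq> support B a then v else \<zero>\<^bsub>S\<^esub>)" if a: "a \<in> carrier B" for a
  proof (rule eqI)
    fix c assume c: "c \<in> carrier B"
    have 1: "act (b \<otimes>\<^bsub>B\<^esub> c) (act a v) = act (b \<otimes>\<^bsub>B\<^esub> (c \<otimes>\<^bsub>B\<^esub> a \<otimes>\<^bsub>B\<^esub> b)) m"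
      using a b c m by (simp add: v_def act_act B.m_assoc)
    have 2: "act (b \<otimes>\<^bsub>B\<^esub> c) v = act (b \<otimes>\<^bsub>B\<^esub> (c \<otimes>\<^bsub>B\<^esub> b)) m"
      using b c m by (simp add: v_def act_act B.m_assoc)
    have sub: "X \<subseteq> support B (c \<otimes>\<^bsub>B\<^esub> a \<otimes>\<^bsub>B\<^esub> b) \<longleftrightarrow> X \<subseteq> support B c \<and> X \<subseteq> support B a"
      "X \<subseteq> support B (c \<otimes>\<^bsub>B\<^esub> b) \<longleftrightarrow> X \<subseteq> support B c"
      using a b c by (simp_all add: B.support_mult_iff[OF X]) (simp_all add: X_def)
    show "act (b \<otimes>\<^bsub>B\<^esub> c) (act a v) = act (b \<otimes>\<^bsub>B\<^esub> c) (if X \<subseteq> support B a then v else \<zero>\<^bsub>S\<^esub>)"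
    proof (cases "X \<subseteq> support B c \<and> X \<subseteq> support B a")
      case True
      then show ?thesis
        using 1 2 sub fix_b[of "c \<otimes>\<^bsub>B\<^esub> a \<otimes>\<^bsub>B\<^esub> b"] fix_b[of "c \<otimes>\<^bsub>B\<^esub> b"] a b c by simp
    next
      case False
      then have "act (b \<otimes>\<^bsub>B\<^esub> c) (act a v) = \<zero>\<^bsub>S\<^esub>"
        using 1 sub vanish a b c m by simp
      moreover have "act (b \<otimes>\<^bsub>B\<^esub> c) v = \<zero>\<^bsub>S\<^esub>" if "X \<subseteq> support B a"
        using 2 sub vanish b c m False that by simp
      ultimately show ?thesis by (simp add: act_def)
    qed
  qed (use v in auto)
  have smult_v: "f \<odot>\<^bsub>S\<^esub> v = scal (lin (chi X) f) v" if "f \<in> carrier A" for f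
    using that
  proof (induction f rule: algebra_induct)
    case zero
    have "scal \<zero>\<^bsub>K\<^esub> v = \<zero>\<^bsub>A\<^esub> \<odot>\<^bsub>S\<^esub> v"
      by (simp add: scal_def ring_hom_zero[OF scalar_ring_hom K.ring_axioms A.ring_axioms])
    then show ?case by (simp add: lin_zero)
  next
    case (single k c)
    have "scal k (scal (chi X c) v) = scal (k \<otimes>\<^bsub>K\<^esub> chi X c) v"
      using single v by (simp add: scal_def smult_closed S.smult_assoc ring_hom_mult[OF scalar_ring_hom])
    moreover have "act c v = scal (chi X c) v"
      using act_v[OF single(2)] v
      by (simp add: scal_def chi_def ring_hom_one[OF scalar_ring_hom] S.smult_one
        ring_hom_zero[OF scalar_ring_hom K.ring_axioms A.ring_axioms])
    ultimately show ?case
      using single v by (simp add: single_scal lin_smult) (simp add: act_def)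
  next
    case (add f g)
    then show ?case
      using v by (simp add: lin_add S.smult_l_distr smult_closed ring_hom_add[OF scalar_ring_hom] scal_def)
  qed
  \<comment> \<open>Parametrizes the line through \<open>v\<close>, a nonzero submodule and hence
    everything.\<close>
  define g where "g \<alpha> = scal \<alpha> v" for \<alpha>
  have g_closed: "g \<alpha> \<in> carrier S" if "\<alpha> \<in> carrier K" for \<alpha> using that v by (simp add: g_def)
  have g_add: "g (\<alpha> \<oplus>\<^bsub>K\<^esub> \<beta>) = g \<alpha> \<oplus>\<^bsub>S\<^esub> g \<beta>" if "\<alpha> \<in> carrier K" "\<beta> \<in> carrier K" for \<alpha> \<beta>
    using that v by (simp add: g_def scal_def smult_closed S.smult_l_distr ring_hom_add[OF scalar_ring_hom])
  have g_mult: "g (\<alpha> \<otimes>\<^bsub>K\<^esub> \<beta>) = scal \<alpha> (g \<beta>)" if "\<alpha> \<in> carrier K" "\<beta> \<in> carrier K" for \<alpha> \<beta>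
    using that v by (simp add: g_def scal_def smult_closed S.smult_assoc ring_hom_mult[OF scalar_ring_hom])
  have g_smult: "g (lin (chi X) f \<otimes>\<^bsub>K\<^esub> \<alpha>) = f \<odot>\<^bsub>S\<^esub> g \<alpha>" if "f \<in> carrier A" "\<alpha> \<in> carrier K" for f \<alpha>
    using that v g_mult[of \<alpha> "lin (chi X) f"]
    by (simp add: K.m_comm) (simp add: g_def single_scal smult_v)
  have g_one: "g \<one>\<^bsub>K\<^esub> = v"
    using v by (simp add: g_def scal_def ring_hom_one[OF scalar_ring_hom] S.smult_one)
  have hom: "g \<in> module_hom A (support_module K B X) S"
    by (auto simp: module_hom_def support_module_simps support_module_smult g_closed g_add g_smult)
  have g_zero: "g \<zero>\<^bsub>K\<^esub> = \<zero>\<^bsub>S\<^esub>"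
    using module_hom_zero[OF left_module_support_module[OF X] S.left_module_axioms hom]
    by (simp add: support_module_simps)
  have nonzero: "g \<alpha> \<noteq> \<zero>\<^bsub>S\<^esub>" if \<alpha>: "\<alpha> \<in> carrier K" "\<alpha> \<noteq> \<zero>\<^bsub>K\<^esub>" for \<alpha>
  proof
    assume "g \<alpha> = \<zero>\<^bsub>S\<^esub>"
    moreover have "inv\<^bsub>K\<^esub> \<alpha> \<in> carrier K" "inv\<^bsub>K\<^esub> \<alpha> \<otimes>\<^bsub>K\<^esub> \<alpha> = \<one>\<^bsub>K\<^esub>"
      using \<alpha> K.field_Units by auto
    ultimately show False
      using g_mult[of "inv\<^bsub>K\<^esub> \<alpha>" \<alpha>] g_one v \<alpha> by (simp add: scal_def smult_closed)
  qed
  have inj: "inj_on g (carrier K)"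
  proof (rule inj_onI)
    fix \<alpha> \<beta> assume \<alpha>: "\<alpha> \<in> carrier K" and \<beta>: "\<beta> \<in> carrier K" and eq: "g \<alpha> = g \<beta>"
    have "g (\<alpha> \<ominus>\<^bsub>K\<^esub> \<beta>) = g \<beta> \<oplus>\<^bsub>S\<^esub> g (\<ominus>\<^bsub>K\<^esub> \<beta>)"
      using \<alpha> \<beta> eq by (simp add: K.minus_eq g_add)
    also have "\<dots> = \<zero>\<^bsub>S\<^esub>" using \<beta> g_zero by (simp add: K.r_neg flip: g_add)
    finally have "\<alpha> \<ominus>\<^bsub>K\<^esub> \<beta> = \<zero>\<^bsub>K\<^esub>" using nonzero \<alpha> \<beta> by blast
    then show "\<alpha> = \<beta>" using \<alpha> \<beta> by simp
  qed
  have "Module.submodule (g ` carrier K) A S"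
  proof (rule S.submoduleI)
    show "\<zero>\<^bsub>S\<^esub> \<in> g ` carrier K" using g_zero by (auto intro!: image_eqI[of _ g "\<zero>\<^bsub>K\<^esub>"])
  qed (auto simp: g_closed simp flip: g_add g_smult)
  moreover have "v \<in> g ` carrier K" using g_one by (auto intro!: image_eqI[of _ g "\<one>\<^bsub>K\<^esub>"])
  ultimately have "g ` carrier K = carrier S" using simple v by blast
  then have "modules_isomorphic A (support_module K B X) S"
    using inj hom by (auto simp: modules_isomorphic_def bij_betw_def support_module_simps)
  with X show ?thesis by (rule that)
qed

text \<open>The module of \<open>X\<close> lives on the scalars, whereas vertices are classes of
  modules on the type of the algebra. \<open>simple_module_realization\<close> supplies a member of
  that type, through which the modules of two equal classes are compared.\<close>

lemma vertex_bij_betw: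
  "bij_betw (\<lambda>X. simple_class A (support_module K B X)) (support_lattice B)
    {simple_class A S | S. simple_module A (S :: ('b \<Rightarrow> 'k, 'b \<Rightarrow> 'k) module)}"
proof (rule bij_betw_imageI)
  let ?v = "\<lambda>X. simple_class A (support_module K B X)"
  have member: "\<exists>S. S \<in> ?v X" if "X \<in> support_lattice B" for X
    using simple_module_realization[OF simple_support_module[OF that]] by (auto simp: simple_class_def)
  have "X \<subseteq> Y" if X: "X \<in> support_lattice B" and Y: "Y \<in> support_lattice B" and "?v X = ?v Y" for X Y
  proof -
    obtain S where "S \<in> ?v X" "S \<in> ?v Y" using member[OF X] \<open>?v X = ?v Y\<close> by auto
    then show ?thesis
      by (intro support_module_isomorphic_imp_subset[OF Y X]) (auto simp: simple_class_def simple_module_def)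
  qed
  then show "inj_on ?v (support_lattice B)" by (auto intro!: inj_onI)
  show "?v ` support_lattice B =
    {simple_class A S | S. simple_module A (S :: ('b \<Rightarrow> 'k, 'b \<Rightarrow> 'k) module)}"
  proof (intro equalityI subsetI)
    fix C assume "C \<in> ?v ` support_lattice B"
    then obtain X where X: "X \<in> support_lattice B" "C = ?v X" by auto
    then obtain S where S: "S \<in> ?v X" using member by auto
    then have "simple_class A S = ?v X"
      by (intro simple_class_cong) (auto simp: simple_class_def simple_module_def)
    then show "C \<in> {simple_class A S | S. simple_module A (S :: ('b \<Rightarrow> 'k, 'b \<Rightarrow> 'k) module)}"
      using S X by (auto simp: simple_class_def)
  next
    fix C assume "C \<in> {simple_class A S | S. simple_module A (S :: ('b \<Rightarrow> 'k, 'b \<Rightarrow> 'k) module)}"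
    then obtain S :: "('b \<Rightarrow> 'k, 'b \<Rightarrow> 'k) module" where S: "simple_module A S" "C = simple_class A S"
      by auto
    then obtain X where X: "X \<in> support_lattice B" "modules_isomorphic A (support_module K B X) S"
      using simple_module_isomorphic_support_module by blast
    then have "?v X = C"
      using S by (simp add: simple_class_cong left_module_support_module)
    then show "C \<in> ?v ` support_lattice B" using X by auto
  qed
qed

end

section \<open>Derivations of a left regular band\<close>

locale lrb_algebra_pair = lrb_algebra K B
  for K :: "('k, 'c) ring_scheme" and B :: "('b, 'd) monoid_scheme" +
  fixes X Y :: "'b set"
  assumes X: "X \<in> support_lattice B" and Y: "Y \<in> support_lattice B"
begin

sublocale algebra_characters K A "lin (chi X)" "lin (chi Y)"
  by (intro algebra_characters.intro algebra_characters_axioms.intro K.field_axioms A.ring_axioms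
      scalar_ring_hom lin_chi_hom X Y)
    (simp_all add: scalar_mult lin_chi_scalar X Y)

section \<open>Derivations of the band and of its algebra\<close>

definition band_derivation :: "('b \<Rightarrow> 'k) \<Rightarrow> bool" where
  "band_derivation d \<longleftrightarrow> d \<in> carrier B \<rightarrow> carrier K \<and>
     (\<forall>a\<in>carrier B. \<forall>b\<in>carrier B.
       d (a \<otimes>\<^bsub>B\<^esub> b) = chi Y a \<otimes>\<^bsub>K\<^esub> d b \<oplus>\<^bsub>K\<^esub> d a \<otimes>\<^bsub>K\<^esub> chi X b)"

lemma band_derivation_closed: "\<lbrakk>band_derivation d; b \<in> carrier B\<rbrakk> \<Longrightarrow> d b \<in> carrier K"
  by (auto simp: band_derivation_def)

lemma band_derivation_mult:
  "\<lbrakk>band_derivation d; a \<in> carrier B; b \<in> carrier B\<rbrakk> \<Longrightarrow>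
    d (a \<otimes>\<^bsub>B\<^esub> b) = chi Y a \<otimes>\<^bsub>K\<^esub> d b \<oplus>\<^bsub>K\<^esub> d a \<otimes>\<^bsub>K\<^esub> chi X b"
  by (auto simp: band_derivation_def)

text \<open>The product rule at bb = b reads d(b) = d(b) + d(b) if both characters are 1 at b, and
  d(b) = 0 if both are 0; the characteristic does not matter.\<close>

lemma band_derivation_vanishes:
  assumes d: "band_derivation d" and b: "b \<in> carrier B" and "X \<subseteq> support B b \<longleftrightarrow> Y \<subseteq> support B b"
  shows "d b = \<zero>\<^bsub>K\<^esub>"
proof (cases "X \<subseteq> support B b")
  case True
  then have "d b = d b \<oplus>\<^bsub>K\<^esub> d b"
    using band_derivation_mult[OF d b b] band_derivation_closed[OF d b] assms(3) b
    by (simp add: B.idem chi_def)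
  then show ?thesis using band_derivation_closed[OF d b] by simp
next
  case False
  then show ?thesis
    using band_derivation_mult[OF d b b] band_derivation_closed[OF d b] assms(3) b
    by (simp add: B.idem chi_def)
qed

lemma derivation_lin:
  assumes d: "band_derivation d"
  shows "derivation (lin d)"
proof -
  have dK: "d \<in> carrier B \<rightarrow> carrier K" using d by (simp add: band_derivation_def)
  have "d \<one>\<^bsub>B\<^esub> = \<zero>\<^bsub>K\<^esub>"
    using d by (rule band_derivation_vanishes) (simp_all add: B.support_one X Y)
  then have "lin d (scalar c) = \<zero>\<^bsub>K\<^esub>" if "c \<in> carrier K" for c
    using that dK by (simp add: scalar_def lin_scalar)
  then show ?thesis
    unfolding derivation_def
    using dK band_derivation_mult[OF d] by (auto simp: lin_add intro!: lin_leibniz)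
qed

text \<open>A derivation kills the scalars, so it is K-linear and determined by its values on the
  band.\<close>

lemma
  assumes D: "derivation D"
  shows band_derivation_single: "band_derivation (\<lambda>b. D (single b))"
    and derivation_eq_lin: "f \<in> carrier A \<Longrightarrow> D f = lin (\<lambda>b. D (single b)) f"
proof -
  note DK = derivationD(1)[OF D] and D_add = derivationD(2)[OF D] and D_mult = derivationD(3)[OF D]
    and D_scalar = derivationD(4)[OF D]
  show "band_derivation (\<lambda>b. D (single b))"
    unfolding band_derivation_def
    by (auto simp: DK D_mult simp flip: single_mult)
  have dK: "(\<lambda>b. D (single b)) \<in> carrier B \<rightarrow> carrier K" by (simp add: DK)
  show "D f = lin (\<lambda>b. D (single b)) f" if "f \<in> carrier A"
    using that
  proof (induction f rule: algebra_induct)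
    case zero
    have "D \<zero>\<^bsub>A\<^esub> = \<zero>\<^bsub>K\<^esub>" using D_scalar[of "\<zero>\<^bsub>K\<^esub>"] by simp
    then show ?case using dK by (simp add: lin_zero)
  next
    case (single c b)
    have "D (c \<odot>\<^bsub>A\<^esub> single b) = D (scalar c \<otimes>\<^bsub>A\<^esub> single b)"
      using single by (simp add: scalar_def scalar_mult)
    also have "\<dots> = c \<otimes>\<^bsub>K\<^esub> D (single b)"
      using single by (simp add: D_mult D_scalar DK)
    finally show ?case using single dK by (simp add: lin_smult)
  next
    case (add f g)
    then show ?case using dK by (simp add: D_add lin_add)
  qed
qed

lemma lin_inner:
  assumes "f \<in> carrier A" "c \<in> carrier K"
    and d: "\<And>b. b \<in> carrier B \<Longrightarrow> d b = c \<otimes>\<^bsub>K\<^esub> (chi Y b \<ominus>\<^bsub>K\<^esub> chi X b)"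
  shows "lin d f = c \<otimes>\<^bsub>K\<^esub> (lin (chi Y) f \<ominus>\<^bsub>K\<^esub> lin (chi X) f)"
proof -
  have "lin d f = lin (\<lambda>b. c \<otimes>\<^bsub>K\<^esub> chi Y b \<oplus>\<^bsub>K\<^esub> (\<ominus>\<^bsub>K\<^esub> c) \<otimes>\<^bsub>K\<^esub> chi X b) f"
    using assms by (intro lin_cong) (auto simp: d K.minus_eq K.r_distr K.r_minus K.l_minus)
  also have "\<dots> = c \<otimes>\<^bsub>K\<^esub> lin (chi Y) f \<oplus>\<^bsub>K\<^esub> (\<ominus>\<^bsub>K\<^esub> c) \<otimes>\<^bsub>K\<^esub> lin (chi X) f"
    using assms by (subst lin_add_right) (auto simp: lin_smult_right)
  finally show ?thesis
    using assms by (simp add: K.minus_eq K.r_distr K.r_minus K.l_minus)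
qed

lemma derivation_inner:
  assumes D: "derivation D" and c: "c \<in> carrier K"
    and "\<And>b. b \<in> carrier B \<Longrightarrow> D (single b) = c \<otimes>\<^bsub>K\<^esub> (chi Y b \<ominus>\<^bsub>K\<^esub> chi X b)"
  shows "\<exists>c\<in>carrier K. \<forall>f\<in>carrier A. D f = c \<otimes>\<^bsub>K\<^esub> (lin (chi Y) f \<ominus>\<^bsub>K\<^esub> lin (chi X) f)"
proof (intro bexI ballI)
  fix f assume f: "f \<in> carrier A"
  show "D f = c \<otimes>\<^bsub>K\<^esub> (lin (chi Y) f \<ominus>\<^bsub>K\<^esub> lin (chi X) f)"
    using derivation_eq_lin[OF D f] lin_inner[OF f c assms(3)] by (rule trans)
qed (fact c)

lemma band_derivation_inner:
  assumes d: "band_derivation d" and "\<not> X \<subset> Y"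
  obtains c where "c \<in> carrier K"
    "\<And>b. b \<in> carrier B \<Longrightarrow> d b = c \<otimes>\<^bsub>K\<^esub> (chi Y b \<ominus>\<^bsub>K\<^esub> chi X b)"
proof (cases "X = Y")
  case True
  show ?thesis
  proof (rule that[of "\<zero>\<^bsub>K\<^esub>"])
    show "d b = \<zero>\<^bsub>K\<^esub> \<otimes>\<^bsub>K\<^esub> (chi Y b \<ominus>\<^bsub>K\<^esub> chi X b)" if "b \<in> carrier B" for b
      using band_derivation_vanishes[OF d that] True by simp
  qed simp
next
  case False
  obtain e where e: "e \<in> carrier B" "support B e = Y" using Y by (auto simp: support_lattice_def)
  \<comment> \<open>\<open>chi X e\<close> is 0 because \<open>X\<close>, being neither equal to
    \<open>Y\<close> nor strictly below it, is not contained in \<open>Y\<close>.\<close>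
  have chi_e: "chi Y e = \<one>\<^bsub>K\<^esub>" "chi X e = \<zero>\<^bsub>K\<^esub>" using e assms(2) False by (auto simp: chi_def)
  show ?thesis
  proof (rule that)
    \<comment> \<open>The constant is \<open>d e\<close>; it is the only value of \<open>d\<close>
      besides \<open>d b\<close> that survives in the two expansions.\<close>
    show "d e \<in> carrier K" using d e(1) by (rule band_derivation_closed)
    fix b assume b: "b \<in> carrier B"
    note [simp] = band_derivation_closed[OF d b] band_derivation_closed[OF d e(1)]
    \<comment> \<open>compare the Leibniz expansions of \<open>e \<otimes> b \<otimes> e\<close> and \<open>e \<otimes> b\<close>\<close>
    have "d (e \<otimes>\<^bsub>B\<^esub> b \<otimes>\<^bsub>B\<^esub> e) = chi Y b \<otimes>\<^bsub>K\<^esub> d e"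
      using band_derivation_mult[OF d, of "e \<otimes>\<^bsub>B\<^esub> b" e] band_derivation_closed[OF d, of "e \<otimes>\<^bsub>B\<^esub> b"]
        b e chi_e by (simp add: chi_mult Y)
    moreover have "d (e \<otimes>\<^bsub>B\<^esub> b \<otimes>\<^bsub>B\<^esub> e) = d b \<oplus>\<^bsub>K\<^esub> d e \<otimes>\<^bsub>K\<^esub> chi X b"
      using band_derivation_mult[OF d e(1) b] b e chi_e by (simp add: B.regular)
    ultimately have *: "chi Y b \<otimes>\<^bsub>K\<^esub> d e = d b \<oplus>\<^bsub>K\<^esub> d e \<otimes>\<^bsub>K\<^esub> chi X b"
      by simp
    have "chi Y b \<otimes>\<^bsub>K\<^esub> d e \<ominus>\<^bsub>K\<^esub> d e \<otimes>\<^bsub>K\<^esub> chi X b = d b"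
      unfolding * by (simp add: K.minus_eq K.a_assoc K.r_neg)
    then show "d b = d e \<otimes>\<^bsub>K\<^esub> (chi Y b \<ominus>\<^bsub>K\<^esub> chi X b)"
      by (simp add: K.minus_eq K.r_distr K.r_minus K.m_comm)
  qed
qed

lemma one_dim_module_pairE:
  fixes S :: "('b \<Rightarrow> 'k, 's) module" and T :: "('b \<Rightarrow> 'k, 't) module"
  assumes "left_module A S" "modules_isomorphic A S (support_module K B X)"
    and "left_module A T" "modules_isomorphic A T (support_module K B Y)"
  obtains \<theta> \<eta> where "one_dim_module_pair K A (lin (chi X)) (lin (chi Y)) S T \<theta> \<eta>"
proof -
  obtain \<theta> \<eta> where "\<theta> \<in> module_hom A S (support_module K B X)" "bij_betw \<theta> (carrier S) (carrier K)"
    "\<eta> \<in> module_hom A T (support_module K B Y)" "bij_betw \<eta> (carrier T) (carrier K)"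
    using assms(2,4) by (auto simp: modules_isomorphic_def support_module_simps)
  then have "one_dim_module_pair K A (lin (chi X)) (lin (chi Y)) S T \<theta> \<eta>"
    using assms(1,3)
    by (intro one_dim_module_pair.intro one_dim_module_pair_axioms.intro algebra_characters_axioms)
      (auto simp: module_hom_def support_module_simps support_module_smult bij_betw_def Pi_def)
  then show ?thesis by (rule that)
qed

lemma vs_dim_ext1_eq_0:
  fixes S :: "('b \<Rightarrow> 'k, 's) module" and T :: "('b \<Rightarrow> 'k, 't) module"
  assumes "left_module A S" "modules_isomorphic A S (support_module K B X)"
    and "left_module A T" "modules_isomorphic A T (support_module K B Y)"
    and "\<not> X \<subset> Y"
  shows "vs_dim K (ext1 A S T) = 0"
proof -
  obtain \<theta> \<eta> where "one_dim_module_pair K A (lin (chi X)) (lin (chi Y)) S T \<theta> \<eta>"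
    using one_dim_module_pairE assms(1-4) by blast
  then interpret P: one_dim_module_pair K A "lin (chi X)" "lin (chi Y)" S T \<theta> \<eta> .
  \<comment> \<open>All derivations are inner, so the empty family of functionals has the right
    common kernel.\<close>
  have "vs_dim K (ext1 A S T) = enat (card ({} :: unit set))"
  proof (rule P.vs_dim_ext1)
    fix D assume D: "derivation D"
    obtain c where c: "c \<in> carrier K"
      "\<And>b. b \<in> carrier B \<Longrightarrow> D (single b) = c \<otimes>\<^bsub>K\<^esub> (chi Y b \<ominus>\<^bsub>K\<^esub> chi X b)"
      using band_derivation_inner[OF band_derivation_single[OF D] assms(5)] by blast
    with D show "\<exists>c\<in>carrier K. \<forall>a\<in>carrier A. D a = c \<otimes>\<^bsub>K\<^esub> (lin (chi Y) a \<ominus>\<^bsub>K\<^esub> lin (chi X) a)"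
      by (rule derivation_inner)
  qed auto
  then show ?thesis by (simp add: zero_enat_def)
qed

end

section \<open>The case X < Y: derivations and components of the interval\<close>

locale lrb_algebra_interval = lrb_algebra_pair K B X Y
  for K :: "('k, 'c) ring_scheme" and B :: "('b, 'd) monoid_scheme" and X Y +
  fixes e
  assumes XY: "X \<subset> Y" and e_carrier: "e \<in> carrier B" and support_e: "support B e = Y"
begin

lemmas e = e_carrier support_e

abbreviation interval where "interval \<equiv> band_interval B X e"

lemma e_mult_eq_iff: "b \<in> carrier B \<Longrightarrow> e \<otimes>\<^bsub>B\<^esub> b = e \<longleftrightarrow> Y \<subseteq> support B b"
  using B.support_subset_iff[of e b] e by simp

text \<open>For b below e, equality with e can be read off the support: if \<open>Y\<close> is
  contained in the support of b, then b = eb = e.\<close>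

lemma interval_iff:
  "b \<in> interval \<longleftrightarrow> b \<in> carrier B \<and> e \<otimes>\<^bsub>B\<^esub> b = b \<and> X \<subseteq> support B b \<and> \<not> Y \<subseteq> support B b"
  using e_mult_eq_iff[of b] by (auto simp: band_interval_def band_le_def)

text \<open>Passing from b to eb lands below e and affects neither condition, as the support of e
  contains both \<open>X\<close> and \<open>Y\<close>. This is how functions on the interval are
  transported to the band.\<close>

lemma e_mult_in_interval_iff:
  assumes "b \<in> carrier B"
  shows "e \<otimes>\<^bsub>B\<^esub> b \<in> interval \<longleftrightarrow> X \<subseteq> support B b \<and> \<not> Y \<subseteq> support B b"
proof -
  have "e \<otimes>\<^bsub>B\<^esub> (e \<otimes>\<^bsub>B\<^esub> b) = e \<otimes>\<^bsub>B\<^esub> b"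
    using assms e by (simp add: B.idem flip: B.m_assoc)
  then show ?thesis
    using assms e XY by (auto simp: interval_iff B.support_mult_iff[OF X] B.support_mult_iff[OF Y])
qed

sublocale comps: order_complex_components "band_le B" interval
  by unfold_locales (simp add: interval_iff band_le_def B.idem)

text \<open>Both characters are 1 at e, so d(e) = 0 and the product rule gives d(eb) = d(b). If a =
  ba with a and b in the interval, then \<open>chi Y b\<close> is 0 and \<open>chi X a\<close> is 1,
  and the rule for ba reduces to d(a) = d(b).\<close>

lemma band_derivation_on_interval:
  assumes d: "band_derivation d"
  shows "\<And>b. b \<in> carrier B \<Longrightarrow> d (e \<otimes>\<^bsub>B\<^esub> b) = d b"
    and "\<And>a b. \<lbrakk>a \<in> interval; b \<in> interval; band_le B a b\<rbrakk> \<Longrightarrow> d a = d b"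
proof -
  have "d e = \<zero>\<^bsub>K\<^esub>" using band_derivation_vanishes[OF d] e XY by blast
  then show "d (e \<otimes>\<^bsub>B\<^esub> b) = d b" if "b \<in> carrier B" for b
    using band_derivation_mult[OF d e(1) that] band_derivation_closed[OF d that] e by (simp add: chi_def)
  show "d a = d b" if "a \<in> interval" "b \<in> interval" "band_le B a b" for a b
    using that band_derivation_mult[OF d, of b a] band_derivation_closed[OF d]
    by (simp add: interval_iff band_le_def chi_def)
qed

text \<open>If the support of a contains \<open>Y\<close>, then ea = e and eab = eb. Otherwise the
  product rule demands that eab lie in C iff ea does and the support of b contains \<open>X\<close>;
  this holds since eab \<le> ea, and comparable elements of the interval share a component.\<close>

lemma band_derivation_component:
  assumes C: "C \<in> comps.components"
  shows "band_derivation (\<lambda>b. if e \<otimes>\<^bsub>B\<^esub> b \<in> C then \<one>\<^bsub>K\<^esub> else \<zero>\<^bsub>K\<^esub>)"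
proof -
  have sub: "C \<subseteq> interval" using C by (rule comps.component_subset)
  have closed: "e \<otimes>\<^bsub>B\<^esub> (a \<otimes>\<^bsub>B\<^esub> b) \<in> C \<longleftrightarrow> e \<otimes>\<^bsub>B\<^esub> a \<in> C"
    if a: "a \<in> carrier B" and b: "b \<in> carrier B" "X \<subseteq> support B b" and "\<not> Y \<subseteq> support B a" for a b
  proof (cases "X \<subseteq> support B a")
    case True
    have "band_le B (e \<otimes>\<^bsub>B\<^esub> (a \<otimes>\<^bsub>B\<^esub> b)) (e \<otimes>\<^bsub>B\<^esub> a)"
    proof -
      have "e \<otimes>\<^bsub>B\<^esub> a \<otimes>\<^bsub>B\<^esub> (e \<otimes>\<^bsub>B\<^esub> a \<otimes>\<^bsub>B\<^esub> b) = e \<otimes>\<^bsub>B\<^esub> a \<otimes>\<^bsub>B\<^esub> b"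
        using a b e by (simp add: B.idem flip: B.m_assoc[of "e \<otimes>\<^bsub>B\<^esub> a" "e \<otimes>\<^bsub>B\<^esub> a" b])
      then show ?thesis using a b e by (simp add: band_le_def B.m_assoc)
    qed
    moreover have "e \<otimes>\<^bsub>B\<^esub> (a \<otimes>\<^bsub>B\<^esub> b) \<in> interval" "e \<otimes>\<^bsub>B\<^esub> a \<in> interval"
      using a b that(4) True
      by (simp_all add: e_mult_in_interval_iff B.support_mult_iff[OF X] B.support_mult_iff[OF Y])
    ultimately show ?thesis using comps.component_closed[OF C] by blast
  next
    case False
    then show ?thesis
      using sub a b e_mult_in_interval_iff[of a] e_mult_in_interval_iff[of "a \<otimes>\<^bsub>B\<^esub> b"]
      by (auto simp: B.support_mult_iff[OF X])
  qed
  have in_C: "X \<subseteq> support B b \<and> \<not> Y \<subseteq> support B b" if "b \<in> carrier B" "e \<otimes>\<^bsub>B\<^esub> b \<in> C" for b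
    using that sub e_mult_in_interval_iff by blast
  have "(if e \<otimes>\<^bsub>B\<^esub> (a \<otimes>\<^bsub>B\<^esub> b) \<in> C then \<one>\<^bsub>K\<^esub> else \<zero>\<^bsub>K\<^esub>) =
      chi Y a \<otimes>\<^bsub>K\<^esub> (if e \<otimes>\<^bsub>B\<^esub> b \<in> C then \<one>\<^bsub>K\<^esub> else \<zero>\<^bsub>K\<^esub>) \<oplus>\<^bsub>K\<^esub>
      (if e \<otimes>\<^bsub>B\<^esub> a \<in> C then \<one>\<^bsub>K\<^esub> else \<zero>\<^bsub>K\<^esub>) \<otimes>\<^bsub>K\<^esub> chi X b"
    if a: "a \<in> carrier B" and b: "b \<in> carrier B" for a b
  proof (cases "Y \<subseteq> support B a")
    case True
    then have "e \<otimes>\<^bsub>B\<^esub> a = e" using a by (simp add: e_mult_eq_iff)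
    moreover have "e \<otimes>\<^bsub>B\<^esub> (a \<otimes>\<^bsub>B\<^esub> b) = e \<otimes>\<^bsub>B\<^esub> a \<otimes>\<^bsub>B\<^esub> b" using a b e by (simp add: B.m_assoc)
    \<comment> \<open>The interval excludes \<open>e\<close>, so the summand with ea
      vanishes.\<close>
    moreover have "e \<notin> C" using sub by (auto simp: interval_iff e)
    ultimately show ?thesis using True by (simp add: chi_def)
  next
    case False
    show ?thesis
    proof (cases "X \<subseteq> support B b")
      case True
      then show ?thesis using closed[OF a b True False] False by (simp add: chi_def)
    next
      case nX: False
      then have "e \<otimes>\<^bsub>B\<^esub> (a \<otimes>\<^bsub>B\<^esub> b) \<notin> C"
        using in_C[of "a \<otimes>\<^bsub>B\<^esub> b"] a b by (auto simp: B.support_mult_iff[OF X])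
      then show ?thesis using False nX by (simp add: chi_def)
    qed
  qed
  then show ?thesis by (auto simp: band_derivation_def)
qed

text \<open>The functionals are d(r_C) - d(r_C0), one for each component other than
  \<open>C0\<close>. Such differences kill inner derivations, which are constant on the interval;
  the indicators of components supply the dual family.\<close>

lemma vs_dim_ext1_eq_components:
  fixes S :: "('b \<Rightarrow> 'k, 's) module" and T :: "('b \<Rightarrow> 'k, 't) module"
  assumes "left_module A S" "modules_isomorphic A S (support_module K B X)"
    and "left_module A T" "modules_isomorphic A T (support_module K B Y)"
  shows "vs_dim K (ext1 A S T) + 1 = enat (card comps.components)"
proof -
  obtain \<theta> \<eta> where "one_dim_module_pair K A (lin (chi X)) (lin (chi Y)) S T \<theta> \<eta>"
    using one_dim_module_pairE assms by blast
  then interpret P: one_dim_module_pair K A "lin (chi X)" "lin (chi Y)" S T \<theta> \<eta> .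
  have fin: "finite comps.components"
    using finite_band by (intro comps.finite_components) (simp add: band_interval_def)
  \<comment> \<open>The interval is never empty: it contains ef for any f of support
    \<open>X\<close>. So there is a base component to subtract.\<close>
  obtain f where f: "f \<in> carrier B" "support B f = X" using X by (auto simp: support_lattice_def)
  then have "e \<otimes>\<^bsub>B\<^esub> f \<in> interval" using XY by (auto simp: e_mult_in_interval_iff)
  then obtain C0 where C0: "C0 \<in> comps.components" using comps.component_exists by blast
  define I where "I = comps.components - {C0}"
  define r where "r C = (SOME b. b \<in> C)" for C :: "'b set"
  have r: "r C \<in> C" if "C \<in> comps.components" for C
    unfolding r_def using comps.component_nonempty[OF that] by (simp add: some_in_eq)
  have r_int: "r C \<in> interval" if "C \<in> comps.components" for C
    using r[OF that] comps.component_subset[OF that] by auto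
  then have r_B: "r C \<in> carrier B" if "C \<in> comps.components" for C
    using that by (simp add: interval_iff)
  define p where "p C = single (r C) \<oplus>\<^bsub>A\<^esub> (\<ominus>\<^bsub>K\<^esub> \<one>\<^bsub>K\<^esub>) \<odot>\<^bsub>A\<^esub> single (r C0)" for C
  have lin_p: "lin u (p C) = u (r C) \<ominus>\<^bsub>K\<^esub> u (r C0)"
    if "C \<in> comps.components" "u \<in> carrier B \<rightarrow> carrier K" for u C
    using that C0 r_B
    by (simp add: p_def lin_add lin_smult smult_closed K.l_minus K.minus_eq Pi_def)
  have "vs_dim K (ext1 A S T) = enat (card I)"
  proof (rule P.vs_dim_ext1[of I p])
    show "finite I" using fin by (simp add: I_def)
    show "p \<in> I \<rightarrow> carrier A" by (simp add: p_def smult_closed)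
    \<comment> \<open>On the interval \<open>chi Y\<close> is 0 and \<open>chi X\<close> is 1, so
      both characters vanish at the difference of two of its elements.\<close>
    show "lin (chi Y) (p C) = lin (chi X) (p C)" if "C \<in> I" for C
      using that r_int[of C] r_int[OF C0] C0 by (simp add: lin_p I_def interval_iff chi_def K.minus_eq K.r_neg)
    show "\<exists>D. derivation D \<and> (\<forall>C\<in>I. D (p C) = (if C = C' then \<one>\<^bsub>K\<^esub> else \<zero>\<^bsub>K\<^esub>))" if C': "C' \<in> I" for C'
    proof (intro exI conjI ballI)
      let ?d = "\<lambda>b. if e \<otimes>\<^bsub>B\<^esub> b \<in> C' then \<one>\<^bsub>K\<^esub> else \<zero>\<^bsub>K\<^esub>"
      show "derivation (lin ?d)"
        using C' by (intro derivation_lin band_derivation_component) (simp add: I_def)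
      fix C assume C: "C \<in> I"
      \<comment> \<open>A representative satisfies e r_D = r_D, and components are disjoint. At the
        base component the value is 0, because \<open>C'\<close> differs from
        \<open>C0\<close>.\<close>
      have d_r: "?d (r D) = (if D = C' then \<one>\<^bsub>K\<^esub> else \<zero>\<^bsub>K\<^esub>)" if "D \<in> comps.components" for D
        using r[OF that] r_int[OF that] comps.component_unique[OF that, of C' "r D"] C'
        by (auto simp: interval_iff I_def)
      show "lin ?d (p C) = (if C = C' then \<one>\<^bsub>K\<^esub> else \<zero>\<^bsub>K\<^esub>)"
        using C C' C0 d_r by (subst lin_p) (auto simp: I_def K.minus_eq simp del: if_splits)
    qed
    fix D assume D: "derivation D" and zero: "\<forall>C\<in>I. D (p C) = \<zero>\<^bsub>K\<^esub>"
    define d where "d b = D (single b)" for b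
    have d: "band_derivation d" unfolding d_def[abs_def] using D by (rule band_derivation_single)
    note d_closed = band_derivation_closed[OF d]
    have D_lin: "D f = lin d f" if "f \<in> carrier A" for f
      unfolding d_def[abs_def] using derivation_eq_lin[OF D that] .
    have d_r: "d (r C) = d (r C0)" if C: "C \<in> comps.components" for C
    proof (cases "C = C0")
      case False
      then have "lin d (p C) = \<zero>\<^bsub>K\<^esub>"
        using zero D_lin[of "p C"] C by (simp add: I_def p_def smult_closed)
      moreover have "d \<in> carrier B \<rightarrow> carrier K" using d_closed by auto
      ultimately have "d (r C) \<ominus>\<^bsub>K\<^esub> d (r C0) = \<zero>\<^bsub>K\<^esub>" using lin_p C by simp
      then show ?thesis using d_closed r_B C C0 by simp
    qed simp
    have const: "d b = d (r C0)" if b: "b \<in> interval" for b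
    proof -
      obtain C where C: "C \<in> comps.components" "b \<in> C" using comps.component_exists[OF b] by blast
      then have "d b = d (r C)"
        using comps.component_constant[of C b "r C" d] r band_derivation_on_interval(2)[OF d] by blast
      then show ?thesis using d_r C by simp
    qed
    have c: "d (r C0) \<in> carrier K" using d_closed r_B C0 by blast
    \<comment> \<open>The sign is there because \<open>chi Y\<close> minus \<open>chi X\<close> is
      -1 on the interval.\<close>
    have "d b = (\<ominus>\<^bsub>K\<^esub> d (r C0)) \<otimes>\<^bsub>K\<^esub> (chi Y b \<ominus>\<^bsub>K\<^esub> chi X b)" if b: "b \<in> carrier B" for b
    proof (cases "X \<subseteq> support B b \<longleftrightarrow> Y \<subseteq> support B b")
      case True
      then show ?thesis
        using band_derivation_vanishes[OF d b True] c by (auto simp: chi_def K.minus_eq K.r_neg)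
    next
      case False
      then have *: "X \<subseteq> support B b" "\<not> Y \<subseteq> support B b" using XY by auto
      then have "d b = d (r C0)"
        using const[of "e \<otimes>\<^bsub>B\<^esub> b"] b band_derivation_on_interval(1)[OF d b]
        by (simp add: e_mult_in_interval_iff)
      then show ?thesis using * c by (simp add: chi_def K.minus_eq K.r_minus K.l_minus)
    qed
    then show "\<exists>c\<in>carrier K. \<forall>a\<in>carrier A. D a = c \<otimes>\<^bsub>K\<^esub> (lin (chi Y) a \<ominus>\<^bsub>K\<^esub> lin (chi X) a)"
      using c by (intro derivation_inner[OF D, of "\<ominus>\<^bsub>K\<^esub> d (r C0)"]) (simp_all add: d_def)
  qed
  moreover have "card I + 1 = card comps.components"
    unfolding I_def using card_Suc_Diff1[OF fin C0] by linarith
  ultimately show ?thesis by (simp add: one_enat_def)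
qed

end

text \<open>Being one less is expressed by adding 1 to the number of arrows; the equation also
  forces that number to be finite. Quantifying over every \<open>e\<close> with support
  \<open>Y\<close> covers all choices of \<open>e\<close>.\<close>

theorem theorem4p2:
  fixes K :: "('k, 'c) ring_scheme" and B :: "('b, 'd) monoid_scheme"
  assumes "field K"
    and "left_regular_band B"
    and "finite (carrier B)"
  shows "let Q = gabriel_quiver K (monoid_algebra K B);
             vertex = (\<lambda>X. simple_class (monoid_algebra K B) (support_module K B X))
         in bij_betw vertex (support_lattice B) (verts Q) \<and>
            (\<forall>X\<in>support_lattice B. \<forall>Y\<in>support_lattice B.
               (\<not> X \<subset> Y \<longrightarrow> num_arrows Q (vertex X) (vertex Y) = 0) \<and>
               (X \<subset> Y \<longrightarrow> (\<forall>e\<in>carrier B. support B e = Y \<longrightarrow>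
                  num_arrows Q (vertex X) (vertex Y) + 1 =
                    enat (card (complex_components
                      (order_complex (band_le B) (band_interval B X e)))))))"
proof -
  interpret lrb_algebra K B
    using assms by (intro lrb_algebra.intro lrb_algebra_axioms.intro)
  let ?v = "\<lambda>X. simple_class A (support_module K B X)"
  \<comment> \<open>The representative selected by \<open>num_arrows\<close>; what is used of it is
    that it is a module isomorphic to the one of \<open>X\<close>.\<close>
  define M where "M X = (SOME S. S \<in> ?v X)" for X
  have "M X \<in> ?v X" if X: "X \<in> support_lattice B" for X
  proof -
    obtain S where "S \<in> ?v X"
      using simple_module_realization[OF simple_support_module[OF X]] by (auto simp: simple_class_def)
    then show ?thesis unfolding M_def by (rule someI)
  qed
  then have M: "left_module A (M X)" "modules_isomorphic A (M X) (support_module K B X)"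
    if "X \<in> support_lattice B" for X
    using that by (auto simp: simple_class_def simple_module_def)
  have arrows: "num_arrows (gabriel_quiver K A) (?v X) (?v Y) = vs_dim K (ext1 A (M X) (M Y))" for X Y
    by (simp add: gabriel_quiver_def M_def)
  have pair: "lrb_algebra_pair K B X Y" if "X \<in> support_lattice B" "Y \<in> support_lattice B" for X Y
    using that lrb_algebra_axioms by (intro lrb_algebra_pair.intro lrb_algebra_pair_axioms.intro)
  have "bij_betw ?v (support_lattice B) (verts (gabriel_quiver K A))"
    using vertex_bij_betw by (simp add: gabriel_quiver_def)
  moreover have "num_arrows (gabriel_quiver K A) (?v X) (?v Y) = 0"
    if "X \<in> support_lattice B" "Y \<in> support_lattice B" "\<not> X \<subset> Y" for X Y
    unfolding arrows using lrb_algebra_pair.vs_dim_ext1_eq_0[OF pair] M that by blast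
  moreover have "num_arrows (gabriel_quiver K A) (?v X) (?v Y) + 1 =
      enat (card (complex_components (order_complex (band_le B) (band_interval B X e))))"
    if "X \<in> support_lattice B" "Y \<in> support_lattice B" "X \<subset> Y" "e \<in> carrier B" "support B e = Y" for X Y e
  proof -
    interpret lrb_algebra_interval K B X Y e
      using that pair by (intro lrb_algebra_interval.intro lrb_algebra_interval_axioms.intro)
    show ?thesis unfolding arrows using vs_dim_ext1_eq_components M that by blast
  qed
  ultimately show ?thesis by (simp add: Let_def)
qed

end
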